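(* For each pair of weaknesses $w' \leq w$ in $\{s,p,l,c\}$, $\mathcal F$-sketches and $(w', w)$-natural $\mathcal F$-multimodels form a multicategory structure $\mathcal F\text{-}\mathrm{SK}_{w', w}$ on the category $\mathcal F\text{-}\mathrm{SK}$ of $\mathcal F$-sketches and sketch morphisms. Furthermore, the forgetful functor of multicategories $\mathcal F\text{-}\mathrm{SK}_{w', w} \to \mathcal F\text{-}\mathrm{CAT}_{w', w}$, sending an $\mathcal F$-sketch to its underlying $\mathcal F$-category, has a fully faithful left adjoint $(-)^\sharp$.
   Context: **$\mathcal F$-categories.** $\mathcal F$ is the full subcategory of the arrow category $\mathrm{CAT}^{\to}$ of the category of small categories spanned by the full embeddings $A\colon A_\tau \to A_\lambda$ (fully faithful, injective-on-objects functors); it is complete, cocomplete and cartesian closed. An $\mathcal F$-category $\mathbb C$ is a category enriched in $\mathcal F$; equivalently, a 2-category $\mathbb C_\lambda$, whose 1-cells are called loose morphisms, with a wide, locally full sub-2-category $\mathbb C_\tau$, whose 1-cells are called tight. An $\mathcal F$-functor is a 2-functor $\mathbb C_\lambda\to\mathbb D_\lambda$ preserving tightness. $\mathcal F$ itself is an $\mathcal F$-category $\mathbb F$: loose morphisms $A\to B$ are functors $A_\lambda\to B_\lambda$, the tight ones are those restricting to $A_\tau \to B_\tau$, 2-cells are natural transformations. All $\mathcal F$-categories and sketches are small. **Weaknesses.** The weaknesses $\{s,p,l,c\}$ (strict, pseudo, lax, colax) are ordered by $s\le p$, $p\le l$, $p\le c$, with involution $\overline{(-)}$ fixing $s,p$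 and exchanging $l,c$. For a square with top $f$, left $g$, right $h$, bottom $k$: an $l$-cell is a 2-cell $hf\Rightarrow kg$; a $c$-cell is a 2-cell $kg\Rightarrow hf$; a $p$-cell is an invertible $l$-cell (inverses being taken where the direction must be reversed); an $s$-cell is an identity. A loose $w$-natural transformation $\phi\colon M\Rightarrow N$ between $\mathcal F$-functors $\mathbb S\to\mathbb C$ has loose components $\phi_S$ and, for each loose $s\colon S\to S'$, a $w$-cell $\phi_s$ in the square with top $\phi_S$, left $M(s)$, right $N(s)$, bottom $\phi_{S'}$, subject to the usual (2-natural/pseudonatural/lax/colax) axioms. **Multifunctors.** For $n>0$, a $(w',w)$-natural $\mathcal F$-multifunctor $M\colon(\mathbb S_1,\dots,\mathbb S_n)\to\mathbb C$ consists of: (1) objects $M(S_1,\dots,S_n)\in\mathbb C$, each assignment $M(S_1,\dots,-_i,\dots,S_n)$ being equipped with the structure of an $\mathcal F$-functor $\mathbb S_i\to\mathbb C$; (2) for $i<j$ and loose $s_i\colon S_i\to S_i'$, $s_j\colon S_j\to S_j'$ (other arguments fixed and suppressed), a $w$-cell $M(s_i,s_j)$ in the square with top $M(s_i,S_j)$, left $M(S_i,s_j)$, right $M(S_i',s_j)$, bottom $M(s_i,S_j')$, such that (a) $M(s_i,s_j)$ is a $w'$-cell if $s_i$ or $s_j$ is tight; (b) the cells $M(s_i,-_j)$ form a loose $w$-natural transformation $M(S_i,-_j)\Rightarrow M(S_i',-_j)$; (c) the cells $M(-_i,s_j)$ form a loose $\overline w$-natural transformation $M(-_i,S_j)\Rightarrow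 M(-_i,S_j')$; (d) for $i<j<k$ and loose $s_i,s_j,s_k$, the cubical compatibility condition: the two composite 2-cells between the composites (first $s_i$, then $s_j$, then $s_k$) and (first $s_k$, then $s_j$, then $s_i$) obtained by pasting the cells on the faces of the cube are equal. A nullary multifunctor to $\mathbb C$ is an object of $\mathbb C$. $\mathcal F$-categories and $(w',w)$-natural $\mathcal F$-multifunctors form a multicategory $\mathcal F\text{-}\mathrm{CAT}_{w',w}$ under substitution. **Sketches.** An $\mathcal F$-weight is an $\mathcal F$-functor $W\colon\mathbb J\to\mathbb F$ with $\mathbb J$ small; a $W$-weighted cone over $D\colon\mathbb J\to\mathbb S$ is an object $X$ with an $\mathcal F$-natural transformation $W\Rightarrow\mathbb S(X,D-)$. A (limit) $\mathcal F$-sketch $\mathcal S$ is a small $\mathcal F$-category $\mathbb S$ with a class of weighted cones. A sketch morphism (also called a model of $\mathcal S$ in $\mathcal C$) is an $\mathcal F$-functor sending specified cones to specified cones. **Multimodels.** For $n>0$, a $(w',w)$-natural $\mathcal F$-multimodel from $\mathcal S_1,\dots,\mathcal S_n$ to $\mathcal C$ is a $(w',w)$-natural $\mathcal F$-multifunctor $M\colon(\mathbb S_1,\dots,\mathbb S_n)\to\mathbb C$ such that each $M(S_1,\dots,-_i,\dots,S_n)$ is a model of $\mathcal S_i$ in $\mathcal C$. A nullary multimodel to $\mathcal C$ is an object of $\mathbb C$. *)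

theory Defs
  imports Main "HOL-Library.FuncSet"
begin

text \<open>
  Conventions. Structures are records over carrier sets; the operations of a structure take the
  value \<^term>\<open>undefined\<close> outside their domain, so that equality of records is equality of the
  structures they represent. A small category or \<open>\<F>\<close>-category is one whose objects, 1-cells and
  2-cells are elements of a fixed but arbitrary type \<^typ>\<open>'u\<close>.
  All compositions are written in applicative order: the first argument is applied last.
\<close>


section \<open>Categories\<close>

record ('o, 'a) cat =
  CObj :: "'o set"
  CArr :: "'a set"
  cdom :: "'a \<Rightarrow> 'o"
  ccod :: "'a \<Rightarrow> 'o"
  cid :: "'o \<Rightarrow> 'a"
  ccomp :: "'a \<Rightarrow> 'a \<Rightarrow> 'a"

locale category =
  fixes A :: "('o, 'a) cat"
  assumes dom_obj: "f \<in> CArr A \<Longrightarrow> cdom A f \<in> CObj A"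
    and cod_obj: "f \<in> CArr A \<Longrightarrow> ccod A f \<in> CObj A"
    and id_arr: "X \<in> CObj A \<Longrightarrow> cid A X \<in> CArr A \<and> cdom A (cid A X) = X \<and> ccod A (cid A X) = X"
    and comp_arr: "\<lbrakk>f \<in> CArr A; g \<in> CArr A; cdom A g = ccod A f\<rbrakk> \<Longrightarrow>
      ccomp A g f \<in> CArr A \<and> cdom A (ccomp A g f) = cdom A f \<and> ccod A (ccomp A g f) = ccod A g"
    and comp_id_left: "f \<in> CArr A \<Longrightarrow> ccomp A (cid A (ccod A f)) f = f"
    and comp_id_right: "f \<in> CArr A \<Longrightarrow> ccomp A f (cid A (cdom A f)) = f"
    and comp_assoc: "\<lbrakk>f \<in> CArr A; g \<in> CArr A; h \<in> CArr A; cdom A g = ccod A f; cdom A h = ccod A g\<rbrakk> \<Longrightarrow>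
      ccomp A h (ccomp A g f) = ccomp A (ccomp A h g) f"
    and dom_ext: "cdom A \<in> extensional (CArr A)"
    and cod_ext: "ccod A \<in> extensional (CArr A)"
    and id_ext: "cid A \<in> extensional (CObj A)"
    and comp_ext: "\<not> (f \<in> CArr A \<and> g \<in> CArr A \<and> cdom A g = ccod A f) \<Longrightarrow> ccomp A g f = undefined"

record ('o, 'a, 'p, 'b) cfun =
  cobj :: "'o \<Rightarrow> 'p"
  carr :: "'a \<Rightarrow> 'b"

locale cat_functor = A: category A + B: category B
  for A :: "('o, 'a) cat" and B :: "('p, 'b) cat" +
  fixes F :: "('o, 'a, 'p, 'b) cfun"
  assumes map_obj: "X \<in> CObj A \<Longrightarrow> cobj F X \<in> CObj B"
    and map_arr: "f \<in> CArr A \<Longrightarrow> carr F f \<in> CArr B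
      \<and> cdom B (carr F f) = cobj F (cdom A f) \<and> ccod B (carr F f) = cobj F (ccod A f)"
    and map_id: "X \<in> CObj A \<Longrightarrow> carr F (cid A X) = cid B (cobj F X)"
    and map_comp: "\<lbrakk>f \<in> CArr A; g \<in> CArr A; cdom A g = ccod A f\<rbrakk> \<Longrightarrow>
      carr F (ccomp A g f) = ccomp B (carr F g) (carr F f)"
    and obj_ext: "cobj F \<in> extensional (CObj A)"
    and arr_ext: "carr F \<in> extensional (CArr A)"

definition cfun_id :: "('o, 'a) cat \<Rightarrow> ('o, 'a, 'o, 'a) cfun" where
  "cfun_id A = \<lparr>cobj = restrict id (CObj A), carr = restrict id (CArr A)\<rparr>"

definition cfun_comp ::
  "('o, 'a) cat \<Rightarrow> ('p, 'b, 'q, 'c) cfun \<Rightarrow> ('o, 'a, 'p, 'b) cfun \<Rightarrow> ('o, 'a, 'q, 'c) cfun" where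
  "cfun_comp A G F = \<lparr>cobj = compose (CObj A) (cobj G) (cobj F), carr = compose (CArr A) (carr G) (carr F)\<rparr>"

definition nat_trans ::
  "('o, 'a) cat \<Rightarrow> ('p, 'b) cat \<Rightarrow> ('o, 'a, 'p, 'b) cfun \<Rightarrow> ('o, 'a, 'p, 'b) cfun \<Rightarrow> ('o \<Rightarrow> 'b) \<Rightarrow> bool" where
  "nat_trans A B F G \<theta> \<longleftrightarrow>
     cat_functor A B F \<and> cat_functor A B G \<and> \<theta> \<in> extensional (CObj A)
     \<and> (\<forall>X\<in>CObj A. \<theta> X \<in> CArr B \<and> cdom B (\<theta> X) = cobj F X \<and> ccod B (\<theta> X) = cobj G X)
     \<and> (\<forall>f\<in>CArr A. ccomp B (\<theta> (ccod A f)) (carr F f) = ccomp B (carr G f) (\<theta> (cdom A f)))"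

definition cat_isomorphism :: "('o, 'a) cat \<Rightarrow> ('p, 'b) cat \<Rightarrow> ('o, 'a, 'p, 'b) cfun \<Rightarrow> bool" where
  "cat_isomorphism A B F \<longleftrightarrow>
     cat_functor A B F \<and> bij_betw (cobj F) (CObj A) (CObj B) \<and> bij_betw (carr F) (CArr A) (CArr B)"

definition fully_faithful :: "('o, 'a) cat \<Rightarrow> ('p, 'b) cat \<Rightarrow> ('o, 'a, 'p, 'b) cfun \<Rightarrow> bool" where
  "fully_faithful A B F \<longleftrightarrow> (\<forall>X\<in>CObj A. \<forall>Y\<in>CObj A.
     bij_betw (carr F) {f \<in> CArr A. cdom A f = X \<and> ccod A f = Y}
       {g \<in> CArr B. cdom B g = cobj F X \<and> ccod B g = cobj F Y})"


section \<open>\<open>\<F>\<close>-categories and \<open>\<F>\<close>-functors\<close>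

text \<open>
  An \<open>\<F>\<close>-category is given as a (strict) 2-category of loose 1-cells together with a wide, locally full
  sub-2-category, which amounts to a set of tight 1-cells containing identities and closed under
  composition.
\<close>

record ('o, 'a, 'c) fcat =
  Obj :: "'o set"
  Loose :: "'a set"
  Tight :: "'a set"
  Cell :: "'c set"
  fdom :: "'a \<Rightarrow> 'o"
  fcod :: "'a \<Rightarrow> 'o"
  fsrc :: "'c \<Rightarrow> 'a"
  ftrg :: "'c \<Rightarrow> 'a"
  id1 :: "'o \<Rightarrow> 'a"
  comp1 :: "'a \<Rightarrow> 'a \<Rightarrow> 'a"
  id2 :: "'a \<Rightarrow> 'c"
  vcomp :: "'c \<Rightarrow> 'c \<Rightarrow> 'c"
  hcomp :: "'c \<Rightarrow> 'c \<Rightarrow> 'c"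

definition loose_hom :: "('o, 'a, 'c) fcat \<Rightarrow> 'o \<Rightarrow> 'o \<Rightarrow> 'a set" where
  "loose_hom C X Y = {f \<in> Loose C. fdom C f = X \<and> fcod C f = Y}"

definition tight_hom :: "('o, 'a, 'c) fcat \<Rightarrow> 'o \<Rightarrow> 'o \<Rightarrow> 'a set" where
  "tight_hom C X Y = {f \<in> Tight C. fdom C f = X \<and> fcod C f = Y}"

definition cell_hom :: "('o, 'a, 'c) fcat \<Rightarrow> 'a \<Rightarrow> 'a \<Rightarrow> 'c set" where
  "cell_hom C f g = {\<alpha> \<in> Cell C. fsrc C \<alpha> = f \<and> ftrg C \<alpha> = g}"

definition composable1 :: "('o, 'a, 'c) fcat \<Rightarrow> 'a \<Rightarrow> 'a \<Rightarrow> bool" where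
  "composable1 C g f \<longleftrightarrow> f \<in> Loose C \<and> g \<in> Loose C \<and> fdom C g = fcod C f"

definition vcomposable :: "('o, 'a, 'c) fcat \<Rightarrow> 'c \<Rightarrow> 'c \<Rightarrow> bool" where
  "vcomposable C \<beta> \<alpha> \<longleftrightarrow> \<alpha> \<in> Cell C \<and> \<beta> \<in> Cell C \<and> fsrc C \<beta> = ftrg C \<alpha>"

definition hcomposable :: "('o, 'a, 'c) fcat \<Rightarrow> 'c \<Rightarrow> 'c \<Rightarrow> bool" where
  "hcomposable C \<beta> \<alpha> \<longleftrightarrow> \<alpha> \<in> Cell C \<and> \<beta> \<in> Cell C \<and> fdom C (fsrc C \<beta>) = fcod C (fsrc C \<alpha>)"

locale f_category =
  fixes C :: "('o, 'a, 'c) fcat"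
  assumes dom_obj: "f \<in> Loose C \<Longrightarrow> fdom C f \<in> Obj C"
    and cod_obj: "f \<in> Loose C \<Longrightarrow> fcod C f \<in> Obj C"
    and src_loose: "\<alpha> \<in> Cell C \<Longrightarrow> fsrc C \<alpha> \<in> Loose C"
    and trg_loose: "\<alpha> \<in> Cell C \<Longrightarrow> ftrg C \<alpha> \<in> Loose C"
    and cell_parallel: "\<alpha> \<in> Cell C \<Longrightarrow>
      fdom C (fsrc C \<alpha>) = fdom C (ftrg C \<alpha>) \<and> fcod C (fsrc C \<alpha>) = fcod C (ftrg C \<alpha>)"
    \<comment> \<open>1-cells\<close>
    and id1_hom: "X \<in> Obj C \<Longrightarrow> id1 C X \<in> loose_hom C X X"
    and comp1_hom: "composable1 C g f \<Longrightarrow> comp1 C g f \<in> loose_hom C (fdom C f) (fcod C g)"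
    and comp1_id_left: "f \<in> Loose C \<Longrightarrow> comp1 C (id1 C (fcod C f)) f = f"
    and comp1_id_right: "f \<in> Loose C \<Longrightarrow> comp1 C f (id1 C (fdom C f)) = f"
    and comp1_assoc: "\<lbrakk>composable1 C g f; composable1 C h g\<rbrakk> \<Longrightarrow>
      comp1 C h (comp1 C g f) = comp1 C (comp1 C h g) f"
    \<comment> \<open>vertical composition of 2-cells\<close>
    and id2_hom: "f \<in> Loose C \<Longrightarrow> id2 C f \<in> cell_hom C f f"
    and vcomp_hom: "vcomposable C \<beta> \<alpha> \<Longrightarrow> vcomp C \<beta> \<alpha> \<in> cell_hom C (fsrc C \<alpha>) (ftrg C \<beta>)"
    and vcomp_id_left: "\<alpha> \<in> Cell C \<Longrightarrow> vcomp C (id2 C (ftrg C \<alpha>)) \<alpha> = \<alpha>"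
    and vcomp_id_right: "\<alpha> \<in> Cell C \<Longrightarrow> vcomp C \<alpha> (id2 C (fsrc C \<alpha>)) = \<alpha>"
    and vcomp_assoc: "\<lbrakk>vcomposable C \<beta> \<alpha>; vcomposable C \<gamma> \<beta>\<rbrakk> \<Longrightarrow>
      vcomp C \<gamma> (vcomp C \<beta> \<alpha>) = vcomp C (vcomp C \<gamma> \<beta>) \<alpha>"
    \<comment> \<open>horizontal composition of 2-cells\<close>
    and hcomp_hom: "hcomposable C \<beta> \<alpha> \<Longrightarrow>
      hcomp C \<beta> \<alpha> \<in> cell_hom C (comp1 C (fsrc C \<beta>) (fsrc C \<alpha>)) (comp1 C (ftrg C \<beta>) (ftrg C \<alpha>))"
    and hcomp_id_left: "\<alpha> \<in> Cell C \<Longrightarrow> hcomp C (id2 C (id1 C (fcod C (fsrc C \<alpha>)))) \<alpha> = \<alpha>"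
    and hcomp_id_right: "\<alpha> \<in> Cell C \<Longrightarrow> hcomp C \<alpha> (id2 C (id1 C (fdom C (fsrc C \<alpha>)))) = \<alpha>"
    and hcomp_assoc: "\<lbrakk>hcomposable C \<beta> \<alpha>; hcomposable C \<gamma> \<beta>\<rbrakk> \<Longrightarrow>
      hcomp C \<gamma> (hcomp C \<beta> \<alpha>) = hcomp C (hcomp C \<gamma> \<beta>) \<alpha>"
    and hcomp_id2: "composable1 C g f \<Longrightarrow> hcomp C (id2 C g) (id2 C f) = id2 C (comp1 C g f)"
    and interchange: "\<lbrakk>vcomposable C \<alpha>' \<alpha>; vcomposable C \<beta>' \<beta>; hcomposable C \<beta> \<alpha>\<rbrakk> \<Longrightarrow>
      hcomp C (vcomp C \<beta>' \<beta>) (vcomp C \<alpha>' \<alpha>) = vcomp C (hcomp C \<beta>' \<alpha>') (hcomp C \<beta> \<alpha>)"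
    \<comment> \<open>tight 1-cells\<close>
    and tight_loose: "Tight C \<subseteq> Loose C"
    and tight_id1: "X \<in> Obj C \<Longrightarrow> id1 C X \<in> Tight C"
    and tight_comp1: "\<lbrakk>f \<in> Tight C; g \<in> Tight C; fdom C g = fcod C f\<rbrakk> \<Longrightarrow> comp1 C g f \<in> Tight C"
    \<comment> \<open>undefinedness outside the carriers\<close>
    and dom_ext: "fdom C \<in> extensional (Loose C)"
    and cod_ext: "fcod C \<in> extensional (Loose C)"
    and src_ext: "fsrc C \<in> extensional (Cell C)"
    and trg_ext: "ftrg C \<in> extensional (Cell C)"
    and id1_ext: "id1 C \<in> extensional (Obj C)"
    and id2_ext: "id2 C \<in> extensional (Loose C)"
    and comp1_ext: "\<not> composable1 C g f \<Longrightarrow> comp1 C g f = undefined"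
    and vcomp_ext: "\<not> vcomposable C \<beta> \<alpha> \<Longrightarrow> vcomp C \<beta> \<alpha> = undefined"
    and hcomp_ext: "\<not> hcomposable C \<beta> \<alpha> \<Longrightarrow> hcomp C \<beta> \<alpha> = undefined"

definition inverse_cells :: "('o, 'a, 'c) fcat \<Rightarrow> 'c \<Rightarrow> 'c \<Rightarrow> bool" where
  "inverse_cells C \<alpha> \<beta> \<longleftrightarrow> \<alpha> \<in> Cell C \<and> \<beta> \<in> cell_hom C (ftrg C \<alpha>) (fsrc C \<alpha>)
     \<and> vcomp C \<beta> \<alpha> = id2 C (fsrc C \<alpha>) \<and> vcomp C \<alpha> \<beta> = id2 C (ftrg C \<alpha>)"

text \<open>Meaningful for invertible \<open>\<alpha>\<close> only.\<close>
definition inv_cell :: "('o, 'a, 'c) fcat \<Rightarrow> 'c \<Rightarrow> 'c" where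
  "inv_cell C \<alpha> = (THE \<beta>. inverse_cells C \<alpha> \<beta>)"

record ('o, 'a, 'c, 'p, 'b, 'd) ffun =
  fobj :: "'o \<Rightarrow> 'p"
  farr :: "'a \<Rightarrow> 'b"
  fcell :: "'c \<Rightarrow> 'd"

locale f_functor = A: f_category A + B: f_category B
  for A :: "('o, 'a, 'c) fcat" and B :: "('p, 'b, 'd) fcat" +
  fixes F :: "('o, 'a, 'c, 'p, 'b, 'd) ffun"
  assumes map_obj: "X \<in> Obj A \<Longrightarrow> fobj F X \<in> Obj B"
    and map_loose: "f \<in> Loose A \<Longrightarrow> farr F f \<in> loose_hom B (fobj F (fdom A f)) (fobj F (fcod A f))"
    and map_tight: "f \<in> Tight A \<Longrightarrow> farr F f \<in> Tight B"
    and map_cell: "\<alpha> \<in> Cell A \<Longrightarrow> fcell F \<alpha> \<in> cell_hom B (farr F (fsrc A \<alpha>)) (farr F (ftrg A \<alpha>))"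
    and map_id1: "X \<in> Obj A \<Longrightarrow> farr F (id1 A X) = id1 B (fobj F X)"
    and map_comp1: "composable1 A g f \<Longrightarrow> farr F (comp1 A g f) = comp1 B (farr F g) (farr F f)"
    and map_id2: "f \<in> Loose A \<Longrightarrow> fcell F (id2 A f) = id2 B (farr F f)"
    and map_vcomp: "vcomposable A \<beta> \<alpha> \<Longrightarrow> fcell F (vcomp A \<beta> \<alpha>) = vcomp B (fcell F \<beta>) (fcell F \<alpha>)"
    and map_hcomp: "hcomposable A \<beta> \<alpha> \<Longrightarrow> fcell F (hcomp A \<beta> \<alpha>) = hcomp B (fcell F \<beta>) (fcell F \<alpha>)"
    and obj_ext: "fobj F \<in> extensional (Obj A)"
    and arr_ext: "farr F \<in> extensional (Loose A)"
    and cell_ext: "fcell F \<in> extensional (Cell A)"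

definition ffun_id :: "('o, 'a, 'c) fcat \<Rightarrow> ('o, 'a, 'c, 'o, 'a, 'c) ffun" where
  "ffun_id A = \<lparr>fobj = restrict id (Obj A), farr = restrict id (Loose A), fcell = restrict id (Cell A)\<rparr>"

definition ffun_comp ::
  "('o, 'a, 'c) fcat \<Rightarrow> ('p, 'b, 'd, 'q, 'e, 'f) ffun \<Rightarrow> ('o, 'a, 'c, 'p, 'b, 'd) ffun
    \<Rightarrow> ('o, 'a, 'c, 'q, 'e, 'f) ffun" where
  "ffun_comp A G F =
     \<lparr>fobj = compose (Obj A) (fobj G) (fobj F),
      farr = compose (Loose A) (farr G) (farr F),
      fcell = compose (Cell A) (fcell G) (fcell F)\<rparr>"

text \<open>
  Transformations in the \<open>\<F>\<close>-enriched sense: the components are tight, and naturality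
  is strict and 2-natural with respect to all loose morphisms.
\<close>
definition f_natural ::
  "('o, 'a, 'c) fcat \<Rightarrow> ('p, 'b, 'd) fcat \<Rightarrow> ('o, 'a, 'c, 'p, 'b, 'd) ffun \<Rightarrow> ('o, 'a, 'c, 'p, 'b, 'd) ffun
    \<Rightarrow> ('o \<Rightarrow> 'b) \<Rightarrow> bool" where
  "f_natural A B F G \<phi> \<longleftrightarrow>
     f_functor A B F \<and> f_functor A B G \<and> \<phi> \<in> extensional (Obj A)
     \<and> (\<forall>X\<in>Obj A. \<phi> X \<in> tight_hom B (fobj F X) (fobj G X))
     \<and> (\<forall>f\<in>Loose A. comp1 B (farr G f) (\<phi> (fdom A f)) = comp1 B (\<phi> (fcod A f)) (farr F f))
     \<and> (\<forall>\<alpha>\<in>Cell A. hcomp B (fcell G \<alpha>) (id2 B (\<phi> (fdom A (fsrc A \<alpha>))))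
          = hcomp B (id2 B (\<phi> (fcod A (fsrc A \<alpha>)))) (fcell F \<alpha>))"


section \<open>The \<open>\<F>\<close>-category \<open>\<F>\<close> of full embeddings\<close>

record 'u femb =
  tau :: "('u, 'u) cat"
  lam :: "('u, 'u) cat"
  emb :: "('u, 'u, 'u, 'u) cfun"

definition full_embedding :: "'u femb \<Rightarrow> bool" where
  "full_embedding A \<longleftrightarrow> cat_functor (tau A) (lam A) (emb A)
     \<and> fully_faithful (tau A) (lam A) (emb A) \<and> inj_on (cobj (emb A)) (CObj (tau A))"

type_synonym 'u floose = "'u femb \<times> 'u femb \<times> ('u, 'u, 'u, 'u) cfun"
type_synonym 'u fcell2 = "'u floose \<times> 'u floose \<times> ('u \<Rightarrow> 'u)"

definition FF_loose :: "'u floose set" where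
  "FF_loose = {(A, B, F). full_embedding A \<and> full_embedding B \<and> cat_functor (lam A) (lam B) F}"

definition FF_tight :: "'u floose set" where
  "FF_tight = {(A, B, F). (A, B, F) \<in> FF_loose \<and>
     (\<exists>G. cat_functor (tau A) (tau B) G \<and> cfun_comp (tau A) (emb B) G = cfun_comp (tau A) F (emb A))}"

definition FF_cell :: "'u fcell2 set" where
  "FF_cell = {((A, B, F), (A', B', G), \<theta>). A' = A \<and> B' = B \<and> (A, B, F) \<in> FF_loose \<and> (A, B, G) \<in> FF_loose
     \<and> nat_trans (lam A) (lam B) F G \<theta>}"

fun FF_comp1 :: "'u floose \<Rightarrow> 'u floose \<Rightarrow> 'u floose" where
  "FF_comp1 (B', C, G) (A, B, F) =
     (if (A, B, F) \<in> FF_loose \<and> (B', C, G) \<in> FF_loose \<and> B' = B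
      then (A, C, cfun_comp (lam A) G F) else undefined)"

fun FF_vcomp :: "'u fcell2 \<Rightarrow> 'u fcell2 \<Rightarrow> 'u fcell2" where
  "FF_vcomp (G', H, \<psi>) ((A, B, F), G, \<theta>) =
     (if ((A, B, F), G, \<theta>) \<in> FF_cell \<and> (G', H, \<psi>) \<in> FF_cell \<and> G' = G
      then ((A, B, F), H, \<lambda>X\<in>CObj (lam A). ccomp (lam B) (\<psi> X) (\<theta> X)) else undefined)"

fun FF_hcomp :: "'u fcell2 \<Rightarrow> 'u fcell2 \<Rightarrow> 'u fcell2" where
  "FF_hcomp ((B', C, H), (B'', C', K), \<psi>) ((A, B, F), (A', B''', G), \<theta>) =
     (if ((A, B, F), (A', B''', G), \<theta>) \<in> FF_cell \<and> ((B', C, H), (B'', C', K), \<psi>) \<in> FF_cell \<and> B' = B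
      then (FF_comp1 (B', C, H) (A, B, F), FF_comp1 (B'', C', K) (A', B''', G),
            \<lambda>X\<in>CObj (lam A). ccomp (lam C) (\<psi> (cobj G X)) (carr H (\<theta> X)))
      else undefined)"

definition FF :: "('u femb, 'u floose, 'u fcell2) fcat" where
  "FF = \<lparr>Obj = Collect full_embedding, Loose = FF_loose, Tight = FF_tight, Cell = FF_cell,
     fdom = restrict fst FF_loose, fcod = restrict (fst \<circ> snd) FF_loose,
     fsrc = restrict fst FF_cell, ftrg = restrict (fst \<circ> snd) FF_cell,
     id1 = (\<lambda>A\<in>Collect full_embedding. (A, A, cfun_id (lam A))), comp1 = FF_comp1,
     id2 = (\<lambda>(A, B, F)\<in>FF_loose. ((A, B, F), (A, B, F), \<lambda>X\<in>CObj (lam A). cid (lam B) (cobj F X))),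
     vcomp = FF_vcomp, hcomp = FF_hcomp\<rparr>"

subsection \<open>Hom-objects and representable \<open>\<F>\<close>-functors\<close>

definition hom_cat :: "('o, 'u, 'u) fcat \<Rightarrow> 'u set \<Rightarrow> ('u, 'u) cat" where
  "hom_cat S H =
     (let K = {\<alpha> \<in> Cell S. fsrc S \<alpha> \<in> H \<and> ftrg S \<alpha> \<in> H} in
      \<lparr>CObj = H, CArr = K, cdom = restrict (fsrc S) K, ccod = restrict (ftrg S) K,
       cid = restrict (id2 S) H,
       ccomp = (\<lambda>\<beta> \<alpha>. if \<alpha> \<in> K \<and> \<beta> \<in> K \<and> fsrc S \<beta> = ftrg S \<alpha> then vcomp S \<beta> \<alpha> else undefined)\<rparr>)"

text \<open>The object \<open>S(X, Y)\<close> of \<open>\<F>\<close>.\<close>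
definition hom_emb :: "('o, 'u, 'u) fcat \<Rightarrow> 'o \<Rightarrow> 'o \<Rightarrow> 'u femb" where
  "hom_emb S X Y = \<lparr>tau = hom_cat S (tight_hom S X Y), lam = hom_cat S (loose_hom S X Y),
     emb = cfun_id (hom_cat S (tight_hom S X Y))\<rparr>"

definition hom_post :: "('o, 'u, 'u) fcat \<Rightarrow> 'o \<Rightarrow> 'u \<Rightarrow> 'u floose" where
  "hom_post S X g = (hom_emb S X (fdom S g), hom_emb S X (fcod S g),
     \<lparr>cobj = (\<lambda>f\<in>CObj (lam (hom_emb S X (fdom S g))). comp1 S g f),
      carr = (\<lambda>\<alpha>\<in>CArr (lam (hom_emb S X (fdom S g))). hcomp S (id2 S g) \<alpha>)\<rparr>)"

text \<open>The \<open>\<F>\<close>-functor \<open>S(X, -)\<close> from \<open>S\<close> to \<open>\<F>\<close>.\<close>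
definition hom_functor ::
  "('o, 'u, 'u) fcat \<Rightarrow> 'o \<Rightarrow> ('o, 'u, 'u, 'u femb, 'u floose, 'u fcell2) ffun" where
  "hom_functor S X =
     \<lparr>fobj = (\<lambda>Y\<in>Obj S. hom_emb S X Y),
      farr = (\<lambda>g\<in>Loose S. hom_post S X g),
      fcell = (\<lambda>\<beta>\<in>Cell S. (hom_post S X (fsrc S \<beta>), hom_post S X (ftrg S \<beta>),
        \<lambda>f\<in>CObj (lam (hom_emb S X (fdom S (fsrc S \<beta>)))). hcomp S \<beta> (id2 S f)))\<rparr>"

text \<open>The action \<open>S(X, Y) \<rightarrow> C(F X, F Y)\<close> of an \<open>\<F>\<close>-functor on hom-objects, a morphism of \<open>\<F>\<close>.\<close>
definition hom_action ::
  "('o, 'u, 'u) fcat \<Rightarrow> ('p, 'u, 'u) fcat \<Rightarrow> ('o, 'u, 'u, 'p, 'u, 'u) ffun \<Rightarrow> 'o \<Rightarrow> 'o \<Rightarrow> 'u floose" where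
  "hom_action S C F X Y = (hom_emb S X Y, hom_emb C (fobj F X) (fobj F Y),
     \<lparr>cobj = restrict (farr F) (CObj (lam (hom_emb S X Y))),
      carr = restrict (fcell F) (CArr (lam (hom_emb S X Y)))\<rparr>)"


section \<open>Sketches\<close>

type_synonym 'u sfcat = "('u, 'u, 'u) fcat"
type_synonym 'u sffun = "('u, 'u, 'u, 'u, 'u, 'u) ffun"

text \<open>A weighted cone in \<open>S\<close> is recorded together with its shape \<open>J\<close>, weight \<open>W\<close> and diagram \<open>D\<close>.\<close>
record 'u wcone =
  shape :: "'u sfcat"
  weight :: "('u, 'u, 'u, 'u femb, 'u floose, 'u fcell2) ffun"
  diagram :: "'u sffun"
  apex :: "'u"
  leg :: "'u \<Rightarrow> 'u floose"

definition weighted_cone :: "'u sfcat \<Rightarrow> 'u wcone \<Rightarrow> bool" where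
  "weighted_cone S c \<longleftrightarrow>
     f_functor (shape c) FF (weight c) \<and> f_functor (shape c) S (diagram c) \<and> apex c \<in> Obj S
     \<and> f_natural (shape c) FF (weight c) (ffun_comp (shape c) (hom_functor S (apex c)) (diagram c)) (leg c)"

definition map_cone :: "'u sfcat \<Rightarrow> 'u sfcat \<Rightarrow> 'u sffun \<Rightarrow> 'u wcone \<Rightarrow> 'u wcone" where
  "map_cone S C F c = \<lparr>shape = shape c, weight = weight c, diagram = ffun_comp (shape c) F (diagram c),
     apex = fobj F (apex c),
     leg = (\<lambda>j\<in>Obj (shape c). comp1 FF (hom_action S C F (apex c) (fobj (diagram c) j)) (leg c j))\<rparr>"

record 'u sketch =
  und :: "'u sfcat"
  cones :: "'u wcone set"

definition f_sketch :: "'u sketch \<Rightarrow> bool" where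
  "f_sketch S \<longleftrightarrow> f_category (und S) \<and> (\<forall>c\<in>cones S. weighted_cone (und S) c)"

definition sketch_morphism :: "'u sketch \<Rightarrow> 'u sketch \<Rightarrow> 'u sffun \<Rightarrow> bool" where
  "sketch_morphism S C F \<longleftrightarrow> f_sketch S \<and> f_sketch C \<and> f_functor (und S) (und C) F
     \<and> (\<forall>c\<in>cones S. map_cone (und S) (und C) F c \<in> cones C)"

definition FSK_arr :: "('u sketch \<times> 'u sketch \<times> 'u sffun) set" where
  "FSK_arr = {(S, C, F). sketch_morphism S C F}"

definition FSK :: "('u sketch, 'u sketch \<times> 'u sketch \<times> 'u sffun) cat" where
  "FSK = \<lparr>CObj = Collect f_sketch, CArr = FSK_arr,
     cdom = restrict fst FSK_arr, ccod = restrict (fst \<circ> snd) FSK_arr,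
     cid = (\<lambda>S\<in>Collect f_sketch. (S, S, ffun_id (und S))),
     ccomp = (\<lambda>(C', D, G) (S, C, F).
       if (S, C, F) \<in> FSK_arr \<and> (C', D, G) \<in> FSK_arr \<and> C' = C
       then (S, D, ffun_comp (und S) G F) else undefined)\<rparr>"


section \<open>Weaknesses and \<open>w\<close>-natural transformations\<close>

datatype weakness = Strict | Pseudo | Lax | Colax

instantiation weakness :: order
begin

definition less_eq_weakness :: "weakness \<Rightarrow> weakness \<Rightarrow> bool" where
  "v \<le> w \<longleftrightarrow> v = w \<or> v = Strict \<or> (v = Pseudo \<and> w \<noteq> Strict)"

definition less_weakness :: "weakness \<Rightarrow> weakness \<Rightarrow> bool" where
  "(v :: weakness) < w \<longleftrightarrow> v \<le> w \<and> v \<noteq> w"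

instance
  by standard (auto simp: less_eq_weakness_def less_weakness_def)

end

fun wbar :: "weakness \<Rightarrow> weakness" where
  "wbar Strict = Strict"
| "wbar Pseudo = Pseudo"
| "wbar Lax = Colax"
| "wbar Colax = Lax"

text \<open>
  \<open>wcell C w f g h k \<alpha>\<close>: \<open>\<alpha>\<close> is a \<open>w\<close>-cell in the square with top \<open>f\<close>, left \<open>g\<close>, right \<open>h\<close>, bottom \<open>k\<close>.
\<close>
fun wcell :: "('o, 'a, 'c) fcat \<Rightarrow> weakness \<Rightarrow> 'a \<Rightarrow> 'a \<Rightarrow> 'a \<Rightarrow> 'a \<Rightarrow> 'c \<Rightarrow> bool" where
  "wcell C Lax f g h k \<alpha> \<longleftrightarrow> \<alpha> \<in> cell_hom C (comp1 C h f) (comp1 C k g)"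
| "wcell C Colax f g h k \<alpha> \<longleftrightarrow> \<alpha> \<in> cell_hom C (comp1 C k g) (comp1 C h f)"
| "wcell C Pseudo f g h k \<alpha> \<longleftrightarrow> \<alpha> \<in> cell_hom C (comp1 C h f) (comp1 C k g) \<and> (\<exists>\<beta>. inverse_cells C \<alpha> \<beta>)"
| "wcell C Strict f g h k \<alpha> \<longleftrightarrow> comp1 C h f = comp1 C k g \<and> \<alpha> = id2 C (comp1 C h f)"

text \<open>
  The \<open>w\<close>-cell \<open>\<alpha>\<close> is a \<open>w'\<close>-cell. A colax cell points in the direction opposite to that of a pseudo cell,
  so that it counts as pseudo when it is the inverse of a pseudo cell.
\<close>
definition wcell_restricts ::
  "('o, 'a, 'c) fcat \<Rightarrow> weakness \<Rightarrow> weakness \<Rightarrow> 'a \<Rightarrow> 'a \<Rightarrow> 'a \<Rightarrow> 'a \<Rightarrow> 'c \<Rightarrow> bool" where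
  "wcell_restricts C w' w f g h k \<alpha> \<longleftrightarrow>
     (if w = Colax \<and> w' = Pseudo then \<exists>\<beta>. wcell C Pseudo f g h k \<beta> \<and> inverse_cells C \<beta> \<alpha>
      else wcell C w' f g h k \<alpha>)"

text \<open>
  A \<open>w\<close>-cell in a square, viewed as a \<open>wbar w\<close>-cell in the transposed square (top and left exchanged,
  right and bottom exchanged).
\<close>
definition wtranspose :: "('o, 'a, 'c) fcat \<Rightarrow> weakness \<Rightarrow> 'c \<Rightarrow> 'c" where
  "wtranspose C w \<alpha> = (if w = Pseudo then inv_cell C \<alpha> else \<alpha>)"

text \<open>
  Strict and pseudo cells are directed like lax ones, so the coherence axioms for \<open>Strict\<close> and \<open>Pseudo\<close>
  are the lax ones.
\<close>
locale loose_natural = F: f_functor A C F + G: f_functor A C G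
  for w :: weakness and A :: "('o, 'a, 'c) fcat" and C :: "('p, 'b, 'd) fcat" and F G +
  fixes \<phi> :: "'o \<Rightarrow> 'b" and \<phi>c :: "'a \<Rightarrow> 'd"
  assumes component: "X \<in> Obj A \<Longrightarrow> \<phi> X \<in> loose_hom C (fobj F X) (fobj G X)"
    and square: "s \<in> Loose A \<Longrightarrow>
      wcell C w (\<phi> (fdom A s)) (farr F s) (farr G s) (\<phi> (fcod A s)) (\<phi>c s)"
    and unit: "X \<in> Obj A \<Longrightarrow> \<phi>c (id1 A X) = id2 C (\<phi> X)"
    and comp: "composable1 A t s \<Longrightarrow> \<phi>c (comp1 A t s) =
      (if w = Colax
       then vcomp C (hcomp C (id2 C (farr G t)) (\<phi>c s)) (hcomp C (\<phi>c t) (id2 C (farr F s)))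
       else vcomp C (hcomp C (\<phi>c t) (id2 C (farr F s))) (hcomp C (id2 C (farr G t)) (\<phi>c s)))"
    and natural: "\<alpha> \<in> Cell A \<Longrightarrow>
      (if w = Colax
       then vcomp C (hcomp C (fcell G \<alpha>) (id2 C (\<phi> (fdom A (fsrc A \<alpha>))))) (\<phi>c (fsrc A \<alpha>))
          = vcomp C (\<phi>c (ftrg A \<alpha>)) (hcomp C (id2 C (\<phi> (fcod A (fsrc A \<alpha>)))) (fcell F \<alpha>))
       else vcomp C (hcomp C (id2 C (\<phi> (fcod A (fsrc A \<alpha>)))) (fcell F \<alpha>)) (\<phi>c (fsrc A \<alpha>))
          = vcomp C (\<phi>c (ftrg A \<alpha>)) (hcomp C (fcell G \<alpha>) (id2 C (\<phi> (fdom A (fsrc A \<alpha>))))))"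


section \<open>Multifunctors\<close>

text \<open>
  Arguments are numbered from \<open>0\<close>. The value \<open>M(S\<^sub>0, \<dots>, s\<^sub>i, \<dots>)\<close> on a loose morphism \<open>s\<^sub>i\<close> (or a 2-cell)
  in place \<open>i\<close> is \<open>marr M i Xs s\<^sub>i\<close> (or \<open>mcell M i Xs \<alpha>\<close>), where \<open>Xs\<close> is the full list of objects with the
  domain of \<open>s\<^sub>i\<close> at place \<open>i\<close>. Similarly \<open>M(s\<^sub>i, s\<^sub>j)\<close> is \<open>mint M i j Xs s\<^sub>i s\<^sub>j\<close>, where \<open>Xs\<close> has the domains of
  \<open>s\<^sub>i\<close> and \<open>s\<^sub>j\<close> at places \<open>i < j\<close>. A nullary multifunctor is determined by the object \<open>mobj M []\<close>.
\<close>
record 'u mfun =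
  msrc :: "'u sfcat list"
  mtrg :: "'u sfcat"
  mobj :: "'u list \<Rightarrow> 'u"
  marr :: "nat \<Rightarrow> 'u list \<Rightarrow> 'u \<Rightarrow> 'u"
  mcell :: "nat \<Rightarrow> 'u list \<Rightarrow> 'u \<Rightarrow> 'u"
  mint :: "nat \<Rightarrow> nat \<Rightarrow> 'u list \<Rightarrow> 'u \<Rightarrow> 'u \<Rightarrow> 'u"

definition obj_tuples :: "'u sfcat list \<Rightarrow> 'u list set" where
  "obj_tuples As = {Xs. list_all2 (\<lambda>X A. X \<in> Obj A) Xs As}"

definition loose_at :: "'u sfcat list \<Rightarrow> 'u list \<Rightarrow> nat \<Rightarrow> 'u \<Rightarrow> bool" where
  "loose_at As Xs i s \<longleftrightarrow> i < length As \<and> s \<in> Loose (As ! i) \<and> fdom (As ! i) s = Xs ! i"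

definition cell_at :: "'u sfcat list \<Rightarrow> 'u list \<Rightarrow> nat \<Rightarrow> 'u \<Rightarrow> bool" where
  "cell_at As Xs i \<alpha> \<longleftrightarrow>
     i < length As \<and> \<alpha> \<in> Cell (As ! i) \<and> fdom (As ! i) (fsrc (As ! i) \<alpha>) = Xs ! i"

definition arr_dom :: "'u sfcat list \<Rightarrow> nat \<Rightarrow> 'u list \<Rightarrow> 'u \<Rightarrow> bool" where
  "arr_dom As i Xs s \<longleftrightarrow> Xs \<in> obj_tuples As \<and> loose_at As Xs i s"

definition cell_dom :: "'u sfcat list \<Rightarrow> nat \<Rightarrow> 'u list \<Rightarrow> 'u \<Rightarrow> bool" where
  "cell_dom As i Xs \<alpha> \<longleftrightarrow> Xs \<in> obj_tuples As \<and> cell_at As Xs i \<alpha>"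

definition int_dom :: "'u sfcat list \<Rightarrow> nat \<Rightarrow> nat \<Rightarrow> 'u list \<Rightarrow> 'u \<Rightarrow> 'u \<Rightarrow> bool" where
  "int_dom As i j Xs s t \<longleftrightarrow> Xs \<in> obj_tuples As \<and> i < j \<and> loose_at As Xs i s \<and> loose_at As Xs j t"

text \<open>The \<open>\<F>\<close>-functor \<open>M(S\<^sub>0, \<dots>, -\<^sub>i, \<dots>)\<close>; it does not depend on the entry of \<open>Xs\<close> at place \<open>i\<close>.\<close>
definition slice :: "'u mfun \<Rightarrow> nat \<Rightarrow> 'u list \<Rightarrow> 'u sffun" where
  "slice M i Xs = (let A = msrc M ! i in
     \<lparr>fobj = (\<lambda>X\<in>Obj A. mobj M (Xs[i := X])),
      farr = (\<lambda>s\<in>Loose A. marr M i (Xs[i := fdom A s]) s),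
      fcell = (\<lambda>\<alpha>\<in>Cell A. mcell M i (Xs[i := fdom A (fsrc A \<alpha>)]) \<alpha>)\<rparr>)"

text \<open>
  The two pastings of the faces of the cube. For lax directions these are 2-cells from
  ``first \<open>r\<close>, then \<open>s\<close>, then \<open>t\<close>'' to ``first \<open>t\<close>, then \<open>s\<close>, then \<open>r\<close>'', and for colax ones in the
  opposite direction, so that the order of vertical composition is reversed. Each listed 2-cell is a whiskered
  face.
\<close>
definition cube_compatible ::
  "weakness \<Rightarrow> 'u mfun \<Rightarrow> nat \<Rightarrow> nat \<Rightarrow> nat \<Rightarrow> 'u list \<Rightarrow> 'u \<Rightarrow> 'u \<Rightarrow> 'u \<Rightarrow> bool" where
  "cube_compatible w M i j k Xs r s t \<longleftrightarrow>
    (let C = mtrg M;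
         X' = fcod (msrc M ! i) r; Y' = fcod (msrc M ! j) s; Z' = fcod (msrc M ! k) t;
         after = (\<lambda>g \<alpha>. hcomp C (id2 C g) \<alpha>);
         before = (\<lambda>\<alpha> f. hcomp C \<alpha> (id2 C f));
         paste = (\<lambda>\<alpha> \<beta> \<gamma>. if w = Colax then vcomp C \<alpha> (vcomp C \<beta> \<gamma>) else vcomp C \<gamma> (vcomp C \<beta> \<alpha>))
     in paste (after (marr M k (Xs[i := X', j := Y']) t) (mint M i j Xs r s))
              (before (mint M i k (Xs[j := Y']) r t) (marr M j Xs s))
              (after (marr M i (Xs[j := Y', k := Z']) r) (mint M j k Xs s t))
      = paste (before (mint M j k (Xs[i := X']) s t) (marr M i Xs r))
              (after (marr M j (Xs[i := X', k := Z']) s) (mint M i k Xs r t))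
              (before (mint M i j (Xs[k := Z']) r s) (marr M k Xs t)))"

locale multifunctor =
  fixes w' w :: weakness and M :: "'u mfun"
  assumes src_cat: "A \<in> set (msrc M) \<Longrightarrow> f_category A"
    and trg_cat: "f_category (mtrg M)"
    and obj: "Xs \<in> obj_tuples (msrc M) \<Longrightarrow> mobj M Xs \<in> Obj (mtrg M)"
    and slice_functor: "\<lbrakk>Xs \<in> obj_tuples (msrc M); i < length (msrc M)\<rbrakk> \<Longrightarrow>
      f_functor (msrc M ! i) (mtrg M) (slice M i Xs)"
    and int_cell: "int_dom (msrc M) i j Xs s t \<Longrightarrow>
      wcell (mtrg M) w (marr M i Xs s) (marr M j Xs t)
        (marr M j (Xs[i := fcod (msrc M ! i) s]) t) (marr M i (Xs[j := fcod (msrc M ! j) t]) s)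
        (mint M i j Xs s t)"
    and int_tight: "\<lbrakk>int_dom (msrc M) i j Xs s t; s \<in> Tight (msrc M ! i) \<or> t \<in> Tight (msrc M ! j)\<rbrakk> \<Longrightarrow>
      wcell_restricts (mtrg M) w' w (marr M i Xs s) (marr M j Xs t)
        (marr M j (Xs[i := fcod (msrc M ! i) s]) t) (marr M i (Xs[j := fcod (msrc M ! j) t]) s)
        (mint M i j Xs s t)"
    and int_natural_right:
      "\<lbrakk>Xs \<in> obj_tuples (msrc M); i < j; j < length (msrc M); loose_at (msrc M) Xs i s\<rbrakk> \<Longrightarrow>
      loose_natural w (msrc M ! j) (mtrg M) (slice M j Xs) (slice M j (Xs[i := fcod (msrc M ! i) s]))
        (\<lambda>Y. marr M i (Xs[j := Y]) s)
        (\<lambda>t. mint M i j (Xs[j := fdom (msrc M ! j) t]) s t)"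
    and int_natural_left:
      "\<lbrakk>Xs \<in> obj_tuples (msrc M); i < j; loose_at (msrc M) Xs j t\<rbrakk> \<Longrightarrow>
      loose_natural (wbar w) (msrc M ! i) (mtrg M) (slice M i Xs) (slice M i (Xs[j := fcod (msrc M ! j) t]))
        (\<lambda>X. marr M j (Xs[i := X]) t)
        (\<lambda>s. wtranspose (mtrg M) w (mint M i j (Xs[i := fdom (msrc M ! i) s]) s t))"
    and cube: "\<lbrakk>Xs \<in> obj_tuples (msrc M); i < j; j < k;
        loose_at (msrc M) Xs i r; loose_at (msrc M) Xs j s; loose_at (msrc M) Xs k t\<rbrakk> \<Longrightarrow>
      cube_compatible w M i j k Xs r s t"
    and obj_ext: "Xs \<notin> obj_tuples (msrc M) \<Longrightarrow> mobj M Xs = undefined"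
    and arr_ext: "\<not> arr_dom (msrc M) i Xs s \<Longrightarrow> marr M i Xs s = undefined"
    and cell_ext: "\<not> cell_dom (msrc M) i Xs \<alpha> \<Longrightarrow> mcell M i Xs \<alpha> = undefined"
    and int_ext: "\<not> int_dom (msrc M) i j Xs s t \<Longrightarrow> mint M i j Xs s t = undefined"

definition mfun_id :: "'u sfcat \<Rightarrow> 'u mfun" where
  "mfun_id A = \<lparr>msrc = [A], mtrg = A,
     mobj = (\<lambda>Xs. if Xs \<in> obj_tuples [A] then hd Xs else undefined),
     marr = (\<lambda>i Xs s. if arr_dom [A] i Xs s then s else undefined),
     mcell = (\<lambda>i Xs \<alpha>. if cell_dom [A] i Xs \<alpha> then \<alpha> else undefined),
     mint = (\<lambda>i j Xs s t. undefined)\<rparr>"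

subsection \<open>Substitution\<close>

fun blocks :: "nat list \<Rightarrow> 'a list \<Rightarrow> 'a list list" where
  "blocks [] xs = []"
| "blocks (n # ns) xs = take n xs # blocks ns (drop n xs)"

text \<open>The number of the block containing place \<open>p\<close>, and the offset of \<open>p\<close> in it.\<close>
fun locate :: "nat list \<Rightarrow> nat \<Rightarrow> nat \<times> nat" where
  "locate [] p = (0, p)"
| "locate (n # ns) p = (if p < n then (0, p) else (case locate ns (p - n) of (a, i) \<Rightarrow> (Suc a, i)))"

definition mfun_comp :: "'u mfun \<Rightarrow> 'u mfun list \<Rightarrow> 'u mfun" where
  "mfun_comp N Ms =
    (let As = concat (map msrc Ms);
         ns = map (length \<circ> msrc) Ms;
         vals = (\<lambda>Xs. map2 mobj Ms (blocks ns Xs))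
     in \<lparr>msrc = As, mtrg = mtrg N,
      mobj = (\<lambda>Xs. if Xs \<in> obj_tuples As then mobj N (vals Xs) else undefined),
      marr = (\<lambda>p Xs s. if arr_dom As p Xs s
        then (case locate ns p of (a, i) \<Rightarrow> marr N a (vals Xs) (marr (Ms ! a) i (blocks ns Xs ! a) s))
        else undefined),
      mcell = (\<lambda>p Xs \<alpha>. if cell_dom As p Xs \<alpha>
        then (case locate ns p of (a, i) \<Rightarrow> mcell N a (vals Xs) (mcell (Ms ! a) i (blocks ns Xs ! a) \<alpha>))
        else undefined),
      mint = (\<lambda>p q Xs s t. if int_dom As p q Xs s t
        then (case (locate ns p, locate ns q) of ((a, i), (b, j)) \<Rightarrow>
          if a = b then mcell N a (vals Xs) (mint (Ms ! a) i j (blocks ns Xs ! a) s t)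
          else mint N a b (vals Xs) (marr (Ms ! a) i (blocks ns Xs ! a) s) (marr (Ms ! b) j (blocks ns Xs ! b) t))
        else undefined)\<rparr>)"


section \<open>Multicategories\<close>

record ('o, 'm) multicat =
  MObj :: "'o set"
  MArr :: "'m set"
  Msrc :: "'m \<Rightarrow> 'o list"
  Mtrg :: "'m \<Rightarrow> 'o"
  Mid :: "'o \<Rightarrow> 'm"
  Mcomp :: "'m \<Rightarrow> 'm list \<Rightarrow> 'm"

definition mcomposable :: "('o, 'm) multicat \<Rightarrow> 'm \<Rightarrow> 'm list \<Rightarrow> bool" where
  "mcomposable V g fs \<longleftrightarrow> g \<in> MArr V \<and> set fs \<subseteq> MArr V \<and> Msrc V g = map (Mtrg V) fs"

locale multicategory =
  fixes V :: "('o, 'm) multicat"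
  assumes src_obj: "f \<in> MArr V \<Longrightarrow> set (Msrc V f) \<subseteq> MObj V"
    and trg_obj: "f \<in> MArr V \<Longrightarrow> Mtrg V f \<in> MObj V"
    and id_arr: "X \<in> MObj V \<Longrightarrow> Mid V X \<in> MArr V \<and> Msrc V (Mid V X) = [X] \<and> Mtrg V (Mid V X) = X"
    and comp_arr: "mcomposable V g fs \<Longrightarrow>
      Mcomp V g fs \<in> MArr V \<and> Msrc V (Mcomp V g fs) = concat (map (Msrc V) fs)
      \<and> Mtrg V (Mcomp V g fs) = Mtrg V g"
    and comp_id_left: "f \<in> MArr V \<Longrightarrow> Mcomp V (Mid V (Mtrg V f)) [f] = f"
    and comp_id_right: "f \<in> MArr V \<Longrightarrow> Mcomp V f (map (Mid V) (Msrc V f)) = f"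
    and comp_assoc: "\<lbrakk>mcomposable V g fs; list_all2 (mcomposable V) fs hss\<rbrakk> \<Longrightarrow>
      Mcomp V (Mcomp V g fs) (concat hss) = Mcomp V g (map2 (Mcomp V) fs hss)"

definition multi_hom :: "('o, 'm) multicat \<Rightarrow> 'o list \<Rightarrow> 'o \<Rightarrow> 'm set" where
  "multi_hom V Xs Y = {f \<in> MArr V. Msrc V f = Xs \<and> Mtrg V f = Y}"

definition unary :: "('o, 'm) multicat \<Rightarrow> 'm set" where
  "unary V = {f \<in> MArr V. length (Msrc V f) = 1}"

definition underlying_cat :: "('o, 'm) multicat \<Rightarrow> ('o, 'm) cat" where
  "underlying_cat V = \<lparr>CObj = MObj V, CArr = unary V,
     cdom = (\<lambda>f\<in>unary V. hd (Msrc V f)), ccod = restrict (Mtrg V) (unary V),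
     cid = restrict (Mid V) (MObj V),
     ccomp = (\<lambda>g f. if f \<in> unary V \<and> g \<in> unary V \<and> hd (Msrc V g) = Mtrg V f
       then Mcomp V g [f] else undefined)\<rparr>"

text \<open>A functor of multicategories is given as the pair of its actions on objects and multimorphisms.\<close>
type_synonym ('o, 'm, 'p, 'n) mcfun = "('o \<Rightarrow> 'p) \<times> ('m \<Rightarrow> 'n)"

locale multicat_functor = V: multicategory V + W: multicategory W
  for V :: "('o, 'm) multicat" and W :: "('p, 'n) multicat" +
  fixes F :: "('o, 'm, 'p, 'n) mcfun"
  assumes map_obj: "X \<in> MObj V \<Longrightarrow> fst F X \<in> MObj W"
    and map_arr: "f \<in> MArr V \<Longrightarrow> snd F f \<in> multi_hom W (map (fst F) (Msrc V f)) (fst F (Mtrg V f))"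
    and map_id: "X \<in> MObj V \<Longrightarrow> snd F (Mid V X) = Mid W (fst F X)"
    and map_comp: "mcomposable V g fs \<Longrightarrow> snd F (Mcomp V g fs) = Mcomp W (snd F g) (map (snd F) fs)"

definition multicat_fully_faithful ::
  "('o, 'm) multicat \<Rightarrow> ('p, 'n) multicat \<Rightarrow> ('o, 'm, 'p, 'n) mcfun \<Rightarrow> bool" where
  "multicat_fully_faithful V W F \<longleftrightarrow> (\<forall>Xs Y. set Xs \<subseteq> MObj V \<longrightarrow> Y \<in> MObj V \<longrightarrow>
     bij_betw (snd F) (multi_hom V Xs Y) (multi_hom W (map (fst F) Xs) (fst F Y)))"

definition multicat_natural ::
  "('o, 'm) multicat \<Rightarrow> ('p, 'n) multicat \<Rightarrow> ('o, 'm, 'p, 'n) mcfun \<Rightarrow> ('o, 'm, 'p, 'n) mcfun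
    \<Rightarrow> ('o \<Rightarrow> 'n) \<Rightarrow> bool" where
  "multicat_natural V W F G \<theta> \<longleftrightarrow>
     (\<forall>X\<in>MObj V. \<theta> X \<in> multi_hom W [fst F X] (fst G X))
     \<and> (\<forall>f\<in>MArr V. Mcomp W (snd G f) (map \<theta> (Msrc V f)) = Mcomp W (\<theta> (Mtrg V f)) [snd F f])"

text \<open>
  Adjunctions in the 2-category of multicategories, multicategory functors and multicategory
  transformations: \<open>L\<close> from \<open>V\<close> to \<open>W\<close> is left adjoint to \<open>R\<close> from \<open>W\<close> to \<open>V\<close>.
\<close>
definition multicat_left_adjoint ::
  "('o, 'm) multicat \<Rightarrow> ('p, 'n) multicat \<Rightarrow> ('o, 'm, 'p, 'n) mcfun \<Rightarrow> ('p, 'n, 'o, 'm) mcfun \<Rightarrow> bool" where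
  "multicat_left_adjoint V W L R \<longleftrightarrow>
     multicat_functor V W L \<and> multicat_functor W V R \<and>
     (\<exists>\<eta> \<epsilon>.
        multicat_natural V V (id, id) (fst R \<circ> fst L, snd R \<circ> snd L) \<eta>
      \<and> multicat_natural W W (fst L \<circ> fst R, snd L \<circ> snd R) (id, id) \<epsilon>
      \<and> (\<forall>X\<in>MObj V. Mcomp W (\<epsilon> (fst L X)) [snd L (\<eta> X)] = Mid W (fst L X))
      \<and> (\<forall>Y\<in>MObj W. Mcomp V (snd R (\<epsilon> Y)) [\<eta> (fst R Y)] = Mid V (fst R Y)))"


section \<open>The multicategories of \<open>\<F>\<close>-categories and of \<open>\<F>\<close>-sketches\<close>

definition FCAT_multi :: "weakness \<Rightarrow> weakness \<Rightarrow> ('u sfcat, 'u mfun) multicat" where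
  "FCAT_multi w' w = \<lparr>MObj = Collect f_category, MArr = Collect (multifunctor w' w),
     Msrc = msrc, Mtrg = mtrg, Mid = mfun_id, Mcomp = mfun_comp\<rparr>"

text \<open>A multimodel is recorded together with the sketches between which it is considered.\<close>
record 'u mmodel =
  sk_src :: "'u sketch list"
  sk_trg :: "'u sketch"
  mult :: "'u mfun"

definition multimodel :: "weakness \<Rightarrow> weakness \<Rightarrow> 'u mmodel \<Rightarrow> bool" where
  "multimodel w' w P \<longleftrightarrow>
     (\<forall>S\<in>set (sk_src P). f_sketch S) \<and> f_sketch (sk_trg P)
     \<and> multifunctor w' w (mult P)
     \<and> msrc (mult P) = map und (sk_src P) \<and> mtrg (mult P) = und (sk_trg P)
     \<and> (\<forall>i<length (sk_src P). \<forall>Xs\<in>obj_tuples (map und (sk_src P)).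
          sketch_morphism (sk_src P ! i) (sk_trg P) (slice (mult P) i Xs))"

definition FSK_multi :: "weakness \<Rightarrow> weakness \<Rightarrow> ('u sketch, 'u mmodel) multicat" where
  "FSK_multi w' w = \<lparr>MObj = Collect f_sketch, MArr = Collect (multimodel w' w),
     Msrc = sk_src, Mtrg = sk_trg,
     Mid = (\<lambda>S. \<lparr>sk_src = [S], sk_trg = S, mult = mfun_id (und S)\<rparr>),
     Mcomp = (\<lambda>Q Ps. \<lparr>sk_src = concat (map sk_src Ps), sk_trg = sk_trg Q,
       mult = mfun_comp (mult Q) (map mult Ps)\<rparr>)\<rparr>"

definition forget :: "('u sketch, 'u mmodel, 'u sfcat, 'u mfun) mcfun" where
  "forget = (und, mult)"

text \<open>
  A unary multimodel \<open>P\<close> as the sketch morphism \<open>P(-)\<close>; the entry of the list \<open>[undefined]\<close> is irrelevant.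
\<close>
definition unary_model ::
  "weakness \<Rightarrow> weakness \<Rightarrow> ('u sketch, 'u mmodel, 'u sketch, 'u sketch \<times> 'u sketch \<times> 'u sffun) cfun" where
  "unary_model w' w =
     \<lparr>cobj = restrict id (Collect f_sketch),
      carr = (\<lambda>P\<in>unary (FSK_multi w' w). (hd (sk_src P), sk_trg P, slice (mult P) 0 [undefined]))\<rparr>"

end

theory Submission
  imports Defs
begin

text \<open>
  The slices of a composite multifunctor \<open>N(M\<^sub>1, \<dots>, M\<^sub>n)\<close> are composites of a slice of \<open>N\<close> with a slice of
  some \<open>M\<^sub>a\<close>. Its interchange cells are images of those of \<open>M\<^sub>a\<close> under a slice of \<open>N\<close> when both arguments
  lie in the same block, and otherwise are interchange cells of \<open>N\<close> at values of the \<open>M\<^sub>a\<close>. So all axioms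
  are inherited, the only new case being a cube with exactly two directions in one block: it commutes by
  naturality of the interchange cells of \<open>N\<close> with respect to the interchange cell of \<open>M\<^sub>a\<close>. Multimodels are
  closed under composition because \<open>\<F>\<close>-functors act functorially on cones, and the left adjoint equips
  an \<open>\<F>\<close>-category with the empty class of cones.
\<close>

section \<open>Blocks of a concatenated list\<close>

text \<open>The bulk of the work lies in two obstacles. One is indexing: the arguments of a
  composite run through a concatenated list, so places are translated into pairs (block, offset) and
  object tuples are cut into blocks before any axiom is checked. The other is direction. Strict and
  pseudo cells point the same way as lax ones, while naturality in the earlier variable is stated
  for transposed cells of the reversed weakness. The two kinds of mixed cube are therefore not
  symmetric: two directions in the later block use the interchange cells as they stand, whereas two
  directions in the earlier block need the untransposed cells as a colax transformation whenever
  \<open>w\<close> is not \<open>Colax\<close>. Strict and pseudo cells have to be converted for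
  this, the latter by taking inverses.

  The adjunction is governed by \<open>und (free_sketch A) = A\<close>: the unit consists of
  identities, and each counit component has an identity as its underlying multifunctor. Categories
  without objects need separate care, since the conditions on slices quantify over object tuples and
  become vacuous for them.\<close>

definition place :: "nat list \<Rightarrow> nat \<Rightarrow> nat \<Rightarrow> nat" where
  "place ns a i = sum_list (take a ns) + i"

lemma place_Cons: "place (n # ns) (Suc a) i = n + place ns a i" "place (n # ns) 0 i = i"
  by (simp_all add: place_def)

text \<open>\<open>place\<close> inverts \<open>locate\<close>. With this, \<open>locate\<close> is
  evaluated in block coordinates and its recursion need not be unfolded again.\<close>

lemma locate_place: "\<lbrakk>a < length ns; i < ns ! a\<rbrakk> \<Longrightarrow> locate ns (place ns a i) = (a, i)"
proof (induction ns arbitrary: a)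
  case (Cons n ns)
  then show ?case by (cases a) (auto simp: place_Cons)
qed simp

lemma place_exhaust:
  assumes "p < sum_list ns"
  obtains a i where "a < length ns" "i < ns ! a" "p = place ns a i"
proof -
  have "\<exists>a i. a < length ns \<and> i < ns ! a \<and> p = place ns a i"
    using assms
  proof (induction ns arbitrary: p)
    case (Cons n ns)
    show ?case
    proof (cases "p < n")
      case True
      then show ?thesis by (intro exI[of _ 0] exI[of _ p]) (simp add: place_Cons)
    next
      case False
      then have "p - n < sum_list ns" using Cons.prems by auto
      then obtain a i where "a < length ns" "i < ns ! a" "p - n = place ns a i"
        using Cons.IH by blast
      then show ?thesis using False
        by (intro exI[of _ "Suc a"] exI[of _ i]) (simp add: place_Cons)
    qed
  qed simp
  then show thesis using that by blast
qed

lemma place_less: "\<lbrakk>a < length ns; i < ns ! a\<rbrakk> \<Longrightarrow> place ns a i < sum_list ns"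
proof (induction ns arbitrary: a)
  case (Cons n ns)
  then show ?case by (cases a) (auto simp: place_Cons)
qed simp

text \<open>The order of places is lexicographic in (block, offset). This is the source of every
  case distinction between one block and two blocks below.\<close>

lemma place_less_iff:
  "\<lbrakk>a < length ns; i < ns ! a; b < length ns; j < ns ! b\<rbrakk> \<Longrightarrow>
    place ns a i < place ns b j \<longleftrightarrow> a < b \<or> a = b \<and> i < j"
proof (induction ns arbitrary: a b)
  case (Cons n ns)
  then show ?case by (cases a; cases b) (auto simp: place_Cons)
qed simp

lemma nth_concat_place:
  "\<lbrakk>a < length xss; i < length (xss ! a)\<rbrakk> \<Longrightarrow> concat xss ! place (map length xss) a i = xss ! a ! i"
proof (induction xss arbitrary: a)
  case (Cons xs xss)
  then show ?case by (cases a) (auto simp: place_Cons nth_append)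
qed simp

lemma update_concat_place:
  "\<lbrakk>a < length xss; i < length (xss ! a)\<rbrakk> \<Longrightarrow>
    (concat xss)[place (map length xss) a i := x] = concat (xss[a := (xss ! a)[i := x]])"
proof (induction xss arbitrary: a)
  case (Cons xs xss)
  then show ?case by (cases a) (auto simp: place_Cons list_update_append)
qed simp

lemma blocks_concat: "blocks (map length xss) (concat xss) = xss"
  by (induction xss) auto

text \<open>Both sides count the entries in front of one and the same position of a list nested
  twice: on the left block by block, on the right group by group. It is the index computation behind
  associativity.\<close>

lemma place_place:
  "\<lbrakk>a < length nss; i < length (nss ! a)\<rbrakk> \<Longrightarrow>
    place (concat nss) (place (map length nss) a i) j = place (map sum_list nss) a (place (nss ! a) i j)"
proof (induction nss arbitrary: a)
  case (Cons ns nss)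
  then show ?case by (cases a) (auto simp: place_Cons place_def)
qed simp

lemma list_all2_obj_tuples_concat:
  assumes "list_all2 (\<lambda>Xs As. Xs \<in> obj_tuples As) Xss Ass"
  shows "concat Xss \<in> obj_tuples (concat Ass)"
  using assms by (induction rule: list_all2_induct) (auto simp: obj_tuples_def list_all2_appendI)

lemma list_all2_concatE:
  assumes "list_all2 P xs (concat yss)"
  obtains xss where "xs = concat xss" "list_all2 (list_all2 P) xss yss"
proof -
  have "\<exists>xss. xs = concat xss \<and> list_all2 (list_all2 P) xss yss"
    using assms
  proof (induction yss arbitrary: xs)
    case (Cons ys yss)
    then obtain us vs where "xs = us @ vs" "list_all2 P us ys" "list_all2 P vs (concat yss)"
      by (auto simp: list_all2_append2)
    moreover then obtain vss where "vs = concat vss" "list_all2 (list_all2 P) vss yss"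
      using Cons.IH by blast
    ultimately show ?case by (intro exI[of _ "us # vss"]) auto
  qed auto
  then show thesis using that by blast
qed

lemma obj_tuples_concatE:
  assumes "Xs \<in> obj_tuples (concat Ass)"
  obtains Xss where "Xs = concat Xss" "list_all2 (\<lambda>Xs As. Xs \<in> obj_tuples As) Xss Ass"
  using list_all2_concatE[of _ Xs Ass] assms by (auto simp: obj_tuples_def)

lemma obj_tuples_length: "Xs \<in> obj_tuples As \<Longrightarrow> length Xs = length As"
  by (auto simp: obj_tuples_def dest: list_all2_lengthD)

lemma obj_tuples_nth: "\<lbrakk>Xs \<in> obj_tuples As; i < length As\<rbrakk> \<Longrightarrow> Xs ! i \<in> Obj (As ! i)"
  by (auto simp: obj_tuples_def list_all2_conv_all_nth)

text \<open>No bound on \<open>i\<close> is assumed, because an update out of range leaves the list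
  as it is.\<close>

lemma obj_tuples_update: "\<lbrakk>Xs \<in> obj_tuples As; X \<in> Obj (As ! i)\<rbrakk> \<Longrightarrow> Xs[i := X] \<in> obj_tuples As"
  by (auto simp: obj_tuples_def list_all2_conv_all_nth)
    (metis nth_list_update_eq nth_list_update_neq)

section \<open>2-cells, functors and natural transformations\<close>

context f_category
begin

text \<open>The axioms speak of membership in hom sets. Splitting them into separate facts about the
  carrier, the domain and the codomain makes them usable as rewrite rules; the next lemmas do the
  same for the other operations.\<close>

lemma comp1_props:
  assumes "f \<in> Loose C" "g \<in> Loose C" "fdom C g = fcod C f"
  shows "comp1 C g f \<in> Loose C" "fdom C (comp1 C g f) = fdom C f" "fcod C (comp1 C g f) = fcod C g"
  using comp1_hom[of g f] assms by (auto simp: composable1_def loose_hom_def)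

lemma id1_props:
  assumes "X \<in> Obj C"
  shows "id1 C X \<in> Loose C" "fdom C (id1 C X) = X" "fcod C (id1 C X) = X"
  using id1_hom[OF assms] by (auto simp: loose_hom_def)

lemma id2_props:
  assumes "f \<in> Loose C"
  shows "id2 C f \<in> Cell C" "fsrc C (id2 C f) = f" "ftrg C (id2 C f) = f"
  using id2_hom[OF assms] by (auto simp: cell_hom_def)

lemma vcomp_props:
  assumes "\<alpha> \<in> Cell C" "\<beta> \<in> Cell C" "fsrc C \<beta> = ftrg C \<alpha>"
  shows "vcomp C \<beta> \<alpha> \<in> Cell C" "fsrc C (vcomp C \<beta> \<alpha>) = fsrc C \<alpha>" "ftrg C (vcomp C \<beta> \<alpha>) = ftrg C \<beta>"
  using vcomp_hom[of \<beta> \<alpha>] assms by (auto simp: vcomposable_def cell_hom_def)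

lemma hcomp_props:
  assumes "\<alpha> \<in> Cell C" "\<beta> \<in> Cell C" "fdom C (fsrc C \<beta>) = fcod C (fsrc C \<alpha>)"
  shows "hcomp C \<beta> \<alpha> \<in> Cell C" "fsrc C (hcomp C \<beta> \<alpha>) = comp1 C (fsrc C \<beta>) (fsrc C \<alpha>)"
    "ftrg C (hcomp C \<beta> \<alpha>) = comp1 C (ftrg C \<beta>) (ftrg C \<alpha>)"
  using hcomp_hom[of \<beta> \<alpha>] assms by (auto simp: hcomposable_def cell_hom_def)

text \<open>Oriented towards composites nested to the right, which serve as the normal form of
  1-cells in all later simplifications.\<close>

lemma comp1_assoc':
  assumes "f \<in> Loose C" "g \<in> Loose C" "h \<in> Loose C" "fdom C g = fcod C f" "fdom C h = fcod C g"
  shows "comp1 C (comp1 C h g) f = comp1 C h (comp1 C g f)"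
  using comp1_assoc[of g f h] assms by (simp add: composable1_def)

lemma vcomp_assoc':
  assumes "\<alpha> \<in> Cell C" "\<beta> \<in> Cell C" "\<gamma> \<in> Cell C" "fsrc C \<beta> = ftrg C \<alpha>" "fsrc C \<gamma> = ftrg C \<beta>"
  shows "vcomp C (vcomp C \<gamma> \<beta>) \<alpha> = vcomp C \<gamma> (vcomp C \<beta> \<alpha>)"
  using vcomp_assoc[of \<beta> \<alpha> \<gamma>] assms by (simp add: vcomposable_def)

lemma inverse_cells_unique:
  assumes "inverse_cells C \<alpha> \<beta>" "inverse_cells C \<alpha> \<gamma>"
  shows "\<beta> = \<gamma>"
proof -
  have c: "\<alpha> \<in> Cell C" "\<beta> \<in> Cell C" "\<gamma> \<in> Cell C" "fsrc C \<beta> = ftrg C \<alpha>" "ftrg C \<beta> = fsrc C \<alpha>"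
    "fsrc C \<gamma> = ftrg C \<alpha>" "ftrg C \<gamma> = fsrc C \<alpha>"
    using assms by (auto simp: inverse_cells_def cell_hom_def)
  have "\<beta> = vcomp C (id2 C (fsrc C \<alpha>)) \<beta>" using vcomp_id_left[of \<beta>] c by simp
  also have "\<dots> = vcomp C (vcomp C \<gamma> \<alpha>) \<beta>" using assms by (simp add: inverse_cells_def)
  also have "\<dots> = vcomp C \<gamma> (vcomp C \<alpha> \<beta>)" using c by (simp add: vcomp_assoc')
  also have "\<dots> = vcomp C \<gamma> (id2 C (ftrg C \<alpha>))" using assms by (simp add: inverse_cells_def)
  also have "\<dots> = \<gamma>" using vcomp_id_right[of \<gamma>] c by simp
  finally show ?thesis .
qed

lemma inv_cell_eq: "inverse_cells C \<alpha> \<beta> \<Longrightarrow> inv_cell C \<alpha> = \<beta>"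
  unfolding inv_cell_def by (rule the_equality) (auto intro: inverse_cells_unique)

lemma inverse_cells_sym: "inverse_cells C \<alpha> \<beta> \<Longrightarrow> inverse_cells C \<beta> \<alpha>"
  by (auto simp: inverse_cells_def cell_hom_def)

lemma inverse_cells_id2: "f \<in> Loose C \<Longrightarrow> inverse_cells C (id2 C f) (id2 C f)"
  using vcomp_id_left[of "id2 C f"] by (simp add: inverse_cells_def id2_props cell_hom_def)

lemma inverse_cells_vcomp:
  assumes "inverse_cells C \<alpha> \<alpha>'" "inverse_cells C \<beta> \<beta>'" "fsrc C \<beta> = ftrg C \<alpha>"
  shows "inverse_cells C (vcomp C \<beta> \<alpha>) (vcomp C \<alpha>' \<beta>')"
proof -
  have c: "\<alpha> \<in> Cell C" "\<beta> \<in> Cell C" "\<alpha>' \<in> Cell C" "\<beta>' \<in> Cell C"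
    "fsrc C \<alpha>' = ftrg C \<alpha>" "ftrg C \<alpha>' = fsrc C \<alpha>" "fsrc C \<beta>' = ftrg C \<beta>" "ftrg C \<beta>' = fsrc C \<beta>"
    and e: "vcomp C \<alpha>' \<alpha> = id2 C (fsrc C \<alpha>)" "vcomp C \<alpha> \<alpha>' = id2 C (ftrg C \<alpha>)"
      "vcomp C \<beta>' \<beta> = id2 C (fsrc C \<beta>)" "vcomp C \<beta> \<beta>' = id2 C (ftrg C \<beta>)"
    using assms by (auto simp: inverse_cells_def cell_hom_def)
  have "vcomp C (vcomp C \<alpha>' \<beta>') (vcomp C \<beta> \<alpha>) = vcomp C \<alpha>' (vcomp C (vcomp C \<beta>' \<beta>) \<alpha>)"
    using c assms(3) by (simp add: vcomp_assoc' vcomp_props)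
  also have "\<dots> = id2 C (fsrc C \<alpha>)" using c e assms(3) vcomp_id_left[of \<alpha>] by simp
  finally have 1: "vcomp C (vcomp C \<alpha>' \<beta>') (vcomp C \<beta> \<alpha>) = id2 C (fsrc C \<alpha>)" .
  have "vcomp C (vcomp C \<beta> \<alpha>) (vcomp C \<alpha>' \<beta>') = vcomp C \<beta> (vcomp C (vcomp C \<alpha> \<alpha>') \<beta>')"
    using c assms(3) by (simp add: vcomp_assoc' vcomp_props)
  also have "\<dots> = id2 C (ftrg C \<beta>)" using c e assms(3) vcomp_id_left[of \<beta>'] by simp
  finally show ?thesis using 1 c assms(3) by (simp add: inverse_cells_def cell_hom_def vcomp_props)
qed

text \<open>Interchange, applied to the identity 2-cell of \<open>g\<close> written as its own
  vertical square.\<close>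

lemma hcomp_vcomp_whisker_left:
  assumes "\<alpha> \<in> Cell C" "\<beta> \<in> Cell C" "fsrc C \<beta> = ftrg C \<alpha>" "g \<in> Loose C" "fdom C g = fcod C (fsrc C \<alpha>)"
  shows "hcomp C (id2 C g) (vcomp C \<beta> \<alpha>) = vcomp C (hcomp C (id2 C g) \<beta>) (hcomp C (id2 C g) \<alpha>)"
  using interchange[of \<beta> \<alpha> "id2 C g" "id2 C g"] vcomp_id_left[of "id2 C g"] assms
  by (simp add: vcomposable_def hcomposable_def id2_props)

lemma hcomp_vcomp_whisker_right:
  assumes "\<alpha> \<in> Cell C" "\<beta> \<in> Cell C" "fsrc C \<beta> = ftrg C \<alpha>" "f \<in> Loose C" "fdom C (fsrc C \<alpha>) = fcod C f"
  shows "hcomp C (vcomp C \<beta> \<alpha>) (id2 C f) = vcomp C (hcomp C \<beta> (id2 C f)) (hcomp C \<alpha> (id2 C f))"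
  using interchange[of "id2 C f" "id2 C f" \<beta> \<alpha>] vcomp_id_left[of "id2 C f"] assms
  by (simp add: vcomposable_def hcomposable_def id2_props)

lemma inverse_cells_whisker_left:
  assumes "inverse_cells C \<alpha> \<beta>" "g \<in> Loose C" "fdom C g = fcod C (fsrc C \<alpha>)"
  shows "inverse_cells C (hcomp C (id2 C g) \<alpha>) (hcomp C (id2 C g) \<beta>)"
proof -
  have c: "\<alpha> \<in> Cell C" "\<beta> \<in> Cell C" "fsrc C \<beta> = ftrg C \<alpha>" "ftrg C \<beta> = fsrc C \<alpha>"
    and e: "vcomp C \<beta> \<alpha> = id2 C (fsrc C \<alpha>)" "vcomp C \<alpha> \<beta> = id2 C (ftrg C \<alpha>)"
    using assms by (auto simp: inverse_cells_def cell_hom_def)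
  note p = cell_parallel[OF c(1)] src_loose[OF c(1)] trg_loose[OF c(1)]
  show ?thesis
    using hcomp_vcomp_whisker_left[of \<alpha> \<beta> g] hcomp_vcomp_whisker_left[of \<beta> \<alpha> g]
      hcomp_id2[of g "fsrc C \<alpha>"] hcomp_id2[of g "ftrg C \<alpha>"] c e p assms(2,3)
    by (simp add: inverse_cells_def cell_hom_def hcomp_props id2_props composable1_def)
qed

lemma inverse_cells_whisker_right:
  assumes "inverse_cells C \<alpha> \<beta>" "f \<in> Loose C" "fdom C (fsrc C \<alpha>) = fcod C f"
  shows "inverse_cells C (hcomp C \<alpha> (id2 C f)) (hcomp C \<beta> (id2 C f))"
proof -
  have c: "\<alpha> \<in> Cell C" "\<beta> \<in> Cell C" "fsrc C \<beta> = ftrg C \<alpha>" "ftrg C \<beta> = fsrc C \<alpha>"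
    and e: "vcomp C \<beta> \<alpha> = id2 C (fsrc C \<alpha>)" "vcomp C \<alpha> \<beta> = id2 C (ftrg C \<alpha>)"
    using assms by (auto simp: inverse_cells_def cell_hom_def)
  note p = cell_parallel[OF c(1)] src_loose[OF c(1)] trg_loose[OF c(1)]
  show ?thesis
    using hcomp_vcomp_whisker_right[of \<alpha> \<beta> f] hcomp_vcomp_whisker_right[of \<beta> \<alpha> f]
      hcomp_id2[of "fsrc C \<alpha>" f] hcomp_id2[of "ftrg C \<alpha>" f] c e p assms(2,3)
    by (simp add: inverse_cells_def cell_hom_def hcomp_props id2_props composable1_def)
qed

text \<open>Only the direction of the cell matters here, so the four weaknesses fall into two cases.
  Looseness of the composite serves the strict case, where the cell is an identity 2-cell and its
  boundary has to be computed.\<close>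

lemma wcell_props:
  assumes "wcell C w f g h k \<alpha>" "comp1 C h f \<in> Loose C"
  shows "\<alpha> \<in> Cell C" "fsrc C \<alpha> = (if w = Colax then comp1 C k g else comp1 C h f)"
    "ftrg C \<alpha> = (if w = Colax then comp1 C h f else comp1 C k g)"
  using assms(1) id2_props[OF assms(2)] by (cases w; auto simp: cell_hom_def)+

text \<open>A commutative square of 2-cells remains commutative when two opposite sides are
  inverted. It turns the lax naturality equation of invertible cells into the colax one for their
  inverses.\<close>

lemma vcomp_swap_inverses:
  assumes "inverse_cells C \<alpha> \<alpha>'" "inverse_cells C \<beta> \<beta>'" "\<gamma> \<in> Cell C" "\<delta> \<in> Cell C"
    and "fsrc C \<gamma> = ftrg C \<alpha>" "ftrg C \<delta> = fsrc C \<beta>" "fsrc C \<delta> = fsrc C \<alpha>" "ftrg C \<gamma> = ftrg C \<beta>"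
    and eq: "vcomp C \<gamma> \<alpha> = vcomp C \<beta> \<delta>"
  shows "vcomp C \<delta> \<alpha>' = vcomp C \<beta>' \<gamma>"
proof -
  have c: "\<alpha> \<in> Cell C" "\<beta> \<in> Cell C" "\<alpha>' \<in> Cell C" "\<beta>' \<in> Cell C"
    "fsrc C \<alpha>' = ftrg C \<alpha>" "ftrg C \<alpha>' = fsrc C \<alpha>" "fsrc C \<beta>' = ftrg C \<beta>" "ftrg C \<beta>' = fsrc C \<beta>"
    and e: "vcomp C \<alpha> \<alpha>' = id2 C (ftrg C \<alpha>)" "vcomp C \<beta>' \<beta> = id2 C (fsrc C \<beta>)"
    using assms by (auto simp: inverse_cells_def cell_hom_def)
  have "vcomp C \<delta> \<alpha>' = vcomp C (vcomp C (vcomp C \<beta>' \<beta>) \<delta>) \<alpha>'"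
    using assms(3-8) e vcomp_id_left[of \<delta>] by simp
  also have "\<dots> = vcomp C \<beta>' (vcomp C (vcomp C \<beta> \<delta>) \<alpha>')"
    using c assms(3-8) by (simp add: vcomp_assoc' vcomp_props)
  also have "\<dots> = vcomp C \<beta>' (vcomp C (vcomp C \<gamma> \<alpha>) \<alpha>')" by (simp add: eq)
  also have "\<dots> = vcomp C \<beta>' (vcomp C \<gamma> (vcomp C \<alpha> \<alpha>'))"
    using c assms(3-8) by (simp add: vcomp_assoc' vcomp_props)
  also have "\<dots> = vcomp C \<beta>' \<gamma>" using assms(3-8) e vcomp_id_right[of \<gamma>] by simp
  finally show ?thesis .
qed

end

section \<open>Preservation of cells and cubes by functors\<close>

context f_functor
begin

lemma map_loose_props:
  assumes "f \<in> Loose A"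
  shows "farr F f \<in> Loose B" "fdom B (farr F f) = fobj F (fdom A f)" "fcod B (farr F f) = fobj F (fcod A f)"
  using map_loose[OF assms] by (auto simp: loose_hom_def)

lemma map_cell_props:
  assumes "\<alpha> \<in> Cell A"
  shows "fcell F \<alpha> \<in> Cell B" "fsrc B (fcell F \<alpha>) = farr F (fsrc A \<alpha>)" "ftrg B (fcell F \<alpha>) = farr F (ftrg A \<alpha>)"
  using map_cell[OF assms] by (auto simp: cell_hom_def)

lemma map_comp1':
  "\<lbrakk>f \<in> Loose A; g \<in> Loose A; fdom A g = fcod A f\<rbrakk> \<Longrightarrow> farr F (comp1 A g f) = comp1 B (farr F g) (farr F f)"
  using map_comp1 by (simp add: composable1_def)

lemma map_vcomp':
  "\<lbrakk>\<alpha> \<in> Cell A; \<beta> \<in> Cell A; fsrc A \<beta> = ftrg A \<alpha>\<rbrakk> \<Longrightarrow>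
    fcell F (vcomp A \<beta> \<alpha>) = vcomp B (fcell F \<beta>) (fcell F \<alpha>)"
  using map_vcomp by (simp add: vcomposable_def)

lemma map_hcomp':
  "\<lbrakk>\<alpha> \<in> Cell A; \<beta> \<in> Cell A; fdom A (fsrc A \<beta>) = fcod A (fsrc A \<alpha>)\<rbrakk> \<Longrightarrow>
    fcell F (hcomp A \<beta> \<alpha>) = hcomp B (fcell F \<beta>) (fcell F \<alpha>)"
  using map_hcomp by (simp add: hcomposable_def)

lemma map_whisker_left:
  "\<lbrakk>\<alpha> \<in> Cell A; g \<in> Loose A; fdom A g = fcod A (fsrc A \<alpha>)\<rbrakk> \<Longrightarrow>
    fcell F (hcomp A (id2 A g) \<alpha>) = hcomp B (id2 B (farr F g)) (fcell F \<alpha>)"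
  by (simp add: map_hcomp' A.id2_props map_id2)

lemma map_whisker_right:
  "\<lbrakk>\<alpha> \<in> Cell A; f \<in> Loose A; fdom A (fsrc A \<alpha>) = fcod A f\<rbrakk> \<Longrightarrow>
    fcell F (hcomp A \<alpha> (id2 A f)) = hcomp B (fcell F \<alpha>) (id2 B (farr F f))"
  by (simp add: map_hcomp' A.id2_props map_id2)

lemma map_inverse_cells: "inverse_cells A \<alpha> \<beta> \<Longrightarrow> inverse_cells B (fcell F \<alpha>) (fcell F \<beta>)"
  using map_vcomp'[of \<alpha> \<beta>] map_vcomp'[of \<beta> \<alpha>] A.src_loose[of \<alpha>] A.trg_loose[of \<alpha>]
  by (auto simp: inverse_cells_def cell_hom_def map_cell_props map_id2)

lemma map_inv_cell: "inverse_cells A \<alpha> \<beta> \<Longrightarrow> fcell F (inv_cell A \<alpha>) = inv_cell B (fcell F \<alpha>)"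
  using map_inverse_cells[of \<alpha> \<beta>] A.inv_cell_eq B.inv_cell_eq by metis

lemma map_wcell:
  assumes "wcell A w f g h k \<alpha>"
    and l: "f \<in> Loose A" "g \<in> Loose A" "h \<in> Loose A" "k \<in> Loose A" "fdom A h = fcod A f" "fdom A k = fcod A g"
  shows "wcell B w (farr F f) (farr F g) (farr F h) (farr F k) (fcell F \<alpha>)"
proof (cases w)
  case Strict
  \<comment> \<open>A strict cell includes an equation between composite 1-cells, so the images are
    folded back into images of composites, where that equation applies.\<close>
  then show ?thesis using assms map_id2[of "comp1 A h f"]
    by (auto simp: A.comp1_props simp flip: map_comp1')
next
  case Pseudo
  then show ?thesis using assms map_cell[of \<alpha>]
    by (auto simp: cell_hom_def map_cell_props map_comp1' dest: map_inverse_cells)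
next
  case Lax
  then show ?thesis using assms by (auto simp: cell_hom_def map_cell_props map_comp1')
next
  case Colax
  then show ?thesis using assms by (auto simp: cell_hom_def map_cell_props map_comp1')
qed

text \<open>Only the pseudo case has content: there the hypothesis supplies an inverse, without
  which \<open>inv_cell\<close> has no meaning.\<close>

lemma map_wtranspose:
  "wcell A w f g h k \<alpha> \<Longrightarrow> fcell F (wtranspose A w \<alpha>) = wtranspose B w (fcell F \<alpha>)"
  by (cases w) (auto simp: wtranspose_def map_inv_cell)

lemma map_wcell_restricts:
  assumes "wcell_restricts A w' w f g h k \<alpha>"
    and l: "f \<in> Loose A" "g \<in> Loose A" "h \<in> Loose A" "k \<in> Loose A" "fdom A h = fcod A f" "fdom A k = fcod A g"
  shows "wcell_restricts B w' w (farr F f) (farr F g) (farr F h) (farr F k) (fcell F \<alpha>)"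
  using assms(1) map_wcell[OF _ l] map_inverse_cells unfolding wcell_restricts_def
  by (metis (full_types))

end

text \<open>
  The two pastings of the faces of a cube, with \<open>p\<^sub>0\<close>, \<open>p\<^sub>3\<close> the initial and the final edges in direction
  \<open>p\<close>; the remaining edges are \<open>r\<^sub>1\<close> (moved along \<open>s\<close>), \<open>r\<^sub>2\<close> (along \<open>t\<close>), \<open>s\<^sub>1\<close> (along \<open>r\<close>), \<open>s\<^sub>2\<close> (along \<open>t\<close>),
  \<open>t\<^sub>1\<close> (along \<open>s\<close>) and \<open>t\<^sub>2\<close> (along \<open>r\<close>).
\<close>
definition cube_commutes ::
  "('o, 'a, 'c) fcat \<Rightarrow> weakness \<Rightarrow> 'a \<Rightarrow> 'c \<Rightarrow> 'c \<Rightarrow> 'a \<Rightarrow> 'a \<Rightarrow> 'c \<Rightarrow> 'c \<Rightarrow> 'a \<Rightarrow> 'a \<Rightarrow> 'c \<Rightarrow> 'c \<Rightarrow> 'a \<Rightarrow> bool" where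
  "cube_commutes C w t3 rs rt' s0 r3 st st' r0 s3 rt rs' t0 \<longleftrightarrow>
    (if w = Colax
     then vcomp C (hcomp C (id2 C t3) rs) (vcomp C (hcomp C rt' (id2 C s0)) (hcomp C (id2 C r3) st))
        = vcomp C (hcomp C st' (id2 C r0)) (vcomp C (hcomp C (id2 C s3) rt) (hcomp C rs' (id2 C t0)))
     else vcomp C (hcomp C (id2 C r3) st) (vcomp C (hcomp C rt' (id2 C s0)) (hcomp C (id2 C t3) rs))
        = vcomp C (hcomp C rs' (id2 C t0)) (vcomp C (hcomp C (id2 C s3) rt) (hcomp C st' (id2 C r0))))"

text \<open>Keeps of an interchange cell only its boundary and its direction. The typing of a
  pasting depends on nothing else, so strict, pseudo and lax cells can be treated alike.\<close>

definition face :: "('o, 'a, 'c) fcat \<Rightarrow> weakness \<Rightarrow> 'a \<Rightarrow> 'a \<Rightarrow> 'c set" where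
  "face C w f g = (if w = Colax then cell_hom C g f else cell_hom C f g)"

text \<open>A functor preserves vertical composites and whiskerings, so it can be applied to both
  pastings. The twelve edges, their incidences and the six faces ensure that all composites involved
  are defined.\<close>

lemma (in f_functor) map_cube_commutes:
  assumes cube: "cube_commutes A w t3 rs rt' s0 r3 st st' r0 s3 rt rs' t0"
    and loose: "r0 \<in> Loose A" "r1 \<in> Loose A" "r2 \<in> Loose A" "r3 \<in> Loose A"
      "s0 \<in> Loose A" "s1 \<in> Loose A" "s2 \<in> Loose A" "s3 \<in> Loose A"
      "t0 \<in> Loose A" "t1 \<in> Loose A" "t2 \<in> Loose A" "t3 \<in> Loose A"
    and ends: "fdom A s1 = fcod A r0" "fdom A t2 = fcod A r0" "fdom A r1 = fcod A s0" "fdom A t1 = fcod A s0"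
      "fdom A r2 = fcod A t0" "fdom A s2 = fcod A t0" "fdom A t3 = fcod A r1" "fcod A s1 = fcod A r1"
      "fdom A s3 = fcod A r2" "fcod A t2 = fcod A r2" "fdom A r3 = fcod A s2" "fcod A t1 = fcod A s2"
    and faces: "rs \<in> face A w (comp1 A s1 r0) (comp1 A r1 s0)" "rs' \<in> face A w (comp1 A s3 r2) (comp1 A r3 s2)"
      "rt \<in> face A w (comp1 A t2 r0) (comp1 A r2 t0)" "rt' \<in> face A w (comp1 A t3 r1) (comp1 A r3 t1)"
      "st \<in> face A w (comp1 A t1 s0) (comp1 A s2 t0)" "st' \<in> face A w (comp1 A t3 s1) (comp1 A s3 t2)"
  shows "cube_commutes B w (farr F t3) (fcell F rs) (fcell F rt') (farr F s0) (farr F r3) (fcell F st)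
    (fcell F st') (farr F r0) (farr F s3) (fcell F rt) (fcell F rs') (farr F t0)"
proof (cases "w = Colax")
  case True
  have "fcell F (vcomp A (hcomp A (id2 A t3) rs) (vcomp A (hcomp A rt' (id2 A s0)) (hcomp A (id2 A r3) st)))
    = fcell F (vcomp A (hcomp A st' (id2 A r0)) (vcomp A (hcomp A (id2 A s3) rt) (hcomp A rs' (id2 A t0))))"
    using cube True by (simp add: cube_commutes_def)
  then show ?thesis using True loose ends faces
    by (simp add: cube_commutes_def face_def cell_hom_def map_vcomp' map_whisker_left map_whisker_right
        A.hcomp_props A.vcomp_props A.id2_props A.comp1_props A.comp1_assoc')
next
  case False
  have "fcell F (vcomp A (hcomp A (id2 A r3) st) (vcomp A (hcomp A rt' (id2 A s0)) (hcomp A (id2 A t3) rs)))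
    = fcell F (vcomp A (hcomp A rs' (id2 A t0)) (vcomp A (hcomp A (id2 A s3) rt) (hcomp A st' (id2 A r0))))"
    using cube False by (simp add: cube_commutes_def)
  then show ?thesis using False loose ends faces
    by (simp add: cube_commutes_def face_def cell_hom_def map_vcomp' map_whisker_left map_whisker_right
        A.hcomp_props A.vcomp_props A.id2_props A.comp1_props A.comp1_assoc')
qed

lemma ffun_eqI:
  fixes F G :: "('o, 'a, 'c, 'p, 'b, 'd) ffun"
  shows "\<lbrakk>fobj F = fobj G; farr F = farr G; fcell F = fcell G\<rbrakk> \<Longrightarrow> F = G"
  by simp

lemma ffun_comp_sel:
  "X \<in> Obj A \<Longrightarrow> fobj (ffun_comp A G F) X = fobj G (fobj F X)"
  "f \<in> Loose A \<Longrightarrow> farr (ffun_comp A G F) f = farr G (farr F f)"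
  "\<alpha> \<in> Cell A \<Longrightarrow> fcell (ffun_comp A G F) \<alpha> = fcell G (fcell F \<alpha>)"
  by (simp_all add: ffun_comp_def compose_def)

lemma f_functor_id: "f_category A \<Longrightarrow> f_functor A A (ffun_id A)"
proof -
  assume "f_category A"
  then interpret f_category A .
  show ?thesis
    by unfold_locales
      (auto simp: ffun_id_def id1_props id2_props comp1_props vcomp_props hcomp_props composable1_def
        vcomposable_def hcomposable_def loose_hom_def cell_hom_def dom_obj cod_obj src_loose trg_loose
        intro: subsetD[OF tight_loose])
qed

lemma f_functor_comp:
  assumes "f_functor A B F" "f_functor B C G"
  shows "f_functor A C (ffun_comp A G F)"
proof -
  interpret F: f_functor A B F by fact
  interpret G: f_functor B C G by fact
  show ?thesis
  proof (unfold_locales, goal_cases)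
    case (3 f)
    then show ?case using F.A.tight_loose F.map_tight G.map_tight by (auto simp: ffun_comp_sel)
  next
    case 10
    then show ?case by (simp add: ffun_comp_def)
  next
    case 11
    then show ?case by (simp add: ffun_comp_def)
  next
    case 12
    then show ?case by (simp add: ffun_comp_def)
  qed (auto simp: ffun_comp_sel F.A.id1_props F.A.id2_props F.A.comp1_props F.A.vcomp_props F.A.hcomp_props
        composable1_def vcomposable_def hcomposable_def loose_hom_def cell_hom_def F.A.dom_obj F.A.cod_obj
        F.A.src_loose F.A.trg_loose F.map_obj G.map_obj F.map_loose_props G.map_loose_props F.map_cell_props
        G.map_cell_props F.map_id1 G.map_id1 F.map_id2 G.map_id2 F.map_comp1' G.map_comp1' F.map_vcomp'
        G.map_vcomp' F.map_hcomp' G.map_hcomp')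
qed

lemma ffun_comp_assoc:
  assumes "f_functor A B F"
  shows "ffun_comp A H (ffun_comp A G F) = ffun_comp A (ffun_comp B H G) F"
proof -
  interpret f_functor A B F by fact
  show ?thesis
    by (rule ffun_eqI)
      (auto simp: ffun_comp_def compose_def fun_eq_iff map_obj map_loose_props map_cell_props)
qed

text \<open>An equality of records, and not just agreement on carriers, because both sides are
  \<open>undefined\<close> elsewhere.\<close>

lemma ffun_comp_id_right: "f_functor A B F \<Longrightarrow> ffun_comp A F (ffun_id A) = F"
proof -
  assume "f_functor A B F"
  then interpret f_functor A B F .
  show ?thesis
    by (rule ffun_eqI)
      (auto simp: ffun_comp_def ffun_id_def compose_def fun_eq_iff
        extensional_arb[OF obj_ext] extensional_arb[OF arr_ext] extensional_arb[OF cell_ext])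
qed

lemma ffun_comp_id_left: "f_functor A B F \<Longrightarrow> ffun_comp A (ffun_id B) F = F"
proof -
  assume "f_functor A B F"
  then interpret f_functor A B F .
  show ?thesis
    by (rule ffun_eqI)
      (auto simp: ffun_comp_def ffun_id_def compose_def fun_eq_iff map_obj map_loose_props map_cell_props
        extensional_arb[OF obj_ext] extensional_arb[OF arr_ext] extensional_arb[OF cell_ext])
qed

lemma loose_natural_cong:
  assumes "loose_natural w A C F G \<phi> \<phi>c"
    and "\<And>X. X \<in> Obj A \<Longrightarrow> \<psi> X = \<phi> X" "\<And>s. s \<in> Loose A \<Longrightarrow> \<psi>c s = \<phi>c s"
  shows "loose_natural w A C F G \<psi> \<psi>c"
proof -
  interpret loose_natural w A C F G \<phi> \<phi>c by fact
  show ?thesis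
  proof (unfold_locales, goal_cases)
    case (4 t s)
    then show ?case using comp[of t s] by (auto simp: assms(2-) composable1_def F.A.comp1_props)
  next
    case (5 \<alpha>)
    then have "\<psi>c (fsrc A \<alpha>) = \<phi>c (fsrc A \<alpha>)" "\<psi>c (ftrg A \<alpha>) = \<phi>c (ftrg A \<alpha>)"
      "\<psi> (fdom A (fsrc A \<alpha>)) = \<phi> (fdom A (fsrc A \<alpha>))" "\<psi> (fcod A (fsrc A \<alpha>)) = \<phi> (fcod A (fsrc A \<alpha>))"
      by (simp_all add: assms(2-) F.A.src_loose F.A.trg_loose F.A.dom_obj F.A.cod_obj)
    then show ?case using natural[OF 5] by simp
  qed (use component square unit in \<open>auto simp: assms(2-) F.A.id1_props F.A.dom_obj F.A.cod_obj\<close>)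
qed

section \<open>Whiskering, change of direction and cubes for natural transformations\<close>

context loose_natural
begin

lemma component_props:
  assumes "X \<in> Obj A"
  shows "\<phi> X \<in> Loose C" "fdom C (\<phi> X) = fobj F X" "fcod C (\<phi> X) = fobj G X"
  using component[OF assms] by (auto simp: loose_hom_def)

lemma top_right:
  assumes "s \<in> Loose A"
  shows "comp1 C (farr G s) (\<phi> (fdom A s)) \<in> Loose C"
    "fdom C (comp1 C (farr G s) (\<phi> (fdom A s))) = fobj F (fdom A s)"
    "fcod C (comp1 C (farr G s) (\<phi> (fdom A s))) = fobj G (fcod A s)"
  using assms by (simp_all add: F.B.comp1_props component_props F.A.dom_obj G.map_loose_props)

lemma left_bottom:
  assumes "s \<in> Loose A"
  shows "comp1 C (\<phi> (fcod A s)) (farr F s) \<in> Loose C"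
    "fdom C (comp1 C (\<phi> (fcod A s)) (farr F s)) = fobj F (fdom A s)"
    "fcod C (comp1 C (\<phi> (fcod A s)) (farr F s)) = fobj G (fcod A s)"
  using assms by (simp_all add: F.B.comp1_props component_props F.A.cod_obj F.map_loose_props)

lemma square_cell:
  assumes "s \<in> Loose A"
  shows "\<phi>c s \<in> Cell C"
    "fsrc C (\<phi>c s) = (if w = Colax then comp1 C (\<phi> (fcod A s)) (farr F s) else comp1 C (farr G s) (\<phi> (fdom A s)))"
    "ftrg C (\<phi>c s) = (if w = Colax then comp1 C (farr G s) (\<phi> (fdom A s)) else comp1 C (\<phi> (fcod A s)) (farr F s))"
    "fdom C (fsrc C (\<phi>c s)) = fobj F (fdom A s)"
    "fcod C (fsrc C (\<phi>c s)) = fobj G (fcod A s)"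
  using square[OF assms] F.B.id2_props[OF top_right(1)[OF assms]] top_right[OF assms] left_bottom[OF assms]
  by (cases w; auto simp: cell_hom_def)+

text \<open>Each axiom is a typing condition or an equation between pastings, and \<open>H\<close>
  preserves both.\<close>

lemma postcompose:
  assumes "f_functor C D H"
  shows "loose_natural w A D (ffun_comp A H F) (ffun_comp A H G) (\<lambda>X. farr H (\<phi> X)) (\<lambda>s. fcell H (\<phi>c s))"
proof -
  interpret H: f_functor C D H by fact
  interpret HF: f_functor A D "ffun_comp A H F" by (rule f_functor_comp) unfold_locales
  interpret HG: f_functor A D "ffun_comp A H G" by (rule f_functor_comp) unfold_locales
  note d = F.A.dom_obj F.A.cod_obj F.A.src_loose F.A.trg_loose component_props F.map_loose_props
    G.map_loose_props F.map_cell_props G.map_cell_props square_cell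
  show ?thesis
  proof (unfold_locales, goal_cases)
    case (1 X)
    then show ?case by (simp add: loose_hom_def ffun_comp_sel component_props H.map_loose_props)
  next
    case (2 s)
    then show ?case using H.map_wcell[OF square[OF 2]] by (simp add: ffun_comp_sel d)
  next
    case (3 X)
    then show ?case using H.map_id2[of "\<phi> X"] by (simp add: unit component_props)
  next
    case (4 t s)
    then have c: "t \<in> Loose A" "s \<in> Loose A" "fdom A t = fcod A s" by (auto simp: composable1_def)
    \<comment> \<open>The intermediate 1-cell of the pasting in its two bracketings; identifying
      them makes the whiskered cells vertically composable.\<close>
    have e: "comp1 C (farr G t) (comp1 C (\<phi> (fcod A s)) (farr F s))
        = comp1 C (comp1 C (farr G t) (\<phi> (fdom A t))) (farr F s)"
      using c by (simp add: F.B.comp1_assoc' d)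
    show ?case using c e
      by (simp add: comp[OF 4] ffun_comp_sel H.map_vcomp' H.map_whisker_left H.map_whisker_right d
          F.B.hcomp_props F.B.id2_props F.B.comp1_props)
  next
    case (5 \<alpha>)
    have p: "fdom A (fsrc A \<alpha>) = fdom A (ftrg A \<alpha>)" "fcod A (fsrc A \<alpha>) = fcod A (ftrg A \<alpha>)"
      using F.A.cell_parallel[OF 5] by auto
    have "fcell H (vcomp C (hcomp C (fcell G \<alpha>) (id2 C (\<phi> (fdom A (fsrc A \<alpha>))))) (\<phi>c (fsrc A \<alpha>)))
        = fcell H (vcomp C (\<phi>c (ftrg A \<alpha>)) (hcomp C (id2 C (\<phi> (fcod A (fsrc A \<alpha>)))) (fcell F \<alpha>)))"
      if "w = Colax" using natural[OF 5] that by simp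
    moreover have "fcell H (vcomp C (hcomp C (id2 C (\<phi> (fcod A (fsrc A \<alpha>)))) (fcell F \<alpha>)) (\<phi>c (fsrc A \<alpha>)))
        = fcell H (vcomp C (\<phi>c (ftrg A \<alpha>)) (hcomp C (fcell G \<alpha>) (id2 C (\<phi> (fdom A (fsrc A \<alpha>))))))"
      if "w \<noteq> Colax" using natural[OF 5] that by simp
    ultimately show ?case using 5
      by (simp add: ffun_comp_sel H.map_vcomp' H.map_whisker_left H.map_whisker_right d p
          F.B.hcomp_props F.B.id2_props split: if_splits)
  qed
qed

text \<open>The axioms are instances of the given ones at images under \<open>K\<close>.\<close>

lemma precompose:
  assumes "f_functor B A K"
  shows "loose_natural w B C (ffun_comp B F K) (ffun_comp B G K) (\<lambda>X. \<phi> (fobj K X)) (\<lambda>s. \<phi>c (farr K s))"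
proof -
  interpret K: f_functor B A K by fact
  interpret FK: f_functor B C "ffun_comp B F K" by (rule f_functor_comp) unfold_locales
  interpret GK: f_functor B C "ffun_comp B G K" by (rule f_functor_comp) unfold_locales
  show ?thesis
  proof (unfold_locales, goal_cases)
    case (1 X)
    then show ?case using component[of "fobj K X"] by (simp add: ffun_comp_sel K.map_obj)
  next
    case (2 s)
    then show ?case using square[of "farr K s"] by (simp add: ffun_comp_sel K.map_loose_props)
  next
    case (3 X)
    then show ?case using unit[of "fobj K X"] by (simp add: K.map_id1 K.map_obj)
  next
    case (4 t s)
    then show ?case using comp[of "farr K t" "farr K s"]
      by (simp add: composable1_def ffun_comp_sel K.map_loose_props K.map_comp1')
  next
    case (5 \<alpha>)
    then show ?case using natural[of "fcell K \<alpha>"]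
      by (auto simp: ffun_comp_sel K.map_loose_props K.map_cell_props K.A.src_loose split: if_splits)
  qed
qed

text \<open>When all cells are identities, direction carries no information: every axiom reduces to
  an equation that can be read both ways.\<close>

lemma strict_colax:
  assumes "w = Strict"
  shows "loose_natural Colax A C F G \<phi> \<phi>c"
proof -
  have sq: "comp1 C (farr G s) (\<phi> (fdom A s)) = comp1 C (\<phi> (fcod A s)) (farr F s)"
    "\<phi>c s = id2 C (comp1 C (\<phi> (fcod A s)) (farr F s))" if "s \<in> Loose A" for s
    using square[OF that] assms by simp_all
  note d = F.A.dom_obj F.A.cod_obj F.A.src_loose F.A.trg_loose component_props F.map_loose_props
    G.map_loose_props F.map_cell_props G.map_cell_props
  show ?thesis
  proof (unfold_locales, goal_cases)
    case (2 s)
    then show ?case using square_cell[OF 2] sq[OF 2] assms by (simp add: cell_hom_def)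
  next
    case (4 t s)
    then have c: "t \<in> Loose A" "s \<in> Loose A" "fdom A t = fcod A s" by (auto simp: composable1_def)
    have l: "comp1 C (comp1 C (\<phi> (fcod A t)) (farr F t)) (farr F s) \<in> Loose C"
      using c by (simp add: d F.B.comp1_props)
    have "comp1 C (farr G t) (comp1 C (\<phi> (fcod A s)) (farr F s))
        = comp1 C (comp1 C (farr G t) (\<phi> (fdom A t))) (farr F s)"
      using c by (simp add: F.B.comp1_assoc' d)
    then have e: "comp1 C (farr G t) (comp1 C (\<phi> (fcod A s)) (farr F s))
        = comp1 C (comp1 C (\<phi> (fcod A t)) (farr F t)) (farr F s)" using sq(1)[OF c(1)] by simp
    \<comment> \<open>Both whiskered cells are the identity of one and the same 1-cell, so the order
      of their vertical composition is immaterial.\<close>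
    have "hcomp C (id2 C (farr G t)) (\<phi>c s) = id2 C (comp1 C (comp1 C (\<phi> (fcod A t)) (farr F t)) (farr F s))"
      "hcomp C (\<phi>c t) (id2 C (farr F s)) = id2 C (comp1 C (comp1 C (\<phi> (fcod A t)) (farr F t)) (farr F s))"
      using c e F.B.hcomp_id2[of "farr G t" "comp1 C (\<phi> (fcod A s)) (farr F s)"]
        F.B.hcomp_id2[of "comp1 C (\<phi> (fcod A t)) (farr F t)" "farr F s"]
      by (simp_all add: sq composable1_def d F.B.comp1_props)
    then show ?case using comp[OF 4] assms by simp
  next
    case (5 \<alpha>)
    have p: "fdom A (fsrc A \<alpha>) = fdom A (ftrg A \<alpha>)" "fcod A (fsrc A \<alpha>) = fcod A (ftrg A \<alpha>)"
      using F.A.cell_parallel[OF 5] by auto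
    let ?l = "hcomp C (id2 C (\<phi> (fcod A (fsrc A \<alpha>)))) (fcell F \<alpha>)"
    let ?r = "hcomp C (fcell G \<alpha>) (id2 C (\<phi> (fdom A (fsrc A \<alpha>))))"
    have l: "?l \<in> Cell C" "fsrc C ?l = comp1 C (\<phi> (fcod A (fsrc A \<alpha>))) (farr F (fsrc A \<alpha>))"
       "ftrg C ?l = comp1 C (\<phi> (fcod A (ftrg A \<alpha>))) (farr F (ftrg A \<alpha>))"
      using 5 by (simp_all add: F.B.hcomp_props F.B.id2_props d p)
    have r: "?r \<in> Cell C" "fsrc C ?r = comp1 C (farr G (fsrc A \<alpha>)) (\<phi> (fdom A (fsrc A \<alpha>)))"
       "ftrg C ?r = comp1 C (farr G (ftrg A \<alpha>)) (\<phi> (fdom A (ftrg A \<alpha>)))"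
      using 5 by (simp_all add: F.B.hcomp_props F.B.id2_props d p)
    \<comment> \<open>Removing the identity cells from the lax naturality equation leaves strict
      2-naturality.\<close>
    have "?l = ?r"
      using natural[OF 5] assms F.B.vcomp_id_right[OF l(1)] F.B.vcomp_id_left[OF r(1)] 5 l r
        sq[OF F.A.src_loose[OF 5]] sq[OF F.A.trg_loose[OF 5]] by simp
    then show ?case using 5 F.B.vcomp_id_right[OF r(1)] F.B.vcomp_id_left[OF l(1)] l r
        sq[OF F.A.src_loose[OF 5]] sq[OF F.A.trg_loose[OF 5]] by simp
  qed (simp_all add: component unit)
qed

text \<open>Inversion reverses pastings, so the lax axioms for \<open>\<phi>c\<close> become the
  colax ones for \<open>\<psi>c\<close>. The unit and composition axioms follow from uniqueness of
  inverses, naturality from inverting two sides of a square.\<close>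

lemma pseudo_inverse_colax:
  assumes "w = Pseudo" and inv: "\<And>s. s \<in> Loose A \<Longrightarrow> inverse_cells C (\<phi>c s) (\<psi>c s)"
  shows "loose_natural Colax A C F G \<phi> \<psi>c"
proof -
  have ic: "\<psi>c s \<in> Cell C" "fsrc C (\<psi>c s) = comp1 C (\<phi> (fcod A s)) (farr F s)"
    "ftrg C (\<psi>c s) = comp1 C (farr G s) (\<phi> (fdom A s))"
    if "s \<in> Loose A" for s
    using inv[OF that] square_cell[OF that] assms(1) by (auto simp: inverse_cells_def cell_hom_def)
  note d = F.A.dom_obj F.A.cod_obj F.A.src_loose F.A.trg_loose component_props F.map_loose_props
    G.map_loose_props F.map_cell_props G.map_cell_props
  show ?thesis
  proof (unfold_locales, goal_cases)
    case (2 s)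
    then show ?case using ic[OF 2] by (simp add: cell_hom_def)
  next
    case (3 X)
    have "inverse_cells C (id2 C (\<phi> X)) (\<psi>c (id1 A X))"
      using inv[of "id1 A X"] 3 by (simp add: unit F.A.id1_props)
    then show ?case using F.B.inverse_cells_id2[of "\<phi> X"] 3
      by (auto simp: component_props intro: F.B.inverse_cells_unique)
  next
    case (4 t s)
    then have c: "t \<in> Loose A" "s \<in> Loose A" "fdom A t = fcod A s" by (auto simp: composable1_def)
    have e: "comp1 C (farr G t) (comp1 C (\<phi> (fcod A s)) (farr F s))
        = comp1 C (comp1 C (farr G t) (\<phi> (fdom A t))) (farr F s)"
      using c by (simp add: F.B.comp1_assoc' d)
    have "inverse_cells C (\<phi>c (comp1 A t s))
      (vcomp C (hcomp C (id2 C (farr G t)) (\<psi>c s)) (hcomp C (\<psi>c t) (id2 C (farr F s))))"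
      unfolding comp[OF 4] using assms(1) c e
      by (auto intro!: F.B.inverse_cells_vcomp F.B.inverse_cells_whisker_left F.B.inverse_cells_whisker_right inv
          simp: square_cell d F.B.hcomp_props F.B.id2_props F.B.comp1_props)
    then show ?case using inv[of "comp1 A t s"] c
      by (auto simp: F.A.comp1_props intro: F.B.inverse_cells_unique)
  next
    case (5 \<alpha>)
    have p: "fdom A (fsrc A \<alpha>) = fdom A (ftrg A \<alpha>)" "fcod A (fsrc A \<alpha>) = fcod A (ftrg A \<alpha>)"
      using F.A.cell_parallel[OF 5] by auto
    have "vcomp C (hcomp C (fcell G \<alpha>) (id2 C (\<phi> (fdom A (fsrc A \<alpha>))))) (\<psi>c (fsrc A \<alpha>))
        = vcomp C (\<psi>c (ftrg A \<alpha>)) (hcomp C (id2 C (\<phi> (fcod A (fsrc A \<alpha>)))) (fcell F \<alpha>))"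
      by (rule F.B.vcomp_swap_inverses[OF inv inv])
        (use 5 natural[OF 5] assms(1) in \<open>simp_all add: d square_cell F.B.hcomp_props F.B.id2_props p\<close>)
    then show ?case by simp
  qed (simp_all add: component)
qed

text \<open>With a 2-cell between composite 1-cells, naturality becomes commutativity of a cube.\<close>
lemma natural_cube:
  assumes c: "composable1 A t s" "composable1 A t' s'" and \<alpha>: "\<alpha> \<in> cell_hom A (comp1 A t s) (comp1 A t' s')"
    and w: "w \<noteq> Colax"
  shows "vcomp C (hcomp C (id2 C (\<phi> (fcod A t))) (fcell F \<alpha>))
      (vcomp C (hcomp C (\<phi>c t) (id2 C (farr F s))) (hcomp C (id2 C (farr G t)) (\<phi>c s)))
    = vcomp C (hcomp C (\<phi>c t') (id2 C (farr F s')))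
      (vcomp C (hcomp C (id2 C (farr G t')) (\<phi>c s')) (hcomp C (fcell G \<alpha>) (id2 C (\<phi> (fdom A s)))))"
    (is "_ = vcomp C ?x (vcomp C ?y ?z)")
proof -
  have l: "s \<in> Loose A" "t \<in> Loose A" "s' \<in> Loose A" "t' \<in> Loose A" "fdom A t = fcod A s" "fdom A t' = fcod A s'"
    using c by (auto simp: composable1_def)
  have a: "\<alpha> \<in> Cell A" "fsrc A \<alpha> = comp1 A t s" "ftrg A \<alpha> = comp1 A t' s'"
    using \<alpha> by (auto simp: cell_hom_def)
  have p: "fdom A s = fdom A s'" "fcod A t = fcod A t'"
    using F.A.cell_parallel[OF a(1)] l a by (auto simp: F.A.comp1_props)
  note d = F.A.dom_obj F.A.cod_obj component_props F.map_loose_props G.map_loose_props F.map_cell_props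
    G.map_cell_props square_cell
  \<comment> \<open>These two equations of 1-cells match the boundaries inside the threefold
    composite. It can then be reassociated so that \<open>?x\<close> and \<open>?y\<close> combine
    to the cell at the composite of \<open>t'\<close> and \<open>s'\<close>.\<close>
  have "comp1 C (farr G t') (comp1 C (\<phi> (fcod A s')) (farr F s'))
      = comp1 C (comp1 C (farr G t') (\<phi> (fdom A t'))) (farr F s')"
    using l by (simp add: F.B.comp1_assoc' d)
  moreover have "comp1 C (comp1 C (farr G t') (farr G s')) (\<phi> (fdom A s))
      = comp1 C (farr G t') (comp1 C (farr G s') (\<phi> (fdom A s')))"
    using l p by (simp add: F.B.comp1_assoc' d)
  ultimately have "vcomp C ?x (vcomp C ?y ?z) = vcomp C (vcomp C ?x ?y) ?z"
    using l a p w
    by (intro F.B.vcomp_assoc'[symmetric])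
      (simp_all add: F.B.hcomp_props F.B.id2_props F.B.comp1_props d F.A.comp1_props G.map_comp1')
  then show ?thesis
    using natural[OF a(1)] a l w by (simp add: comp[OF c(1)] comp[OF c(2)] F.A.comp1_props)
qed

text \<open>Colax counterpart of the preceding cube: the cell coming from \<open>F\<close> is now
  applied first and the one coming from \<open>G\<close> last.\<close>

lemma natural_cube_colax:
  assumes c: "composable1 A t s" "composable1 A t' s'" and \<alpha>: "\<alpha> \<in> cell_hom A (comp1 A t s) (comp1 A t' s')"
    and w: "w = Colax"
  shows "vcomp C (hcomp C (fcell G \<alpha>) (id2 C (\<phi> (fdom A s))))
      (vcomp C (hcomp C (id2 C (farr G t)) (\<phi>c s)) (hcomp C (\<phi>c t) (id2 C (farr F s))))
    = vcomp C (hcomp C (id2 C (farr G t')) (\<phi>c s'))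
      (vcomp C (hcomp C (\<phi>c t') (id2 C (farr F s'))) (hcomp C (id2 C (\<phi> (fcod A t))) (fcell F \<alpha>)))"
    (is "_ = vcomp C ?x (vcomp C ?y ?z)")
proof -
  have l: "s \<in> Loose A" "t \<in> Loose A" "s' \<in> Loose A" "t' \<in> Loose A" "fdom A t = fcod A s" "fdom A t' = fcod A s'"
    using c by (auto simp: composable1_def)
  have a: "\<alpha> \<in> Cell A" "fsrc A \<alpha> = comp1 A t s" "ftrg A \<alpha> = comp1 A t' s'"
    using \<alpha> by (auto simp: cell_hom_def)
  have p: "fdom A s = fdom A s'" "fcod A t = fcod A t'"
    using F.A.cell_parallel[OF a(1)] l a by (auto simp: F.A.comp1_props)
  note d = F.A.dom_obj F.A.cod_obj component_props F.map_loose_props G.map_loose_props F.map_cell_props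
    G.map_cell_props square_cell
  have "comp1 C (farr G t') (comp1 C (\<phi> (fcod A s')) (farr F s'))
      = comp1 C (comp1 C (farr G t') (\<phi> (fdom A t'))) (farr F s')"
    using l by (simp add: F.B.comp1_assoc' d)
  moreover have "comp1 C (\<phi> (fcod A t)) (comp1 C (farr F t') (farr F s'))
      = comp1 C (comp1 C (\<phi> (fcod A t')) (farr F t')) (farr F s')"
    using l p by (simp add: F.B.comp1_assoc' d)
  ultimately have "vcomp C ?x (vcomp C ?y ?z) = vcomp C (vcomp C ?x ?y) ?z"
    using l a p w
    by (intro F.B.vcomp_assoc'[symmetric])
      (simp_all add: F.B.hcomp_props F.B.id2_props F.B.comp1_props d F.A.comp1_props F.map_comp1')
  then show ?thesis
    using natural[OF a(1)] a l w by (simp add: comp[OF c(1)] comp[OF c(2)] F.A.comp1_props)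
qed

end

section \<open>Multifunctors and their substitution\<close>

lemma mfun_eqI:
  fixes M N :: "'u mfun"
  shows "\<lbrakk>msrc M = msrc N; mtrg M = mtrg N; mobj M = mobj N; marr M = marr N; mcell M = mcell N; mint M = mint N\<rbrakk>
    \<Longrightarrow> M = N"
  by simp

section \<open>Typing of multifunctors in terms of their slices\<close>

lemma slice_sel:
  "X \<in> Obj (msrc M ! i) \<Longrightarrow> fobj (slice M i Xs) X = mobj M (Xs[i := X])"
  "s \<in> Loose (msrc M ! i) \<Longrightarrow> farr (slice M i Xs) s = marr M i (Xs[i := fdom (msrc M ! i) s]) s"
  "\<alpha> \<in> Cell (msrc M ! i) \<Longrightarrow>
    fcell (slice M i Xs) \<alpha> = mcell M i (Xs[i := fdom (msrc M ! i) (fsrc (msrc M ! i) \<alpha>)]) \<alpha>"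
  by (simp_all add: slice_def Let_def)

lemma slice_update: "slice M i (Xs[i := X]) = slice M i Xs"
  by (simp add: slice_def)

lemma loose_at_update_other: "i \<noteq> j \<Longrightarrow> loose_at As (Xs[j := X]) i s = loose_at As Xs i s"
  by (simp add: loose_at_def)

lemma loose_at_update_same:
  "\<lbrakk>i < length As; i < length Xs\<rbrakk> \<Longrightarrow> loose_at As (Xs[i := X]) i s \<longleftrightarrow> s \<in> Loose (As ! i) \<and> fdom (As ! i) s = X"
  by (auto simp: loose_at_def)

lemma cell_at_update_same:
  "\<lbrakk>i < length As; i < length Xs\<rbrakk> \<Longrightarrow>
    cell_at As (Xs[i := X]) i \<alpha> \<longleftrightarrow> \<alpha> \<in> Cell (As ! i) \<and> fdom (As ! i) (fsrc (As ! i) \<alpha>) = X"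
  by (auto simp: cell_at_def)

context multifunctor
begin

lemma src_nth: "i < length (msrc M) \<Longrightarrow> f_category (msrc M ! i)"
  using src_cat by simp

lemma loose_at_cod: "loose_at (msrc M) Xs i s \<Longrightarrow> fcod (msrc M ! i) s \<in> Obj (msrc M ! i)"
  using f_category.cod_obj[OF src_nth] by (simp add: loose_at_def)

lemma cell_at_loose:
  "cell_at (msrc M) Xs i \<alpha> \<Longrightarrow> loose_at (msrc M) Xs i (fsrc (msrc M ! i) \<alpha>) \<and> loose_at (msrc M) Xs i (ftrg (msrc M ! i) \<alpha>)"
  using f_category.src_loose[OF src_nth] f_category.trg_loose[OF src_nth]
    f_category.cell_parallel[OF src_nth, THEN conjunct1, symmetric]
  by (simp add: loose_at_def cell_at_def)

text \<open>Makes the lemmas on functors applicable to \<open>marr\<close>: the entry of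
  \<open>Xs\<close> at place \<open>i\<close> already is the domain of \<open>s\<close>, so the
  update made by the slice is trivial.\<close>

lemma marr_slice: "loose_at (msrc M) Xs i s \<Longrightarrow> marr M i Xs s = farr (slice M i Xs) s"
  by (auto simp: slice_sel loose_at_def)

lemma mcell_slice: "cell_at (msrc M) Xs i \<alpha> \<Longrightarrow> mcell M i Xs \<alpha> = fcell (slice M i Xs) \<alpha>"
  by (auto simp: slice_sel cell_at_def)

lemma marr_props:
  assumes "Xs \<in> obj_tuples (msrc M)" "loose_at (msrc M) Xs i s"
  shows "marr M i Xs s \<in> Loose (mtrg M)" "fdom (mtrg M) (marr M i Xs s) = mobj M Xs"
    "fcod (mtrg M) (marr M i Xs s) = mobj M (Xs[i := fcod (msrc M ! i) s])"
    "s \<in> Tight (msrc M ! i) \<Longrightarrow> marr M i Xs s \<in> Tight (mtrg M)"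
proof -
  have i: "i < length (msrc M)" and s: "s \<in> Loose (msrc M ! i)" "fdom (msrc M ! i) s = Xs ! i"
    using assms(2) by (auto simp: loose_at_def)
  interpret S: f_functor "msrc M ! i" "mtrg M" "slice M i Xs" using assms(1) i by (rule slice_functor)
  have "Xs ! i \<in> Obj (msrc M ! i)" using obj_tuples_nth[OF assms(1) i] .
  then show "marr M i Xs s \<in> Loose (mtrg M)" "fdom (mtrg M) (marr M i Xs s) = mobj M Xs"
    "fcod (mtrg M) (marr M i Xs s) = mobj M (Xs[i := fcod (msrc M ! i) s])"
    "s \<in> Tight (msrc M ! i) \<Longrightarrow> marr M i Xs s \<in> Tight (mtrg M)"
    using s S.map_tight by (simp_all add: marr_slice[OF assms(2)] S.map_loose_props slice_sel(1) S.A.cod_obj)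
qed

lemma mcell_props:
  assumes "Xs \<in> obj_tuples (msrc M)" "cell_at (msrc M) Xs i \<alpha>"
  shows "mcell M i Xs \<alpha> \<in> Cell (mtrg M)" "fsrc (mtrg M) (mcell M i Xs \<alpha>) = marr M i Xs (fsrc (msrc M ! i) \<alpha>)"
    "ftrg (mtrg M) (mcell M i Xs \<alpha>) = marr M i Xs (ftrg (msrc M ! i) \<alpha>)"
proof -
  have i: "i < length (msrc M)" and a: "\<alpha> \<in> Cell (msrc M ! i)"
    using assms(2) by (auto simp: cell_at_def)
  interpret S: f_functor "msrc M ! i" "mtrg M" "slice M i Xs" using assms(1) i by (rule slice_functor)
  show "mcell M i Xs \<alpha> \<in> Cell (mtrg M)" "fsrc (mtrg M) (mcell M i Xs \<alpha>) = marr M i Xs (fsrc (msrc M ! i) \<alpha>)"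
    "ftrg (mtrg M) (mcell M i Xs \<alpha>) = marr M i Xs (ftrg (msrc M ! i) \<alpha>)"
    using a cell_at_loose[OF assms(2)]
    by (simp_all add: mcell_slice[OF assms(2)] S.map_cell_props marr_slice)
qed

lemma mint_props:
  assumes "Xs \<in> obj_tuples (msrc M)" "i < j" "loose_at (msrc M) Xs i s" "loose_at (msrc M) Xs j t"
  shows "mint M i j Xs s t \<in> Cell (mtrg M)"
    "fsrc (mtrg M) (mint M i j Xs s t) =
      (if w = Colax then comp1 (mtrg M) (marr M i (Xs[j := fcod (msrc M ! j) t]) s) (marr M j Xs t)
       else comp1 (mtrg M) (marr M j (Xs[i := fcod (msrc M ! i) s]) t) (marr M i Xs s))"
    "ftrg (mtrg M) (mint M i j Xs s t) =
      (if w = Colax then comp1 (mtrg M) (marr M j (Xs[i := fcod (msrc M ! i) s]) t) (marr M i Xs s)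
       else comp1 (mtrg M) (marr M i (Xs[j := fcod (msrc M ! j) t]) s) (marr M j Xs t))"
proof -
  have "int_dom (msrc M) i j Xs s t" using assms by (simp add: int_dom_def)
  note c = int_cell[OF this]
  have "comp1 (mtrg M) (marr M j (Xs[i := fcod (msrc M ! i) s]) t) (marr M i Xs s) \<in> Loose (mtrg M)"
    using assms
    by (intro f_category.comp1_props[OF trg_cat]) (simp_all add: marr_props loose_at_update_other obj_tuples_update
        loose_at_cod[OF assms(3)] loose_at_cod[OF assms(4)])
  note p = f_category.wcell_props[OF trg_cat c this]
  then show "mint M i j Xs s t \<in> Cell (mtrg M)"
    "fsrc (mtrg M) (mint M i j Xs s t) =
      (if w = Colax then comp1 (mtrg M) (marr M i (Xs[j := fcod (msrc M ! j) t]) s) (marr M j Xs t)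
       else comp1 (mtrg M) (marr M j (Xs[i := fcod (msrc M ! i) s]) t) (marr M i Xs s))"
    "ftrg (mtrg M) (mint M i j Xs s t) =
      (if w = Colax then comp1 (mtrg M) (marr M j (Xs[i := fcod (msrc M ! i) s]) t) (marr M i Xs s)
       else comp1 (mtrg M) (marr M i (Xs[j := fcod (msrc M ! j) t]) s) (marr M j Xs t))"
    by simp_all
qed

text \<open>For lax \<open>w\<close> this is the axiom itself, since nothing is transposed. For
  strict \<open>w\<close> the cells are identities. For pseudo \<open>w\<close> the axiom concerns
  the inverses of the interchange cells, and inverting once more restores the cells while reversing
  the direction.\<close>

lemma int_natural_left_colax:
  assumes "w \<noteq> Colax" "Xs \<in> obj_tuples (msrc M)" "i < j" "loose_at (msrc M) Xs j t"
  shows "loose_natural Colax (msrc M ! i) (mtrg M) (slice M i Xs) (slice M i (Xs[j := fcod (msrc M ! j) t]))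
    (\<lambda>X. marr M j (Xs[i := X]) t) (\<lambda>s. mint M i j (Xs[i := fdom (msrc M ! i) s]) s t)"
proof -
  note n = int_natural_left[OF assms(2-4)]
  show ?thesis
  proof (cases w)
    case Strict
    then show ?thesis using loose_natural.strict_colax[OF n] by (simp add: wtranspose_def)
  next
    case Pseudo
    \<comment> \<open>The transposed cell is by definition the inverse of the interchange cell, so
      the interchange cell is the inverse of the transposed one.\<close>
    have "inverse_cells (mtrg M) (wtranspose (mtrg M) w (mint M i j (Xs[i := fdom (msrc M ! i) s]) s t))
      (mint M i j (Xs[i := fdom (msrc M ! i) s]) s t)" if s: "s \<in> Loose (msrc M ! i)" for s
    proof -
      have i: "i < length (msrc M)" "i < length Xs"
        using assms(2-4) by (simp_all add: loose_at_def obj_tuples_length)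
      have "int_dom (msrc M) i j (Xs[i := fdom (msrc M ! i) s]) s t"
        using assms(2-4) s i f_category.dom_obj[OF src_nth[OF i(1)] s]
        by (simp add: int_dom_def loose_at_update_other loose_at_update_same obj_tuples_update)
      from int_cell[OF this] Pseudo obtain \<beta>
        where b: "inverse_cells (mtrg M) (mint M i j (Xs[i := fdom (msrc M ! i) s]) s t) \<beta>"
        unfolding Pseudo wcell.simps by blast
      show ?thesis using f_category.inv_cell_eq[OF trg_cat b] f_category.inverse_cells_sym[OF trg_cat b] Pseudo
        by (simp add: wtranspose_def)
    qed
    moreover have "wbar w = Pseudo" by (simp add: Pseudo)
    ultimately show ?thesis by (intro loose_natural.pseudo_inverse_colax[OF n])
  next
    case Lax
    then show ?thesis using n by (simp add: wtranspose_def)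
  next
    case Colax
    then show ?thesis using assms(1) by simp
  qed
qed

end

section \<open>Evaluation of a composite in block coordinates\<close>

lemma mfun_comp_simps [simp]:
  "msrc (mfun_comp N Ms) = concat (map msrc Ms)" "mtrg (mfun_comp N Ms) = mtrg N"
  by (simp_all add: mfun_comp_def Let_def)

text \<open>The object tuples of a composite, already cut into blocks; working with these removes
  \<open>blocks\<close> from the computations.\<close>

definition families :: "'u mfun list \<Rightarrow> 'u list list set" where
  "families Ms = {Xss. list_all2 (\<lambda>Xs M. Xs \<in> obj_tuples (msrc M)) Xss Ms}"

abbreviation (input) mplace :: "'u mfun list \<Rightarrow> nat \<Rightarrow> nat \<Rightarrow> nat" where
  "mplace Ms \<equiv> place (map (length \<circ> msrc) Ms)"

lemma families_length: "Xss \<in> families Ms \<Longrightarrow> length Xss = length Ms"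
  by (auto simp: families_def dest: list_all2_lengthD)

lemma families_nth: "\<lbrakk>Xss \<in> families Ms; a < length Ms\<rbrakk> \<Longrightarrow> Xss ! a \<in> obj_tuples (msrc (Ms ! a))"
  by (auto simp: families_def list_all2_conv_all_nth)

lemma families_nth_length: "\<lbrakk>Xss \<in> families Ms; a < length Ms\<rbrakk> \<Longrightarrow> length (Xss ! a) = length (msrc (Ms ! a))"
  by (rule obj_tuples_length) (rule families_nth)

lemma families_lengths: "Xss \<in> families Ms \<Longrightarrow> map (length \<circ> msrc) Ms = map length Xss"
  by (rule nth_equalityI) (simp_all add: families_length families_nth_length)

lemma families_update:
  "\<lbrakk>Xss \<in> families Ms; Ys \<in> obj_tuples (msrc (Ms ! a))\<rbrakk> \<Longrightarrow> Xss[a := Ys] \<in> families Ms"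
  by (cases "a < length Xss") (auto simp: families_def list_all2_conv_all_nth nth_list_update)

lemma families_concat: "Xss \<in> families Ms \<Longrightarrow> concat Xss \<in> obj_tuples (concat (map msrc Ms))"
  by (rule list_all2_obj_tuples_concat) (simp add: families_def list_all2_map2)

lemma families_cases:
  assumes "Xs \<in> obj_tuples (concat (map msrc Ms))"
  obtains Xss where "Xss \<in> families Ms" "Xs = concat Xss"
  using obj_tuples_concatE[OF assms] by (auto simp: families_def list_all2_map2)

lemma mplace_cases:
  assumes "p < length (concat (map msrc Ms))"
  obtains a i where "a < length Ms" "i < length (msrc (Ms ! a))" "p = mplace Ms a i"
  using assms place_exhaust[of p "map (length \<circ> msrc) Ms"]
  by (auto simp: length_concat comp_def)

lemma concat_msrc_mplace:
  "\<lbrakk>a < length Ms; i < length (msrc (Ms ! a))\<rbrakk> \<Longrightarrow> concat (map msrc Ms) ! mplace Ms a i = msrc (Ms ! a) ! i"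
  using nth_concat_place[of a "map msrc Ms" i] by (simp add: comp_def)

lemma mplace_less:
  "\<lbrakk>a < length Ms; i < length (msrc (Ms ! a))\<rbrakk> \<Longrightarrow> mplace Ms a i < length (concat (map msrc Ms))"
  using place_less[of a "map (length \<circ> msrc) Ms" i] by (simp add: length_concat comp_def)

lemma mplace_less_iff:
  "\<lbrakk>a < length Ms; i < length (msrc (Ms ! a)); b < length Ms; j < length (msrc (Ms ! b))\<rbrakk> \<Longrightarrow>
    mplace Ms a i < mplace Ms b j \<longleftrightarrow> a < b \<or> a = b \<and> i < j"
  by (rule place_less_iff) simp_all

lemma locate_mplace:
  "\<lbrakk>a < length Ms; i < length (msrc (Ms ! a))\<rbrakk> \<Longrightarrow> locate (map (length \<circ> msrc) Ms) (mplace Ms a i) = (a, i)"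
  by (rule locate_place) simp_all

lemma concat_update_mplace:
  "\<lbrakk>Xss \<in> families Ms; a < length Ms; i < length (msrc (Ms ! a))\<rbrakk> \<Longrightarrow>
    (concat Xss)[mplace Ms a i := x] = concat (Xss[a := (Xss ! a)[i := x]])"
  by (simp add: families_lengths update_concat_place families_length families_nth_length)

lemma concat_nth_mplace:
  "\<lbrakk>Xss \<in> families Ms; a < length Ms; i < length (msrc (Ms ! a))\<rbrakk> \<Longrightarrow> concat Xss ! mplace Ms a i = Xss ! a ! i"
  by (simp add: families_lengths nth_concat_place families_length families_nth_length)

lemma blocks_families: "Xss \<in> families Ms \<Longrightarrow> blocks (map (length \<circ> msrc) Ms) (concat Xss) = Xss"
  by (simp add: families_lengths blocks_concat)

lemma loose_at_mplace:
  "\<lbrakk>Xss \<in> families Ms; a < length Ms; i < length (msrc (Ms ! a))\<rbrakk> \<Longrightarrow>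
    loose_at (concat (map msrc Ms)) (concat Xss) (mplace Ms a i) s \<longleftrightarrow> loose_at (msrc (Ms ! a)) (Xss ! a) i s"
  by (simp add: loose_at_def concat_msrc_mplace concat_nth_mplace mplace_less)

lemma cell_at_mplace:
  "\<lbrakk>Xss \<in> families Ms; a < length Ms; i < length (msrc (Ms ! a))\<rbrakk> \<Longrightarrow>
    cell_at (concat (map msrc Ms)) (concat Xss) (mplace Ms a i) \<alpha> \<longleftrightarrow> cell_at (msrc (Ms ! a)) (Xss ! a) i \<alpha>"
  by (simp add: cell_at_def concat_msrc_mplace concat_nth_mplace mplace_less)

abbreviation (input) part_values :: "'u mfun list \<Rightarrow> 'u list list \<Rightarrow> 'u list" where
  "part_values Ms Xss \<equiv> map2 mobj Ms Xss"

lemma values_nth: "\<lbrakk>Xss \<in> families Ms; a < length Ms\<rbrakk> \<Longrightarrow> part_values Ms Xss ! a = mobj (Ms ! a) (Xss ! a)"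
  by (simp add: families_length)

lemma values_update:
  "\<lbrakk>Xss \<in> families Ms; a < length Ms\<rbrakk> \<Longrightarrow> part_values Ms (Xss[a := Ys]) = (part_values Ms Xss)[a := mobj (Ms ! a) Ys]"
  by (rule nth_equalityI) (auto simp: families_length nth_list_update)

lemma values_update_id:
  "\<lbrakk>Xss \<in> families Ms; a < length Ms\<rbrakk> \<Longrightarrow> (part_values Ms Xss)[a := mobj (Ms ! a) (Xss ! a)] = part_values Ms Xss"
  using list_update_id[of "part_values Ms Xss" a] by (simp add: families_length)

lemma mobj_comp: "Xss \<in> families Ms \<Longrightarrow> mobj (mfun_comp N Ms) (concat Xss) = mobj N (part_values Ms Xss)"
  by (simp add: mfun_comp_def Let_def families_concat blocks_families)

lemma marr_comp:
  assumes "Xss \<in> families Ms" "a < length Ms" "loose_at (msrc (Ms ! a)) (Xss ! a) i s"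
  shows "marr (mfun_comp N Ms) (mplace Ms a i) (concat Xss) s = marr N a (part_values Ms Xss) (marr (Ms ! a) i (Xss ! a) s)"
proof -
  have "i < length (msrc (Ms ! a))" using assms(3) by (simp add: loose_at_def)
  then show ?thesis using assms
    by (simp add: mfun_comp_def Let_def blocks_families arr_dom_def families_concat loose_at_mplace locate_mplace)
qed

lemma mcell_comp:
  assumes "Xss \<in> families Ms" "a < length Ms" "cell_at (msrc (Ms ! a)) (Xss ! a) i \<alpha>"
  shows "mcell (mfun_comp N Ms) (mplace Ms a i) (concat Xss) \<alpha> = mcell N a (part_values Ms Xss) (mcell (Ms ! a) i (Xss ! a) \<alpha>)"
proof -
  have "i < length (msrc (Ms ! a))" using assms(3) by (simp add: cell_at_def)
  then show ?thesis using assms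
    by (simp add: mfun_comp_def Let_def blocks_families cell_dom_def families_concat cell_at_mplace locate_mplace)
qed

lemma mint_comp_same:
  assumes "Xss \<in> families Ms" "a < length Ms" "i < j"
    "loose_at (msrc (Ms ! a)) (Xss ! a) i s" "loose_at (msrc (Ms ! a)) (Xss ! a) j t"
  shows "mint (mfun_comp N Ms) (mplace Ms a i) (mplace Ms a j) (concat Xss) s t =
    mcell N a (part_values Ms Xss) (mint (Ms ! a) i j (Xss ! a) s t)"
proof -
  have "i < length (msrc (Ms ! a))" "j < length (msrc (Ms ! a))" using assms by (auto simp: loose_at_def)
  then show ?thesis using assms
    by (simp add: mfun_comp_def Let_def blocks_families int_dom_def families_concat loose_at_mplace locate_mplace
        mplace_less_iff)
qed

lemma mint_comp_diff:
  assumes "Xss \<in> families Ms" "a < b" "b < length Ms"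
    "loose_at (msrc (Ms ! a)) (Xss ! a) i s" "loose_at (msrc (Ms ! b)) (Xss ! b) j t"
  shows "mint (mfun_comp N Ms) (mplace Ms a i) (mplace Ms b j) (concat Xss) s t =
    mint N a b (part_values Ms Xss) (marr (Ms ! a) i (Xss ! a) s) (marr (Ms ! b) j (Xss ! b) t)"
proof -
  have "i < length (msrc (Ms ! a))" "j < length (msrc (Ms ! b))" using assms by (auto simp: loose_at_def)
  then show ?thesis using assms
    by (simp add: mfun_comp_def Let_def blocks_families int_dom_def families_concat loose_at_mplace locate_mplace
        mplace_less_iff)
qed

text \<open>The typing conditions of one substitution, collected so that the axioms for the
  composite can be proved one by one.\<close>

locale mfun_composite = N: multifunctor w' w N
  for w' w :: weakness and N :: "'u mfun" +
  fixes Ms :: "'u mfun list"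
  assumes parts: "M \<in> set Ms \<Longrightarrow> multifunctor w' w M"
    and src: "msrc N = map mtrg Ms"
begin

lemma part: "a < length Ms \<Longrightarrow> multifunctor w' w (Ms ! a)"
  by (simp add: parts)

lemma src_N: "a < length Ms \<Longrightarrow> msrc N ! a = mtrg (Ms ! a)"
  by (simp add: src)

lemma length_src_N: "length (msrc N) = length Ms"
  by (simp add: src)

lemma values_tuple: "Xss \<in> families Ms \<Longrightarrow> part_values Ms Xss \<in> obj_tuples (msrc N)"
  unfolding obj_tuples_def mem_Collect_eq list_all2_conv_all_nth
  by (simp add: src families_length multifunctor.obj[OF part] families_nth)

lemma loose_at_values:
  "\<lbrakk>Xss \<in> families Ms; a < length Ms; loose_at (msrc (Ms ! a)) (Xss ! a) i s\<rbrakk> \<Longrightarrow>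
    loose_at (msrc N) (part_values Ms Xss) a (marr (Ms ! a) i (Xss ! a) s)"
  using multifunctor.marr_props[OF part families_nth]
  by (simp add: loose_at_def[of "msrc N"] length_src_N src_N families_length)

lemma cell_at_values:
  "\<lbrakk>Xss \<in> families Ms; a < length Ms; cell_at (msrc (Ms ! a)) (Xss ! a) i \<alpha>\<rbrakk> \<Longrightarrow>
    cell_at (msrc N) (part_values Ms Xss) a (mcell (Ms ! a) i (Xss ! a) \<alpha>)"
  using multifunctor.mcell_props[OF part families_nth] multifunctor.marr_props[OF part families_nth]
    multifunctor.cell_at_loose[OF part]
  by (simp add: cell_at_def[of "msrc N"] length_src_N src_N families_length)

lemma slice_comp:
  assumes X: "Xss \<in> families Ms" and a: "a < length Ms" and i: "i < length (msrc (Ms ! a))"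
  shows "slice (mfun_comp N Ms) (mplace Ms a i) (concat Xss) =
    ffun_comp (msrc (Ms ! a) ! i) (slice N a (part_values Ms Xss)) (slice (Ms ! a) i (Xss ! a))"
proof -
  interpret M: multifunctor w' w "Ms ! a" using a by (rule part)
  interpret A: f_category "msrc (Ms ! a) ! i" using i by (rule M.src_nth)
  have il: "i < length (Xss ! a)" using families_nth_length[OF X a] i by simp
  have al: "a < length Xss" using a X by (simp add: families_length)
  have u: "(Xss ! a)[i := X] \<in> obj_tuples (msrc (Ms ! a))" "Xss[a := (Xss ! a)[i := X]] \<in> families Ms"
    if "X \<in> Obj (msrc (Ms ! a) ! i)" for X
    using that X a by (simp_all add: obj_tuples_update families_nth families_update)
  show ?thesis
  proof (rule ffun_eqI; rule ext)
    fix Y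
    show "fobj (slice (mfun_comp N Ms) (mplace Ms a i) (concat Xss)) Y =
      fobj (ffun_comp (msrc (Ms ! a) ! i) (slice N a (part_values Ms Xss)) (slice (Ms ! a) i (Xss ! a))) Y"
    proof (cases "Y \<in> Obj (msrc (Ms ! a) ! i)")
      case True
      then show ?thesis using u[OF True] a i X M.obj
        by (simp add: ffun_comp_sel slice_sel concat_msrc_mplace concat_update_mplace mobj_comp src_N values_update)
    next
      case False
      then show ?thesis using a i by (simp add: slice_def ffun_comp_def Let_def concat_msrc_mplace compose_def)
    qed
  next
    fix s
    show "farr (slice (mfun_comp N Ms) (mplace Ms a i) (concat Xss)) s =
      farr (ffun_comp (msrc (Ms ! a) ! i) (slice N a (part_values Ms Xss)) (slice (Ms ! a) i (Xss ! a))) s"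
    proof (cases "s \<in> Loose (msrc (Ms ! a) ! i)")
      case True
      have l: "loose_at (msrc (Ms ! a)) ((Xss ! a)[i := fdom (msrc (Ms ! a) ! i) s]) i s"
        using True i il by (simp add: loose_at_update_same)
      show ?thesis using u[OF A.dom_obj[OF True]] a al i X M.obj True l M.marr_props[OF _ l]
        by (simp add: ffun_comp_sel slice_sel concat_msrc_mplace concat_update_mplace marr_comp src_N values_update)
    next
      case False
      then show ?thesis using a i by (simp add: slice_def ffun_comp_def Let_def concat_msrc_mplace compose_def)
    qed
  next
    fix \<alpha>
    show "fcell (slice (mfun_comp N Ms) (mplace Ms a i) (concat Xss)) \<alpha> =
      fcell (ffun_comp (msrc (Ms ! a) ! i) (slice N a (part_values Ms Xss)) (slice (Ms ! a) i (Xss ! a))) \<alpha>"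
    proof (cases "\<alpha> \<in> Cell (msrc (Ms ! a) ! i)")
      case True
      have l: "cell_at (msrc (Ms ! a)) ((Xss ! a)[i := fdom (msrc (Ms ! a) ! i) (fsrc (msrc (Ms ! a) ! i) \<alpha>)]) i \<alpha>"
        using True i il by (simp add: cell_at_update_same)
      show ?thesis using u[OF A.dom_obj[OF A.src_loose[OF True]]] a al i X M.obj True l M.mcell_props[OF _ l]
         M.marr_props(2)[OF _ conjunct1[OF M.cell_at_loose[OF l]]]
        by (simp add: ffun_comp_sel slice_sel concat_msrc_mplace concat_update_mplace mcell_comp src_N values_update)
    next
      case False
      then show ?thesis using a i by (simp add: slice_def ffun_comp_def Let_def concat_msrc_mplace compose_def)
    qed
  qed
qed

end

text \<open>Detaches the cube equation from the multifunctor, so that it can be transported along a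
  functor or compared with a naturality equation.\<close>

lemma (in multifunctor) cube_compatible_iff:
  "cube_compatible w M i j k Xs r s t \<longleftrightarrow>
    (let X' = fcod (msrc M ! i) r; Y' = fcod (msrc M ! j) s; Z' = fcod (msrc M ! k) t
     in cube_commutes (mtrg M) w (marr M k (Xs[i := X', j := Y']) t) (mint M i j Xs r s)
          (mint M i k (Xs[j := Y']) r t) (marr M j Xs s) (marr M i (Xs[j := Y', k := Z']) r) (mint M j k Xs s t)
          (mint M j k (Xs[i := X']) s t) (marr M i Xs r) (marr M j (Xs[i := X', k := Z']) s) (mint M i k Xs r t)
          (mint M i j (Xs[k := Z']) r s) (marr M k Xs t))"
  by (simp add: cube_compatible_def cube_commutes_def Let_def)

text \<open>Places the interchange cell over the value at \<open>Xs\<close>. When \<open>M\<close>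
  is substituted into another multifunctor, this is the condition for applying the outer
  \<open>mcell\<close> to it.\<close>

lemma (in multifunctor) cell_at_mint:
  assumes "Xs \<in> obj_tuples (msrc M)" "i < j" "loose_at (msrc M) Xs i s" "loose_at (msrc M) Xs j t"
  shows "fdom (mtrg M) (fsrc (mtrg M) (mint M i j Xs s t)) = mobj M Xs"
  using assms loose_at_cod[OF assms(3)] loose_at_cod[OF assms(4)]
  by (simp add: mint_props f_category.comp1_props[OF trg_cat] marr_props loose_at_update_other obj_tuples_update)

lemma (in multifunctor) mint_face:
  assumes "Xs \<in> obj_tuples (msrc M)" "i < j" "loose_at (msrc M) Xs i s" "loose_at (msrc M) Xs j t"
  shows "mint M i j Xs s t \<in> face (mtrg M) w
    (comp1 (mtrg M) (marr M j (Xs[i := fcod (msrc M ! i) s]) t) (marr M i Xs s))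
    (comp1 (mtrg M) (marr M i (Xs[j := fcod (msrc M ! j) t]) s) (marr M j Xs t))"
  using assms by (simp add: mint_props face_def cell_hom_def)

lemma (in multifunctor) cube_postcompose:
  assumes Xs: "Xs \<in> obj_tuples (msrc M)" and ijk: "i < j" "j < k" and r: "loose_at (msrc M) Xs i r"
    and s: "loose_at (msrc M) Xs j s" and t: "loose_at (msrc M) Xs k t" and H: "f_functor (mtrg M) D H"
  defines "X' \<equiv> fcod (msrc M ! i) r" and "Y' \<equiv> fcod (msrc M ! j) s" and "Z' \<equiv> fcod (msrc M ! k) t"
  shows "cube_commutes D w
    (farr H (marr M k (Xs[i := X', j := Y']) t)) (fcell H (mint M i j Xs r s))
    (fcell H (mint M i k (Xs[j := Y']) r t)) (farr H (marr M j Xs s))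
    (farr H (marr M i (Xs[j := Y', k := Z']) r)) (fcell H (mint M j k Xs s t))
    (fcell H (mint M j k (Xs[i := X']) s t)) (farr H (marr M i Xs r))
    (farr H (marr M j (Xs[i := X', k := Z']) s)) (fcell H (mint M i k Xs r t))
    (fcell H (mint M i j (Xs[k := Z']) r s)) (farr H (marr M k Xs t))"
proof -
  interpret H: f_functor "mtrg M" D H by fact
  \<comment> \<open>Updates at different places commute; they are sorted by increasing place to give
    tuples a normal form.\<close>
  have swap: "Zs[j := y, i := x] = Zs[i := x, j := y]" "Zs[k := y, i := x] = Zs[i := x, k := y]"
    "Zs[k := y, j := x] = Zs[j := x, k := y]" for Zs x y
    using ijk by (simp_all add: list_update_swap)
  have cods: "X' \<in> Obj (msrc M ! i)" "Y' \<in> Obj (msrc M ! j)" "Z' \<in> Obj (msrc M ! k)"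
    using loose_at_cod[OF r] loose_at_cod[OF s] loose_at_cod[OF t] by (simp_all add: X'_def Y'_def Z'_def)
  have at: "loose_at (msrc M) (Zs[j := y]) i r = loose_at (msrc M) Zs i r"
    "loose_at (msrc M) (Zs[k := y]) i r = loose_at (msrc M) Zs i r"
    "loose_at (msrc M) (Zs[i := y]) j s = loose_at (msrc M) Zs j s"
    "loose_at (msrc M) (Zs[k := y]) j s = loose_at (msrc M) Zs j s"
    "loose_at (msrc M) (Zs[i := y]) k t = loose_at (msrc M) Zs k t"
    "loose_at (msrc M) (Zs[j := y]) k t = loose_at (msrc M) Zs k t" for Zs y
    using ijk by (simp_all add: loose_at_def)
  note rules = Xs r s t at cods obj_tuples_update swap marr_props X'_def[symmetric] Y'_def[symmetric] Z'_def[symmetric]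
  have cube': "cube_commutes (mtrg M) w
    (marr M k (Xs[i := X', j := Y']) t) (mint M i j Xs r s)
    (mint M i k (Xs[j := Y']) r t) (marr M j Xs s)
    (marr M i (Xs[j := Y', k := Z']) r) (mint M j k Xs s t)
    (mint M j k (Xs[i := X']) s t) (marr M i Xs r)
    (marr M j (Xs[i := X', k := Z']) s) (mint M i k Xs r t)
    (mint M i j (Xs[k := Z']) r s) (marr M k Xs t)"
    using cube[OF Xs ijk r s t] by (simp add: cube_compatible_iff X'_def Y'_def Z'_def Let_def)
  have ik: "i < k" using ijk by simp
  show ?thesis
    \<comment> \<open>The six intermediate edges occur only in the typing hypotheses and not in
      \<open>cube_commutes\<close>, so they have to be supplied.\<close>
    by (rule H.map_cube_commutes[OF cube', where ?r1.0 = "marr M i (Xs[j := Y']) r" and ?r2.0 = "marr M i (Xs[k := Z']) r"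
        and ?s1.0 = "marr M j (Xs[i := X']) s" and ?s2.0 = "marr M j (Xs[k := Z']) s"
        and ?t1.0 = "marr M k (Xs[j := Y']) t" and ?t2.0 = "marr M k (Xs[i := X']) t"])
      (use mint_face[OF _ ijk(1), of Xs r s] mint_face[OF _ ijk(1), of "Xs[k := Z']" r s]
         mint_face[OF _ ik, of Xs r t] mint_face[OF _ ik, of "Xs[j := Y']" r t]
         mint_face[OF _ ijk(2), of Xs s t] mint_face[OF _ ijk(2), of "Xs[i := X']" s t]
       in \<open>simp_all add: rules\<close>)
qed

section \<open>Interchange cells of a composite and their naturality\<close>

context mfun_composite
begin

lemma part_functor:
  "\<lbrakk>Xss \<in> families Ms; a < length Ms\<rbrakk> \<Longrightarrow> f_functor (mtrg (Ms ! a)) (mtrg N) (slice N a (part_values Ms Xss))"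
  using N.slice_functor[OF values_tuple] by (simp add: length_src_N flip: src_N)

lemma marr_comp_slice:
  "\<lbrakk>Xss \<in> families Ms; a < length Ms; loose_at (msrc (Ms ! a)) (Xss ! a) i s\<rbrakk> \<Longrightarrow>
    marr (mfun_comp N Ms) (mplace Ms a i) (concat Xss) s = farr (slice N a (part_values Ms Xss)) (marr (Ms ! a) i (Xss ! a) s)"
  by (simp add: marr_comp N.marr_slice loose_at_values)

lemma mint_comp_slice:
  assumes "Xss \<in> families Ms" "a < length Ms" "i < j"
    "loose_at (msrc (Ms ! a)) (Xss ! a) i s" "loose_at (msrc (Ms ! a)) (Xss ! a) j t"
  shows "mint (mfun_comp N Ms) (mplace Ms a i) (mplace Ms a j) (concat Xss) s t =
    fcell (slice N a (part_values Ms Xss)) (mint (Ms ! a) i j (Xss ! a) s t)"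
proof -
  interpret M: multifunctor w' w "Ms ! a" using assms(2) by (rule part)
  have "cell_at (msrc N) (part_values Ms Xss) a (mint (Ms ! a) i j (Xss ! a) s t)"
    using assms M.cell_at_mint[OF families_nth[OF assms(1,2)] assms(3-5)]
      M.mint_props(1)[OF families_nth[OF assms(1,2)] assms(3-5)]
    by (simp add: cell_at_def length_src_N src_N families_length)
  then show ?thesis using assms by (simp add: mint_comp_same N.mcell_slice)
qed

lemma int_comp_same:
  assumes X: "Xss \<in> families Ms" and a: "a < length Ms" and ij: "i < j"
    and s: "loose_at (msrc (Ms ! a)) (Xss ! a) i s" and t: "loose_at (msrc (Ms ! a)) (Xss ! a) j t"
  defines "K \<equiv> mfun_comp N Ms" and "p \<equiv> mplace Ms a i" and "q \<equiv> mplace Ms a j" and "Xs \<equiv> concat Xss"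
  shows "wcell (mtrg K) w (marr K p Xs s) (marr K q Xs t)
      (marr K q (Xs[p := fcod (msrc K ! p) s]) t) (marr K p (Xs[q := fcod (msrc K ! q) t]) s) (mint K p q Xs s t)"
    and "s \<in> Tight (msrc K ! p) \<or> t \<in> Tight (msrc K ! q) \<Longrightarrow>
      wcell_restricts (mtrg K) w' w (marr K p Xs s) (marr K q Xs t)
      (marr K q (Xs[p := fcod (msrc K ! p) s]) t) (marr K p (Xs[q := fcod (msrc K ! q) t]) s) (mint K p q Xs s t)"
proof -
  interpret M: multifunctor w' w "Ms ! a" using a by (rule part)
  interpret F: f_functor "mtrg (Ms ! a)" "mtrg N" "slice N a (part_values Ms Xss)" using X a by (rule part_functor)
  have al: "a < length Xss" using a X by (simp add: families_length)
  have il: "i < length (msrc (Ms ! a))" "j < length (msrc (Ms ! a))" using s t by (auto simp: loose_at_def)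
  note facts = X a ij s t al il families_nth[OF X a] M.loose_at_cod[OF s] M.loose_at_cod[OF t]
  have id: "int_dom (msrc (Ms ! a)) i j (Xss ! a) s t" using facts by (simp add: int_dom_def)
  note rules = K_def p_def q_def Xs_def concat_msrc_mplace concat_update_mplace marr_comp_slice mint_comp_slice
    families_update obj_tuples_update loose_at_update_other values_update slice_update M.marr_props
  show "wcell (mtrg K) w (marr K p Xs s) (marr K q Xs t)
      (marr K q (Xs[p := fcod (msrc K ! p) s]) t) (marr K p (Xs[q := fcod (msrc K ! q) t]) s) (mint K p q Xs s t)"
    using F.map_wcell[OF M.int_cell[OF id]] facts by (simp add: rules)
  show "wcell_restricts (mtrg K) w' w (marr K p Xs s) (marr K q Xs t)
      (marr K q (Xs[p := fcod (msrc K ! p) s]) t) (marr K p (Xs[q := fcod (msrc K ! q) t]) s) (mint K p q Xs s t)"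
    if "s \<in> Tight (msrc K ! p) \<or> t \<in> Tight (msrc K ! q)"
    using F.map_wcell_restricts[OF M.int_tight[OF id]] that facts by (simp add: rules)
qed

text \<open>The interchange cell is one of \<open>N\<close> at values of two parts. For the clause
  on tight morphisms, the slices of the parts carry tight morphisms to tight ones, so the
  corresponding clause of \<open>N\<close> applies.\<close>

lemma int_comp_diff:
  assumes X: "Xss \<in> families Ms" and ab: "a < b" "b < length Ms"
    and s: "loose_at (msrc (Ms ! a)) (Xss ! a) i s" and t: "loose_at (msrc (Ms ! b)) (Xss ! b) j t"
  defines "K \<equiv> mfun_comp N Ms" and "p \<equiv> mplace Ms a i" and "q \<equiv> mplace Ms b j" and "Xs \<equiv> concat Xss"
  shows "wcell (mtrg K) w (marr K p Xs s) (marr K q Xs t)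
      (marr K q (Xs[p := fcod (msrc K ! p) s]) t) (marr K p (Xs[q := fcod (msrc K ! q) t]) s) (mint K p q Xs s t)"
    and "s \<in> Tight (msrc K ! p) \<or> t \<in> Tight (msrc K ! q) \<Longrightarrow>
      wcell_restricts (mtrg K) w' w (marr K p Xs s) (marr K q Xs t)
      (marr K q (Xs[p := fcod (msrc K ! p) s]) t) (marr K p (Xs[q := fcod (msrc K ! q) t]) s) (mint K p q Xs s t)"
proof -
  have a: "a < length Ms" using ab by simp
  interpret A: multifunctor w' w "Ms ! a" using a by (rule part)
  interpret B: multifunctor w' w "Ms ! b" using ab(2) by (rule part)
  have al: "a < length Xss" "b < length Xss" using ab X by (simp_all add: families_length)
  have il: "i < length (msrc (Ms ! a))" "j < length (msrc (Ms ! b))" using s t by (auto simp: loose_at_def)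
  note facts = X a ab s t al il families_nth[OF X a] families_nth[OF X ab(2)]
    A.loose_at_cod[OF s] B.loose_at_cod[OF t]
  have id: "int_dom (msrc N) a b (part_values Ms Xss) (marr (Ms ! a) i (Xss ! a) s) (marr (Ms ! b) j (Xss ! b) t)"
    using facts by (simp add: int_dom_def loose_at_values values_tuple)
  note rules = K_def p_def q_def Xs_def concat_msrc_mplace concat_update_mplace marr_comp mint_comp_diff src_N
    families_update obj_tuples_update loose_at_update_other values_update A.marr_props B.marr_props
  show "wcell (mtrg K) w (marr K p Xs s) (marr K q Xs t)
      (marr K q (Xs[p := fcod (msrc K ! p) s]) t) (marr K p (Xs[q := fcod (msrc K ! q) t]) s) (mint K p q Xs s t)"
    using N.int_cell[OF id] facts by (simp add: rules)
  show "wcell_restricts (mtrg K) w' w (marr K p Xs s) (marr K q Xs t)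
      (marr K q (Xs[p := fcod (msrc K ! p) s]) t) (marr K p (Xs[q := fcod (msrc K ! q) t]) s) (mint K p q Xs s t)"
    if "s \<in> Tight (msrc K ! p) \<or> t \<in> Tight (msrc K ! q)"
    using N.int_tight[OF id] that facts by (auto simp: rules)
qed

text \<open>Within one block, the transformation of the part is postcomposed with a slice of
  \<open>N\<close>.\<close>

lemma natural_right_comp_same:
  assumes X: "Xss \<in> families Ms" and a: "a < length Ms" and ij: "i < j" "j < length (msrc (Ms ! a))"
    and s: "loose_at (msrc (Ms ! a)) (Xss ! a) i s"
  defines "K \<equiv> mfun_comp N Ms" and "p \<equiv> mplace Ms a i" and "q \<equiv> mplace Ms a j" and "Xs \<equiv> concat Xss"
  shows "loose_natural w (msrc K ! q) (mtrg K) (slice K q Xs) (slice K q (Xs[p := fcod (msrc K ! p) s]))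
    (\<lambda>Y. marr K p (Xs[q := Y]) s) (\<lambda>t. mint K p q (Xs[q := fdom (msrc K ! q) t]) s t)"
proof -
  interpret M: multifunctor w' w "Ms ! a" using a by (rule part)
  interpret B: f_category "msrc (Ms ! a) ! j" using ij(2) by (rule M.src_nth)
  have al: "a < length Xss" using a X by (simp add: families_length)
  have il: "i < length (msrc (Ms ! a))" using ij by simp
  have jl: "j < length (Xss ! a)" using ij families_nth_length[OF X a] by simp
  note facts = X a ij s al il jl families_nth[OF X a] M.loose_at_cod[OF s]
  note rules = K_def p_def q_def Xs_def concat_msrc_mplace concat_update_mplace marr_comp_slice mint_comp_slice
    families_update obj_tuples_update loose_at_update_other loose_at_update_same values_update slice_update slice_comp
  have "loose_natural w (msrc K ! q) (mtrg K) (slice K q Xs) (slice K q (Xs[p := fcod (msrc K ! p) s]))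
    (\<lambda>Y. farr (slice N a (part_values Ms Xss)) (marr (Ms ! a) i ((Xss ! a)[j := Y]) s))
    (\<lambda>t. fcell (slice N a (part_values Ms Xss))
       (mint (Ms ! a) i j ((Xss ! a)[j := fdom (msrc (Ms ! a) ! j) t]) s t))"
    using loose_natural.postcompose[OF M.int_natural_right[OF families_nth[OF X a] ij s] part_functor[OF X a]] facts
    by (simp add: rules)
  then show ?thesis
    by (rule loose_natural_cong) (use facts B.dom_obj in \<open>simp_all add: rules\<close>)
qed

text \<open>Across two blocks, the transformation of \<open>N\<close> is precomposed with a slice of
  the later part, which contains the free variable.\<close>

lemma natural_right_comp_diff:
  assumes X: "Xss \<in> families Ms" and ab: "a < b" "b < length Ms" and j: "j < length (msrc (Ms ! b))"
    and s: "loose_at (msrc (Ms ! a)) (Xss ! a) i s"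
  defines "K \<equiv> mfun_comp N Ms" and "p \<equiv> mplace Ms a i" and "q \<equiv> mplace Ms b j" and "Xs \<equiv> concat Xss"
  shows "loose_natural w (msrc K ! q) (mtrg K) (slice K q Xs) (slice K q (Xs[p := fcod (msrc K ! p) s]))
    (\<lambda>Y. marr K p (Xs[q := Y]) s) (\<lambda>t. mint K p q (Xs[q := fdom (msrc K ! q) t]) s t)"
proof -
  have a: "a < length Ms" using ab by simp
  interpret A: multifunctor w' w "Ms ! a" using a by (rule part)
  interpret B: multifunctor w' w "Ms ! b" using ab(2) by (rule part)
  interpret Bj: f_category "msrc (Ms ! b) ! j" using j by (rule B.src_nth)
  have al: "a < length Xss" "b < length Xss" using ab X by (simp_all add: families_length)
  have il: "i < length (msrc (Ms ! a))" using s by (auto simp: loose_at_def)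
  have jl: "j < length (Xss ! b)" using j families_nth_length[OF X ab(2)] by simp
  note facts = X a ab s al il j jl families_nth[OF X a] families_nth[OF X ab(2)] A.loose_at_cod[OF s]
  note rules = K_def p_def q_def Xs_def concat_msrc_mplace concat_update_mplace marr_comp mint_comp_diff src_N
    families_update obj_tuples_update loose_at_update_other loose_at_update_same values_update slice_comp
    slice_sel A.marr_props B.marr_props
  have "loose_natural w (msrc K ! q) (mtrg K) (slice K q Xs) (slice K q (Xs[p := fcod (msrc K ! p) s]))
    (\<lambda>Y. marr N a ((part_values Ms Xss)[b := fobj (slice (Ms ! b) j (Xss ! b)) Y]) (marr (Ms ! a) i (Xss ! a) s))
    (\<lambda>t. mint N a b ((part_values Ms Xss)[b := fdom (mtrg (Ms ! b)) (farr (slice (Ms ! b) j (Xss ! b)) t)])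
       (marr (Ms ! a) i (Xss ! a) s) (farr (slice (Ms ! b) j (Xss ! b)) t))"
    using loose_natural.precompose[OF N.int_natural_right[OF values_tuple[OF X] ab(1) _ loose_at_values[OF X a s]],
        of "msrc (Ms ! b) ! j" "slice (Ms ! b) j (Xss ! b)"]
      B.slice_functor[OF families_nth[OF X ab(2)] j] facts
    by (simp add: rules length_src_N)
  then show ?thesis
    by (rule loose_natural_cong) (use facts Bj.dom_obj in \<open>simp_all add: rules\<close>)
qed

text \<open>Postcomposition as on the other side, except that the slice of \<open>N\<close> must
  also be moved past the transposition of cells.\<close>

lemma natural_left_comp_same:
  assumes X: "Xss \<in> families Ms" and a: "a < length Ms" and ij: "i < j"
    and t: "loose_at (msrc (Ms ! a)) (Xss ! a) j t"
  defines "K \<equiv> mfun_comp N Ms" and "p \<equiv> mplace Ms a i" and "q \<equiv> mplace Ms a j" and "Xs \<equiv> concat Xss"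
  shows "loose_natural (wbar w) (msrc K ! p) (mtrg K) (slice K p Xs) (slice K p (Xs[q := fcod (msrc K ! q) t]))
    (\<lambda>X. marr K q (Xs[p := X]) t) (\<lambda>s. wtranspose (mtrg K) w (mint K p q (Xs[p := fdom (msrc K ! p) s]) s t))"
proof -
  interpret M: multifunctor w' w "Ms ! a" using a by (rule part)
  interpret F: f_functor "mtrg (Ms ! a)" "mtrg N" "slice N a (part_values Ms Xss)" using X a by (rule part_functor)
  have al: "a < length Xss" using a X by (simp add: families_length)
  have jl: "j < length (msrc (Ms ! a))" using t by (auto simp: loose_at_def)
  have il: "i < length (msrc (Ms ! a))" using ij jl by simp
  interpret A: f_category "msrc (Ms ! a) ! i" using il by (rule M.src_nth)
  have il': "i < length (Xss ! a)" using il families_nth_length[OF X a] by simp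
  note facts = X a ij t al il jl il' families_nth[OF X a] M.loose_at_cod[OF t]
  note rules = K_def p_def q_def Xs_def concat_msrc_mplace concat_update_mplace marr_comp_slice mint_comp_slice
    families_update obj_tuples_update loose_at_update_other loose_at_update_same values_update slice_update slice_comp
  have "loose_natural (wbar w) (msrc K ! p) (mtrg K) (slice K p Xs) (slice K p (Xs[q := fcod (msrc K ! q) t]))
    (\<lambda>X. farr (slice N a (part_values Ms Xss)) (marr (Ms ! a) j ((Xss ! a)[i := X]) t))
    (\<lambda>s. fcell (slice N a (part_values Ms Xss))
       (wtranspose (mtrg (Ms ! a)) w (mint (Ms ! a) i j ((Xss ! a)[i := fdom (msrc (Ms ! a) ! i) s]) s t)))"
    using loose_natural.postcompose[OF M.int_natural_left[OF families_nth[OF X a] ij t] part_functor[OF X a]] facts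
    by (simp add: rules)
  \<comment> \<open>Functors preserve inverses of cells, hence transposition. Since
    \<open>inv_cell\<close> is meaningful for invertible cells only, the argument has to be known to
    be a \<open>w\<close>-cell.\<close>
  moreover have "wtranspose (mtrg K) w (mint K p q (Xs[p := fdom (msrc K ! p) s]) s t) =
      fcell (slice N a (part_values Ms Xss))
       (wtranspose (mtrg (Ms ! a)) w (mint (Ms ! a) i j ((Xss ! a)[i := fdom (msrc (Ms ! a) ! i) s]) s t))"
    if "s \<in> Loose (msrc K ! p)" for s
  proof -
    have s: "s \<in> Loose (msrc (Ms ! a) ! i)" using that facts by (simp add: rules)
    have "int_dom (msrc (Ms ! a)) i j ((Xss ! a)[i := fdom (msrc (Ms ! a) ! i) s]) s t"
      using facts s A.dom_obj[OF s] by (simp add: int_dom_def rules)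
    from F.map_wtranspose[OF M.int_cell[OF this]] show ?thesis
      using facts s A.dom_obj[OF s] by (simp add: rules)
  qed
  ultimately show ?thesis
    by (elim loose_natural_cong) (use facts in \<open>simp_all add: rules\<close>)
qed

text \<open>The free variable now lies in the earlier block, so it is a slice of the earlier part
  that is precomposed. The cells remain cells of \<open>N\<close>, and their transposition is taken
  in \<open>mtrg N\<close> from the start.\<close>

lemma natural_left_comp_diff:
  assumes X: "Xss \<in> families Ms" and ab: "a < b" "b < length Ms" and i: "i < length (msrc (Ms ! a))"
    and t: "loose_at (msrc (Ms ! b)) (Xss ! b) j t"
  defines "K \<equiv> mfun_comp N Ms" and "p \<equiv> mplace Ms a i" and "q \<equiv> mplace Ms b j" and "Xs \<equiv> concat Xss"
  shows "loose_natural (wbar w) (msrc K ! p) (mtrg K) (slice K p Xs) (slice K p (Xs[q := fcod (msrc K ! q) t]))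
    (\<lambda>X. marr K q (Xs[p := X]) t) (\<lambda>s. wtranspose (mtrg K) w (mint K p q (Xs[p := fdom (msrc K ! p) s]) s t))"
proof -
  have a: "a < length Ms" using ab by simp
  interpret A: multifunctor w' w "Ms ! a" using a by (rule part)
  interpret B: multifunctor w' w "Ms ! b" using ab(2) by (rule part)
  interpret Ai: f_category "msrc (Ms ! a) ! i" using i by (rule A.src_nth)
  have al: "a < length Xss" "b < length Xss" using ab X by (simp_all add: families_length)
  have jl: "j < length (msrc (Ms ! b))" using t by (auto simp: loose_at_def)
  have il: "i < length (Xss ! a)" using i families_nth_length[OF X a] by simp
  note facts = X a ab t al il i jl families_nth[OF X a] families_nth[OF X ab(2)] B.loose_at_cod[OF t]
  note rules = K_def p_def q_def Xs_def concat_msrc_mplace concat_update_mplace marr_comp mint_comp_diff src_N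
    families_update obj_tuples_update loose_at_update_other loose_at_update_same values_update slice_comp
    slice_sel A.marr_props B.marr_props
  have "loose_natural (wbar w) (msrc K ! p) (mtrg K) (slice K p Xs) (slice K p (Xs[q := fcod (msrc K ! q) t]))
    (\<lambda>X. marr N b ((part_values Ms Xss)[a := fobj (slice (Ms ! a) i (Xss ! a)) X]) (marr (Ms ! b) j (Xss ! b) t))
    (\<lambda>s. wtranspose (mtrg N) w
      (mint N a b ((part_values Ms Xss)[a := fdom (mtrg (Ms ! a)) (farr (slice (Ms ! a) i (Xss ! a)) s)])
       (farr (slice (Ms ! a) i (Xss ! a)) s) (marr (Ms ! b) j (Xss ! b) t)))"
    using loose_natural.precompose[OF N.int_natural_left[OF values_tuple[OF X] ab(1) loose_at_values[OF X ab(2) t]],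
        of "msrc (Ms ! a) ! i" "slice (Ms ! a) i (Xss ! a)"]
      A.slice_functor[OF families_nth[OF X a] i] facts
    by (simp add: rules length_src_N)
  then show ?thesis
    by (rule loose_natural_cong) (use facts Ai.dom_obj in \<open>simp_all add: rules\<close>)
qed

text \<open>The analogue of \<open>cube_compatible_iff\<close>, stated separately because the
  composite is not yet known to be a multifunctor at this point.\<close>

lemma cube_compatible_comp_iff:
  "cube_compatible w (mfun_comp N Ms) p q l Xs r s t \<longleftrightarrow>
    (let K = mfun_comp N Ms; X' = fcod (msrc K ! p) r; Y' = fcod (msrc K ! q) s; Z' = fcod (msrc K ! l) t
     in cube_commutes (mtrg N) w (marr K l (Xs[p := X', q := Y']) t) (mint K p q Xs r s)
          (mint K p l (Xs[q := Y']) r t) (marr K q Xs s) (marr K p (Xs[q := Y', l := Z']) r) (mint K q l Xs s t)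
          (mint K q l (Xs[p := X']) s t) (marr K p Xs r) (marr K q (Xs[p := X', l := Z']) s) (mint K p l Xs r t)
          (mint K p q (Xs[l := Z']) r s) (marr K l Xs t))"
  by (simp add: cube_compatible_def cube_commutes_def Let_def)

section \<open>Cubes of a composite, by the distribution of their directions over blocks\<close>

lemma cube_comp_same:
  assumes X: "Xss \<in> families Ms" and a: "a < length Ms" and ijk: "i < j" "j < k"
    and r: "loose_at (msrc (Ms ! a)) (Xss ! a) i r" and s: "loose_at (msrc (Ms ! a)) (Xss ! a) j s"
    and t: "loose_at (msrc (Ms ! a)) (Xss ! a) k t"
  shows "cube_compatible w (mfun_comp N Ms) (mplace Ms a i) (mplace Ms a j) (mplace Ms a k) (concat Xss) r s t"
proof -
  interpret M: multifunctor w' w "Ms ! a" using a by (rule part)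
  have al: "a < length Xss" using a X by (simp add: families_length)
  have il: "i < length (msrc (Ms ! a))" "j < length (msrc (Ms ! a))" "k < length (msrc (Ms ! a))"
    using r s t by (auto simp: loose_at_def)
  have at: "loose_at (msrc (Ms ! a)) (Zs[j := y]) i r = loose_at (msrc (Ms ! a)) Zs i r"
    "loose_at (msrc (Ms ! a)) (Zs[k := y]) i r = loose_at (msrc (Ms ! a)) Zs i r"
    "loose_at (msrc (Ms ! a)) (Zs[i := y]) j s = loose_at (msrc (Ms ! a)) Zs j s"
    "loose_at (msrc (Ms ! a)) (Zs[k := y]) j s = loose_at (msrc (Ms ! a)) Zs j s"
    "loose_at (msrc (Ms ! a)) (Zs[i := y]) k t = loose_at (msrc (Ms ! a)) Zs k t"
    "loose_at (msrc (Ms ! a)) (Zs[j := y]) k t = loose_at (msrc (Ms ! a)) Zs k t" for Zs y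
    using ijk by (simp_all add: loose_at_def)
  have "i < k" using ijk by simp
  note rules = X a ijk \<open>i < k\<close> r s t at al il families_nth[OF X a] M.loose_at_cod[OF r] M.loose_at_cod[OF s] M.loose_at_cod[OF t]
    concat_msrc_mplace concat_update_mplace marr_comp_slice mint_comp_slice
    families_update obj_tuples_update values_update slice_update
  show ?thesis
    using M.cube_postcompose[OF families_nth[OF X a] ijk r s t part_functor[OF X a]]
    by (simp add: cube_compatible_comp_iff Let_def rules)
qed

text \<open>The 2-cell made of \<open>r\<close> and \<open>s\<close> enters the earlier variable of
  an interchange of \<open>N\<close>, where naturality has the reversed weakness. The transformation
  used is therefore lax for \<open>w = Colax\<close> and colax otherwise, the latter with
  untransposed cells.\<close>

lemma cube_comp_left:
  assumes X: "Xss \<in> families Ms" and ab: "a < b" "b < length Ms" and ij: "i < j"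
    and r: "loose_at (msrc (Ms ! a)) (Xss ! a) i r" and s: "loose_at (msrc (Ms ! a)) (Xss ! a) j s"
    and t: "loose_at (msrc (Ms ! b)) (Xss ! b) k t"
  shows "cube_compatible w (mfun_comp N Ms) (mplace Ms a i) (mplace Ms a j) (mplace Ms b k) (concat Xss) r s t"
proof -
  have a: "a < length Ms" "a < length (msrc N)" using ab by (simp_all add: length_src_N)
  interpret A: multifunctor w' w "Ms ! a" using a(1) by (rule part)
  interpret B: multifunctor w' w "Ms ! b" using ab(2) by (rule part)
  have al: "a < length Xss" "b < length Xss" "a \<noteq> b" "b \<noteq> a" using ab X by (simp_all add: families_length)
  have il: "i < length (msrc (Ms ! a))" "j < length (msrc (Ms ! a))" "k < length (msrc (Ms ! b))"
    using r s t by (auto simp: loose_at_def)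
  have at: "loose_at (msrc (Ms ! a)) (Zs[j := y]) i r = loose_at (msrc (Ms ! a)) Zs i r"
    "loose_at (msrc (Ms ! a)) (Zs[i := y]) j s = loose_at (msrc (Ms ! a)) Zs j s" for Zs y
    using ij by (simp_all add: loose_at_def)
  have swap: "Zs[j := y, i := x] = Zs[i := x, j := y]" "Zs[b := y, a := x] = Zs[a := x, b := y]" for Zs :: "'u list" and x y
    using ij al by (simp_all add: list_update_swap)
  note tuple = families_nth[OF X a(1)] families_nth[OF X ab(2)]
  note cods = A.loose_at_cod[OF r] A.loose_at_cod[OF s] B.loose_at_cod[OF t]
  note facts = X a ab ij r s t at al il swap tuple cods A.mint_props(1)[OF tuple(1) ij r s]
    A.cell_at_mint[OF tuple(1) ij r s] concat_msrc_mplace concat_update_mplace marr_comp mint_comp_same mint_comp_diff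
    families_update obj_tuples_update values_update values_update_id src_N slice_sel A.marr_props B.marr_props
  define tt where "tt = marr (Ms ! b) k (Xss ! b) t"
  define r0 where "r0 = marr (Ms ! a) i (Xss ! a) r"
  define s0 where "s0 = marr (Ms ! a) j (Xss ! a) s"
  define r1 where "r1 = marr (Ms ! a) i ((Xss ! a)[j := fcod (msrc (Ms ! a) ! j) s]) r"
  define s1 where "s1 = marr (Ms ! a) j ((Xss ! a)[i := fcod (msrc (Ms ! a) ! i) r]) s"
  note defs = tt_def r0_def s0_def r1_def s1_def
  have c: "composable1 (mtrg (Ms ! a)) s1 r0" "composable1 (mtrg (Ms ! a)) r1 s0"
    by (simp_all add: composable1_def defs facts)
  have \<alpha>: "mint (Ms ! a) i j (Xss ! a) r s \<in> face (mtrg (Ms ! a)) w (comp1 (mtrg (Ms ! a)) s1 r0) (comp1 (mtrg (Ms ! a)) r1 s0)"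
    using A.mint_face[OF tuple(1) ij r s] by (simp add: defs)
  note V = values_tuple[OF X] ab(1) loose_at_values[OF X ab(2) t]
  show ?thesis
  proof (cases "w = Colax")
    case True
    have "loose_natural Lax (mtrg (Ms ! a)) (mtrg N) (slice N a (part_values Ms Xss))
      (slice N a ((part_values Ms Xss)[b := fcod (mtrg (Ms ! b)) tt]))
      (\<lambda>X. marr N b ((part_values Ms Xss)[a := X]) tt)
      (\<lambda>s. mint N a b ((part_values Ms Xss)[a := fdom (mtrg (Ms ! a)) s]) s tt)"
      using N.int_natural_left[OF V] True a ab by (simp add: src_N wtranspose_def tt_def)
    \<comment> \<open>A colax interchange cell runs from \<open>s0\<close> followed by
      \<open>r1\<close> to \<open>r0\<close> followed by \<open>s1\<close>, hence the exchanged
      order of \<open>c\<close>.\<close>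
    from loose_natural.natural_cube[OF this c(2,1), of "mint (Ms ! a) i j (Xss ! a) r s"] \<alpha> True show ?thesis
      unfolding cube_compatible_comp_iff cube_commutes_def Let_def by (simp add: face_def facts defs)
  next
    case False
    have "loose_natural Colax (mtrg (Ms ! a)) (mtrg N) (slice N a (part_values Ms Xss))
      (slice N a ((part_values Ms Xss)[b := fcod (mtrg (Ms ! b)) tt]))
      (\<lambda>X. marr N b ((part_values Ms Xss)[a := X]) tt)
      (\<lambda>s. mint N a b ((part_values Ms Xss)[a := fdom (mtrg (Ms ! a)) s]) s tt)"
      using N.int_natural_left_colax[OF False V] a ab by (simp add: src_N tt_def)
    from loose_natural.natural_cube_colax[OF this c(1,2), of "mint (Ms ! a) i j (Xss ! a) r s"] \<alpha> False show ?thesis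
      unfolding cube_compatible_comp_iff cube_commutes_def Let_def by (simp add: face_def facts defs)
  qed
qed

text \<open>Here the 2-cell made of \<open>s\<close> and \<open>t\<close> enters the later variable,
  where naturality holds for the interchange cells as they stand and with weakness \<open>w\<close>
  itself.\<close>

lemma cube_comp_right:
  assumes X: "Xss \<in> families Ms" and ab: "a < b" "b < length Ms" and jk: "j < k"
    and r: "loose_at (msrc (Ms ! a)) (Xss ! a) i r" and s: "loose_at (msrc (Ms ! b)) (Xss ! b) j s"
    and t: "loose_at (msrc (Ms ! b)) (Xss ! b) k t"
  shows "cube_compatible w (mfun_comp N Ms) (mplace Ms a i) (mplace Ms b j) (mplace Ms b k) (concat Xss) r s t"
proof -
  have a: "a < length Ms" "b < length (msrc N)" using ab by (simp_all add: length_src_N)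
  interpret A: multifunctor w' w "Ms ! a" using a(1) by (rule part)
  interpret B: multifunctor w' w "Ms ! b" using ab(2) by (rule part)
  have al: "a < length Xss" "b < length Xss" "a \<noteq> b" "b \<noteq> a" using ab X by (simp_all add: families_length)
  have il: "i < length (msrc (Ms ! a))" "j < length (msrc (Ms ! b))" "k < length (msrc (Ms ! b))"
    using r s t by (auto simp: loose_at_def)
  have at: "loose_at (msrc (Ms ! b)) (Zs[k := y]) j s = loose_at (msrc (Ms ! b)) Zs j s"
    "loose_at (msrc (Ms ! b)) (Zs[j := y]) k t = loose_at (msrc (Ms ! b)) Zs k t" for Zs y
    using jk by (simp_all add: loose_at_def)
  have swap: "Zs[k := y, j := x] = Zs[j := x, k := y]" "Zs[b := y, a := x] = Zs[a := x, b := y]" for Zs :: "'u list" and x y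
    using jk al by (simp_all add: list_update_swap)
  \<comment> \<open>Sorting puts the update at \<open>a\<close> in front, which hides the trivial
    update at \<open>b\<close>; this is the form in which it has to be recognised.\<close>
  have id: "(part_values Ms Xss)[a := x, b := mobj (Ms ! b) (Xss ! b)] = (part_values Ms Xss)[a := x]" for x
    using values_update_id[OF X ab(2)] al by (metis list_update_swap)
  note tuple = families_nth[OF X a(1)] families_nth[OF X ab(2)]
  note cods = A.loose_at_cod[OF r] B.loose_at_cod[OF s] B.loose_at_cod[OF t]
  note facts = X a ab jk r s t at al il swap id tuple cods B.mint_props(1)[OF tuple(2) jk s t]
    B.cell_at_mint[OF tuple(2) jk s t] concat_msrc_mplace concat_update_mplace marr_comp mint_comp_same mint_comp_diff
    families_update obj_tuples_update values_update values_update_id src_N slice_sel A.marr_props B.marr_props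
  define rr where "rr = marr (Ms ! a) i (Xss ! a) r"
  define s0 where "s0 = marr (Ms ! b) j (Xss ! b) s"
  define t0 where "t0 = marr (Ms ! b) k (Xss ! b) t"
  define s1 where "s1 = marr (Ms ! b) j ((Xss ! b)[k := fcod (msrc (Ms ! b) ! k) t]) s"
  define t1 where "t1 = marr (Ms ! b) k ((Xss ! b)[j := fcod (msrc (Ms ! b) ! j) s]) t"
  note defs = rr_def s0_def t0_def s1_def t1_def
  have c: "composable1 (mtrg (Ms ! b)) t1 s0" "composable1 (mtrg (Ms ! b)) s1 t0"
    by (simp_all add: composable1_def defs facts)
  have \<alpha>: "mint (Ms ! b) j k (Xss ! b) s t \<in> face (mtrg (Ms ! b)) w (comp1 (mtrg (Ms ! b)) t1 s0) (comp1 (mtrg (Ms ! b)) s1 t0)"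
    using B.mint_face[OF tuple(2) jk s t] by (simp add: defs)
  have "loose_natural w (mtrg (Ms ! b)) (mtrg N) (slice N b (part_values Ms Xss))
    (slice N b ((part_values Ms Xss)[a := fcod (mtrg (Ms ! a)) rr]))
    (\<lambda>Y. marr N a ((part_values Ms Xss)[b := Y]) rr)
    (\<lambda>t. mint N a b ((part_values Ms Xss)[b := fdom (mtrg (Ms ! b)) t]) rr t)"
    using N.int_natural_right[OF values_tuple[OF X] ab(1) a(2) loose_at_values[OF X a(1) r]] a ab
    by (simp add: src_N rr_def)
  note cubes = loose_natural.natural_cube[OF this c, of "mint (Ms ! b) j k (Xss ! b) s t"]
    loose_natural.natural_cube_colax[OF this c(2,1), of "mint (Ms ! b) j k (Xss ! b) s t"]
  show ?thesis
  proof (cases "w = Colax")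
    case True
    with cubes(2) \<alpha> show ?thesis
      unfolding cube_compatible_comp_iff cube_commutes_def Let_def by (simp add: face_def facts defs)
  next
    case False
    with cubes(1) \<alpha> show ?thesis
      unfolding cube_compatible_comp_iff cube_commutes_def Let_def by (simp add: face_def facts defs)
  qed
qed

text \<open>With three distinct blocks the cube is a cube of \<open>N\<close> at values of the
  parts.\<close>

lemma cube_comp_diff:
  assumes X: "Xss \<in> families Ms" and abc: "a < b" "b < c" "c < length Ms"
    and r: "loose_at (msrc (Ms ! a)) (Xss ! a) i r" and s: "loose_at (msrc (Ms ! b)) (Xss ! b) j s"
    and t: "loose_at (msrc (Ms ! c)) (Xss ! c) k t"
  shows "cube_compatible w (mfun_comp N Ms) (mplace Ms a i) (mplace Ms b j) (mplace Ms c k) (concat Xss) r s t"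
proof -
  have a: "a < length Ms" "b < length Ms" "a < c" using abc by simp_all
  interpret A: multifunctor w' w "Ms ! a" using a(1) by (rule part)
  interpret B: multifunctor w' w "Ms ! b" using a(2) by (rule part)
  interpret C: multifunctor w' w "Ms ! c" using abc(3) by (rule part)
  have al: "a < length Xss" "b < length Xss" "c < length Xss" "a \<noteq> b" "b \<noteq> a" "a \<noteq> c" "c \<noteq> a" "b \<noteq> c" "c \<noteq> b"
    using abc X by (simp_all add: families_length)
  have il: "i < length (msrc (Ms ! a))" "j < length (msrc (Ms ! b))" "k < length (msrc (Ms ! c))"
    using r s t by (auto simp: loose_at_def)
  note tuple = families_nth[OF X a(1)] families_nth[OF X a(2)] families_nth[OF X abc(3)]
  note cods = A.loose_at_cod[OF r] B.loose_at_cod[OF s] C.loose_at_cod[OF t]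
  note facts = X a abc r s t al il tuple cods concat_msrc_mplace concat_update_mplace marr_comp mint_comp_diff
    families_update obj_tuples_update values_update src_N A.marr_props B.marr_props C.marr_props
  show ?thesis
    using N.cube[OF values_tuple[OF X] abc(1,2) loose_at_values[OF X a(1) r] loose_at_values[OF X a(2) s]
        loose_at_values[OF X abc(3) t]]
    by (simp add: cube_compatible_comp_iff N.cube_compatible_iff Let_def facts)
qed

lemma loose_at_comp_cases:
  assumes "Xss \<in> families Ms" "loose_at (msrc (mfun_comp N Ms)) (concat Xss) p s"
  obtains a i where "a < length Ms" "i < length (msrc (Ms ! a))" "p = mplace Ms a i"
    "loose_at (msrc (Ms ! a)) (Xss ! a) i s"
proof -
  have "p < length (concat (map msrc Ms))" using assms(2) by (simp add: loose_at_def)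
  then obtain a i where "a < length Ms" "i < length (msrc (Ms ! a))" "p = mplace Ms a i"
    by (rule mplace_cases)
  then show thesis using that assms by (simp add: loose_at_mplace)
qed

text \<open>All arguments are brought into block coordinates and the preceding case lemmas are
  collected. The remaining extensionality axioms hold by the guards in the definition of
  \<open>mfun_comp\<close>.\<close>

theorem multifunctor_comp: "multifunctor w' w (mfun_comp N Ms)"
proof (rule multifunctor.intro, goal_cases)
  case (1 A)
  then show ?case using parts multifunctor.src_cat by fastforce
next
  case 2
  then show ?case using N.trg_cat by simp
next
  case (3 Xs)
  then obtain Xss where "Xss \<in> families Ms" "Xs = concat Xss" using families_cases by auto
  then show ?case by (simp add: mobj_comp N.obj values_tuple)
next
  case (4 Xs p)
  then obtain Xss where X: "Xss \<in> families Ms" and Xs: "Xs = concat Xss" using families_cases by auto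
  have "p < length (concat (map msrc Ms))" using 4(2) by simp
  then obtain a i where ai: "a < length Ms" "i < length (msrc (Ms ! a))" "p = mplace Ms a i" by (rule mplace_cases)
  show ?case
    using f_functor_comp[OF multifunctor.slice_functor[OF part[OF ai(1)] families_nth[OF X ai(1)] ai(2)]
        part_functor[OF X ai(1)]] X ai
    by (simp add: Xs slice_comp concat_msrc_mplace)
next
  case (5 p q Xs s t)
  then obtain Xss where X: "Xss \<in> families Ms" and Xs: "Xs = concat Xss"
    using families_cases by (auto simp: int_dom_def)
  obtain a i b j where "a < length Ms" "i < length (msrc (Ms ! a))" "p = mplace Ms a i"
    "loose_at (msrc (Ms ! a)) (Xss ! a) i s" "b < length Ms" "j < length (msrc (Ms ! b))" "q = mplace Ms b j"
    "loose_at (msrc (Ms ! b)) (Xss ! b) j t"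
    using 5 loose_at_comp_cases[OF X] unfolding int_dom_def Xs by metis
  then show ?case using 5 int_comp_same(1)[OF X] int_comp_diff(1)[OF X] by (auto simp: int_dom_def Xs mplace_less_iff)
next
  case (6 p q Xs s t)
  then obtain Xss where X: "Xss \<in> families Ms" and Xs: "Xs = concat Xss"
    using families_cases by (auto simp: int_dom_def)
  obtain a i b j where "a < length Ms" "i < length (msrc (Ms ! a))" "p = mplace Ms a i"
    "loose_at (msrc (Ms ! a)) (Xss ! a) i s" "b < length Ms" "j < length (msrc (Ms ! b))" "q = mplace Ms b j"
    "loose_at (msrc (Ms ! b)) (Xss ! b) j t"
    using 6 loose_at_comp_cases[OF X] unfolding int_dom_def Xs by metis
  then show ?case using 6 int_comp_same(2)[OF X] int_comp_diff(2)[OF X] by (auto simp: int_dom_def Xs mplace_less_iff)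
next
  case (7 Xs p q s)
  then obtain Xss where X: "Xss \<in> families Ms" and Xs: "Xs = concat Xss" using families_cases by auto
  obtain a i where ai: "a < length Ms" "i < length (msrc (Ms ! a))" "p = mplace Ms a i"
    "loose_at (msrc (Ms ! a)) (Xss ! a) i s"
    using 7 loose_at_comp_cases[OF X] unfolding Xs by metis
  have "q < length (concat (map msrc Ms))" using 7 by simp
  then obtain b j where bj: "b < length Ms" "j < length (msrc (Ms ! b))" "q = mplace Ms b j" by (rule mplace_cases)
  have "a < b \<or> a = b \<and> i < j" using 7(2) ai bj by (simp add: mplace_less_iff)
  then show ?case
    using natural_right_comp_same[OF X ai(1) _ _ ai(4)] natural_right_comp_diff[OF X _ bj(1,2) ai(4)] bj
    unfolding Xs ai(3) by auto
next
  case (8 Xs p q t)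
  then obtain Xss where X: "Xss \<in> families Ms" and Xs: "Xs = concat Xss" using families_cases by auto
  obtain b j where bj: "b < length Ms" "j < length (msrc (Ms ! b))" "q = mplace Ms b j"
    "loose_at (msrc (Ms ! b)) (Xss ! b) j t"
    using 8 loose_at_comp_cases[OF X] unfolding Xs by metis
  have "p < length (concat (map msrc Ms))" using 8 by (simp add: loose_at_def)
  then obtain a i where ai: "a < length Ms" "i < length (msrc (Ms ! a))" "p = mplace Ms a i" by (rule mplace_cases)
  have "a < b \<or> a = b \<and> i < j" using 8(2) ai bj by (simp add: mplace_less_iff)
  then show ?case
    using natural_left_comp_same[OF X bj(1) _ bj(4)] natural_left_comp_diff[OF X _ bj(1) ai(2) bj(4)] ai
    unfolding Xs bj(3) by auto
next
  case (9 Xs p q l r s t)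
  then obtain Xss where X: "Xss \<in> families Ms" and Xs: "Xs = concat Xss" using families_cases by auto
  obtain a i where ai: "a < length Ms" "i < length (msrc (Ms ! a))" "p = mplace Ms a i"
    "loose_at (msrc (Ms ! a)) (Xss ! a) i r"
    using 9 loose_at_comp_cases[OF X] unfolding Xs by metis
  obtain b j where bj: "b < length Ms" "j < length (msrc (Ms ! b))" "q = mplace Ms b j"
    "loose_at (msrc (Ms ! b)) (Xss ! b) j s"
    using 9 loose_at_comp_cases[OF X] unfolding Xs by metis
  obtain c k where ck: "c < length Ms" "k < length (msrc (Ms ! c))" "l = mplace Ms c k"
    "loose_at (msrc (Ms ! c)) (Xss ! c) k t"
    using 9 loose_at_comp_cases[OF X] unfolding Xs by metis
  \<comment> \<open>The lexicographic order leaves four cases: all directions in one block, the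
    first two together, the last two together, or three different blocks.\<close>
  have "a < b \<or> a = b \<and> i < j" "b < c \<or> b = c \<and> j < k" using 9(2,3) ai bj ck by (simp_all add: mplace_less_iff)
  then show ?case unfolding Xs ai(3) bj(3) ck(3)
    using cube_comp_same[OF X ai(1) _ _ ai(4)] cube_comp_left[OF X _ ck(1) _ ai(4) _ ck(4)]
      cube_comp_right[OF X _ ck(1) _ ai(4) _ ck(4)] cube_comp_diff[OF X _ _ ck(1) ai(4) bj(4) ck(4)] bj(4) ck(4)
    by auto
qed (simp_all add: mfun_comp_def Let_def)

end

section \<open>Units and associativity\<close>

text \<open>Off their domains the operations of both multifunctors are \<open>undefined\<close>, so
  equality only has to be checked on well-typed arguments.\<close>

lemma multifunctor_eqI:
  assumes "multifunctor w' w M" "multifunctor w' w N" "msrc M = msrc N" "mtrg M = mtrg N"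
    and obj: "\<And>Xs. Xs \<in> obj_tuples (msrc N) \<Longrightarrow> mobj M Xs = mobj N Xs"
    and arr: "\<And>i Xs s. \<lbrakk>Xs \<in> obj_tuples (msrc N); loose_at (msrc N) Xs i s\<rbrakk> \<Longrightarrow> marr M i Xs s = marr N i Xs s"
    and cell: "\<And>i Xs \<alpha>. \<lbrakk>Xs \<in> obj_tuples (msrc N); cell_at (msrc N) Xs i \<alpha>\<rbrakk> \<Longrightarrow> mcell M i Xs \<alpha> = mcell N i Xs \<alpha>"
    and int: "\<And>i j Xs s t. \<lbrakk>Xs \<in> obj_tuples (msrc N); i < j; loose_at (msrc N) Xs i s; loose_at (msrc N) Xs j t\<rbrakk> \<Longrightarrow>
      mint M i j Xs s t = mint N i j Xs s t"
  shows "M = N"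
proof -
  interpret M: multifunctor w' w M by fact
  interpret N: multifunctor w' w N by fact
  have "mobj M Xs = mobj N Xs" for Xs
    using obj M.obj_ext[of Xs] N.obj_ext[of Xs] assms(3) by metis
  moreover have "marr M i Xs s = marr N i Xs s" for i Xs s
    using arr M.arr_ext[of i Xs s] N.arr_ext[of i Xs s] assms(3) unfolding arr_dom_def by metis
  moreover have "mcell M i Xs \<alpha> = mcell N i Xs \<alpha>" for i Xs \<alpha>
    using cell M.cell_ext[of i Xs \<alpha>] N.cell_ext[of i Xs \<alpha>] assms(3) unfolding cell_dom_def by metis
  moreover have "mint M i j Xs s t = mint N i j Xs s t" for i j Xs s t
    using int M.int_ext[of i j Xs s t] N.int_ext[of i j Xs s t] assms(3) unfolding int_dom_def by metis
  ultimately show ?thesis using assms(3,4) by (intro mfun_eqI ext) simp_all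
qed

text \<open>Inverse to taking the slice at the only place. It covers both the identity multifunctors
  and the passage from sketch morphisms to unary multimodels.\<close>

definition mfun_unary :: "'u sfcat \<Rightarrow> 'u sfcat \<Rightarrow> 'u sffun \<Rightarrow> 'u mfun" where
  "mfun_unary A B F = \<lparr>msrc = [A], mtrg = B,
     mobj = (\<lambda>Xs. if Xs \<in> obj_tuples [A] then fobj F (hd Xs) else undefined),
     marr = (\<lambda>i Xs s. if arr_dom [A] i Xs s then farr F s else undefined),
     mcell = (\<lambda>i Xs \<alpha>. if cell_dom [A] i Xs \<alpha> then fcell F \<alpha> else undefined),
     mint = (\<lambda>i j Xs s t. undefined)\<rparr>"

lemma mfun_unary_simps [simp]: "msrc (mfun_unary A B F) = [A]" "mtrg (mfun_unary A B F) = B"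
  by (simp_all add: mfun_unary_def)

lemma obj_tuples_single: "Xs \<in> obj_tuples [A] \<longleftrightarrow> (\<exists>X\<in>Obj A. Xs = [X])"
  by (auto simp: obj_tuples_def list_all2_Cons2)

text \<open>The length of \<open>Xs\<close> matters: updating a list of length one at place
  \<open>0\<close> yields the one-element list of the new entry, whatever was there before.\<close>

lemma slice_unary:
  assumes "f_functor A B F" "length Xs = 1"
  shows "slice (mfun_unary A B F) 0 Xs = F"
proof -
  interpret f_functor A B F by fact
  obtain X where Xs: "Xs = [X]" using assms(2) by (cases Xs) auto
  show ?thesis
  proof (rule ffun_eqI; rule ext)
    show "fobj (slice (mfun_unary A B F) 0 Xs) Y = fobj F Y" for Y
      by (auto simp: slice_def mfun_unary_def obj_tuples_single Xs extensional_arb[OF obj_ext])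
    show "farr (slice (mfun_unary A B F) 0 Xs) s = farr F s" for s
      by (auto simp: slice_def mfun_unary_def obj_tuples_single Xs extensional_arb[OF arr_ext] arr_dom_def
          loose_at_def A.dom_obj)
    show "fcell (slice (mfun_unary A B F) 0 Xs) \<alpha> = fcell F \<alpha>" for \<alpha>
      by (auto simp: slice_def mfun_unary_def obj_tuples_single Xs extensional_arb[OF cell_ext] cell_dom_def
          cell_at_def A.dom_obj A.src_loose)
  qed
qed

text \<open>All conditions involving two or three places are vacuous when there is a single
  place.\<close>

lemma multifunctor_unary:
  assumes "f_functor A B F"
  shows "multifunctor w' w (mfun_unary A B F)"
proof -
  interpret f_functor A B F by fact
  show ?thesis
  proof (rule multifunctor.intro, goal_cases)
    case (3 Xs)
    then show ?case by (auto simp: mfun_unary_def obj_tuples_single map_obj)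
  next
    case (4 Xs i)
    then show ?case using slice_unary[OF assms] assms obj_tuples_length[of Xs] by simp
  qed (auto simp: A.f_category_axioms B.f_category_axioms int_dom_def loose_at_def, auto simp: mfun_unary_def)
qed

lemma mfun_id_unary: "mfun_id A = mfun_unary A A (ffun_id A)"
  by (rule mfun_eqI)
    (auto simp: mfun_id_def mfun_unary_def ffun_id_def fun_eq_iff obj_tuples_single arr_dom_def cell_dom_def
      loose_at_def cell_at_def)

lemma multifunctor_id: "f_category A \<Longrightarrow> multifunctor w' w (mfun_id A)"
  by (simp add: mfun_id_unary multifunctor_unary f_functor_id)

lemma mfun_id_simps [simp]: "msrc (mfun_id A) = [A]" "mtrg (mfun_id A) = A"
  by (simp_all add: mfun_id_def)

lemma mfun_id_sel:
  "X \<in> Obj A \<Longrightarrow> mobj (mfun_id A) [X] = X"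
  "\<lbrakk>X \<in> Obj A; loose_at [A] [X] i s\<rbrakk> \<Longrightarrow> marr (mfun_id A) i [X] s = s"
  "\<lbrakk>X \<in> Obj A; cell_at [A] [X] i \<alpha>\<rbrakk> \<Longrightarrow> mcell (mfun_id A) i [X] \<alpha> = \<alpha>"
  by (simp_all add: mfun_id_def obj_tuples_single arr_dom_def cell_dom_def)

lemma mfun_comp_id_left:
  assumes "multifunctor w' w M"
  shows "mfun_comp (mfun_id (mtrg M)) [M] = M"
proof -
  interpret M: multifunctor w' w M by fact
  interpret C: mfun_composite w' w "mfun_id (mtrg M)" "[M]"
    by (intro mfun_composite.intro mfun_composite_axioms.intro multifunctor_id M.trg_cat) (auto simp: assms)
  have fam: "Xs \<in> obj_tuples (msrc M) \<Longrightarrow> [Xs] \<in> families [M]" for Xs by (simp add: families_def)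
  note rules = mfun_id_sel M.obj place_Cons
  show ?thesis
  proof (rule multifunctor_eqI[OF C.multifunctor_comp assms])
    fix Xs assume Xs: "Xs \<in> obj_tuples (msrc M)"
    note f = fam[OF Xs]
    show "mobj (mfun_comp (mfun_id (mtrg M)) [M]) Xs = mobj M Xs"
      using mobj_comp[OF f] Xs by (simp add: rules)
    show "marr (mfun_comp (mfun_id (mtrg M)) [M]) i Xs s = marr M i Xs s" if "loose_at (msrc M) Xs i s" for i s
      using marr_comp[OF f, of 0 i s] C.loose_at_values[OF f, of 0 i s] that Xs by (simp add: rules)
    show "mcell (mfun_comp (mfun_id (mtrg M)) [M]) i Xs \<alpha> = mcell M i Xs \<alpha>" if "cell_at (msrc M) Xs i \<alpha>" for i \<alpha>
      using mcell_comp[OF f, of 0 i \<alpha>] C.cell_at_values[OF f, of 0 i \<alpha>] that Xs by (simp add: rules)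
    show "mint (mfun_comp (mfun_id (mtrg M)) [M]) i j Xs s t = mint M i j Xs s t"
      if "i < j" "loose_at (msrc M) Xs i s" "loose_at (msrc M) Xs j t" for i j s t
    proof -
      \<comment> \<open>The identity multifunctor acts as the identity only on cells in its domain,
        so the interchange cell must first be shown to lie there.\<close>
      have "cell_at [mtrg M] [mobj M Xs] 0 (mint M i j Xs s t)"
        using M.mint_props(1)[OF Xs that] M.cell_at_mint[OF Xs that] by (simp add: cell_at_def)
      then show ?thesis using mint_comp_same[OF f, of 0 i j s t] that Xs by (simp add: rules)
    qed
  qed simp_all
qed

text \<open>All blocks have length one. Distinct places thus lie in distinct blocks, and every
  interchange cell of the composite is one of \<open>M\<close>.\<close>

lemma mfun_comp_id_right:
  assumes "multifunctor w' w M"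
  shows "mfun_comp M (map mfun_id (msrc M)) = M"
proof -
  interpret M: multifunctor w' w M by fact
  let ?I = "map mfun_id (msrc M)"
  interpret C: mfun_composite w' w M ?I
    by (intro mfun_composite.intro mfun_composite_axioms.intro assms)
      (auto simp: multifunctor_id M.src_cat comp_def)
  have src: "concat (map (msrc \<circ> mfun_id) (msrc M)) = msrc M" by (simp add: comp_def)
  \<comment> \<open>For blocks of length one, the number of entries before block \<open>a\<close> is
    \<open>a\<close>, so places and block numbers coincide.\<close>
  have sum: "sum_list (take a (map (\<lambda>x. Suc 0) xs)) = a" if "a \<le> length xs" for a and xs :: "'a sfcat list"
    using that by (induction xs arbitrary: a) (auto simp: take_Cons split: nat.split)
  have place: "mplace ?I a 0 = a" if "a < length (msrc M)" for a
    using that sum[of a "msrc M"] by (simp add: place_def comp_def)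
  show ?thesis
  proof (rule multifunctor_eqI[OF C.multifunctor_comp assms])
    fix Xs assume Xs: "Xs \<in> obj_tuples (msrc M)"
    let ?Xss = "map (\<lambda>X. [X]) Xs"
    have len: "length Xs = length (msrc M)" by (rule obj_tuples_length[OF Xs])
    have f: "?Xss \<in> families ?I"
      using Xs by (auto simp: families_def obj_tuples_def list_all2_conv_all_nth)
    have con: "concat ?Xss = Xs" by simp
    have vals: "part_values ?I ?Xss = Xs"
      using obj_tuples_nth[OF Xs] by (intro nth_equalityI) (simp_all add: len mfun_id_sel)
    have nth: "?I ! a = mfun_id (msrc M ! a)" "?Xss ! a = [Xs ! a]" "Xs ! a \<in> Obj (msrc M ! a)"
      if "a < length (msrc M)" for a
      using that obj_tuples_nth[OF Xs] by (simp_all add: len)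
    show "mobj (mfun_comp M ?I) Xs = mobj M Xs" using mobj_comp[OF f, of M] unfolding con vals by simp
    have at: "a < length (msrc M)" "loose_at [msrc M ! a] [Xs ! a] 0 s" if "loose_at (msrc M) Xs a s" for a s
      using that by (simp_all add: loose_at_def)
    show "marr (mfun_comp M ?I) a Xs s = marr M a Xs s" if "loose_at (msrc M) Xs a s" for a s
      using marr_comp[OF f, of a 0 s M] at[OF that] unfolding con vals
      by (simp only: place nth mfun_id_sel length_map mfun_id_simps)
    show "mcell (mfun_comp M ?I) a Xs \<alpha> = mcell M a Xs \<alpha>" if "cell_at (msrc M) Xs a \<alpha>" for a \<alpha>
    proof -
      have "a < length (msrc M)" "cell_at [msrc M ! a] [Xs ! a] 0 \<alpha>" using that by (simp_all add: cell_at_def)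
      then show ?thesis using mcell_comp[OF f, of a 0 \<alpha> M] unfolding con vals
        by (simp only: place nth mfun_id_sel length_map mfun_id_simps)
    qed
    show "mint (mfun_comp M ?I) a b Xs s t = mint M a b Xs s t"
      if "a < b" "loose_at (msrc M) Xs a s" "loose_at (msrc M) Xs b t" for a b s t
      using mint_comp_diff[OF f, of a b 0 s 0 t M] at[OF that(2)] at[OF that(3)] that(1) unfolding con vals
      by (simp only: place nth mfun_id_sel length_map mfun_id_simps)
  qed (simp_all add: src)
qed

section \<open>Associativity of substitution\<close>

lemma concat_concat: "concat (concat xsss) = concat (map concat xsss)"
  by (induction xsss) auto

lemma map2_concat:
  "list_all2 (\<lambda>xs ys. length xs = length ys) xss yss \<Longrightarrow>
    map2 f (concat xss) (concat yss) = concat (map2 (map2 f) xss yss)"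
  by (induction rule: list_all2_induct) auto

locale mfun_composite_twice = mfun_composite w' w N Ms
  for w' w :: weakness and N :: "'u mfun" and Ms +
  fixes Kss :: "'u mfun list list"
  assumes length_Kss: "length Kss = length Ms"
    and inner: "a < length Ms \<Longrightarrow> mfun_composite w' w (Ms ! a) (Kss ! a)"
begin

abbreviation (input) Cs :: "'u mfun list" where "Cs \<equiv> map2 mfun_comp Ms Kss"

lemma Cs_nth: "a < length Ms \<Longrightarrow> Cs ! a = mfun_comp (Ms ! a) (Kss ! a)"
  by (simp add: length_Kss)

lemma inner_length: "a < length Ms \<Longrightarrow> length (msrc (Ms ! a)) = length (Kss ! a)"
  using mfun_composite.length_src_N[OF inner] .

lemma map_trg_concat: "map mtrg (concat Kss) = concat (map msrc Ms)"
proof -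
  have "map (map mtrg) Kss = map msrc Ms"
    by (rule nth_equalityI) (simp_all add: length_Kss mfun_composite.src[OF inner])
  then show ?thesis by (metis map_concat)
qed

lemma multifunctor_Kss: "K \<in> set (concat Kss) \<Longrightarrow> multifunctor w' w K"
  using mfun_composite.parts[OF inner] length_Kss by (fastforce simp: in_set_conv_nth)

text \<open>Together with the next sublocale: both bracketings are composites of multifunctors, so
  they can be compared on well-typed arguments alone.\<close>

sublocale outer_left: mfun_composite w' w "mfun_comp N Ms" "concat Kss"
  by (intro mfun_composite.intro mfun_composite_axioms.intro multifunctor_comp)
    (simp_all only: multifunctor_Kss map_trg_concat mfun_comp_simps)

sublocale outer_right: mfun_composite w' w N Cs
proof (intro mfun_composite.intro mfun_composite_axioms.intro N.multifunctor_axioms)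
  show "multifunctor w' w M" if M: "M \<in> set Cs" for M
  proof -
    obtain a where "a < length Cs" "M = Cs ! a" using M by (metis in_set_conv_nth)
    then show ?thesis using mfun_composite.multifunctor_comp[OF inner] by (simp add: length_Kss)
  qed
  show "msrc N = map mtrg Cs"
    by (rule nth_equalityI) (simp_all add: src length_Kss)
qed

lemma place_Ms: "map length Kss = map (length \<circ> msrc) Ms"
  by (rule nth_equalityI) (simp_all add: length_Kss inner_length)

lemma src_Cs: "map msrc Cs = map (\<lambda>Ks. concat (map msrc Ks)) Kss"
  by (rule nth_equalityI) (simp_all add: length_Kss)

lemma src_eq: "concat (map msrc (concat Kss)) = concat (map msrc Cs)"
  unfolding src_Cs by (simp add: map_concat concat_concat comp_def)

text \<open>Lets a single triple of indices (group, part, argument) describe a place under both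
  bracketings.\<close>

lemma mplace_mplace:
  assumes "a < length Ms" "i < length (Kss ! a)"
  shows "mplace (concat Kss) (mplace Ms a i) j = mplace Cs a (mplace (Kss ! a) i j)"
proof -
  have "map (length \<circ> msrc) Cs = map sum_list (map (map (length \<circ> msrc)) Kss)"
    by (rule nth_equalityI) (simp_all add: length_Kss length_concat comp_def)
  moreover have "map length (map (map (length \<circ> msrc)) Kss) = map (length \<circ> msrc) Ms"
    using place_Ms by (simp add: comp_def)
  ultimately show ?thesis
    using place_place[of a "map (map (length \<circ> msrc)) Kss" i j] assms length_Kss
    by (simp add: map_concat)
qed

lemma nth_concat_Kss:
  assumes "a < length Ms" "i < length (Kss ! a)"
  shows "concat Kss ! mplace Ms a i = Kss ! a ! i" "mplace Ms a i < length (concat Kss)"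
  using nth_concat_place[of a Kss i] place_less[of a "map length Kss" i] assms length_Kss place_Ms
    inner_length[OF assms(1)]
  by (simp_all add: length_concat)

text \<open>Object tuples cut twice. Applying \<open>concat\<close> yields a family for the left
  bracketing, applying \<open>map concat\<close> one for the right.\<close>

definition double_families :: "'u list list list set" where
  "double_families = {Xsss. list_all2 (\<lambda>Xss Ks. Xss \<in> families Ks) Xsss Kss}"

lemma double_families_cases:
  assumes "Xs \<in> obj_tuples (concat (map msrc Cs))"
  obtains Xsss where "Xsss \<in> double_families" "Xs = concat (concat Xsss)"
proof -
  have "Xs \<in> obj_tuples (concat (map msrc (concat Kss)))" using assms src_eq by simp
  then obtain Xss where X: "Xss \<in> families (concat Kss)" "Xs = concat Xss" by (rule families_cases)
  from X(1) obtain Xsss where "Xss = concat Xsss"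
      "list_all2 (list_all2 (\<lambda>Xs M. Xs \<in> obj_tuples (msrc M))) Xsss Kss"
    unfolding families_def mem_Collect_eq by (rule list_all2_concatE)
  then show thesis using that[of Xsss] X(2) by (simp add: double_families_def families_def)
qed

lemma double_families_props:
  assumes "Xsss \<in> double_families"
  shows "length Xsss = length Ms" "a < length Ms \<Longrightarrow> Xsss ! a \<in> families (Kss ! a)"
    "concat Xsss \<in> families (concat Kss)" "map concat Xsss \<in> families Cs"
proof -
  have l: "list_all2 (\<lambda>Xss Ks. Xss \<in> families Ks) Xsss Kss" using assms by (simp add: double_families_def)
  then show len: "length Xsss = length Ms" by (auto dest: list_all2_lengthD simp: length_Kss)
  show fam: "Xsss ! a \<in> families (Kss ! a)" if "a < length Ms" for a
    using l that by (simp add: list_all2_conv_all_nth length_Kss)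
  show "concat Xsss \<in> families (concat Kss)"
    using l by (induction rule: list_all2_induct) (auto simp: families_def list_all2_appendI)
  show "map concat Xsss \<in> families Cs"
    using families_concat[OF fam] by (simp add: families_def list_all2_conv_all_nth len length_Kss)
qed

abbreviation (input) inner_values :: "'u list list list \<Rightarrow> 'u list list" where
  "inner_values Xsss \<equiv> map2 (map2 mobj) Kss Xsss"

text \<open>The values in the middle layer are shared by the two bracketings: flattened they are the
  arguments of \<open>mfun_comp N Ms\<close>, and kept in groups they are the arguments of the
  single \<open>Ms\<close>.\<close>

lemma inner_values:
  assumes X: "Xsss \<in> double_families"
  shows "inner_values Xsss \<in> families Ms"
    and "part_values (concat Kss) (concat Xsss) = concat (inner_values Xsss)"
    and "part_values Cs (map concat Xsss) = part_values Ms (inner_values Xsss)"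
    and "a < length Ms \<Longrightarrow> inner_values Xsss ! a = part_values (Kss ! a) (Xsss ! a)"
proof -
  note p = double_families_props[OF X]
  show nth: "inner_values Xsss ! a = part_values (Kss ! a) (Xsss ! a)" if "a < length Ms" for a
    using that p by (simp add: length_Kss)
  show "inner_values Xsss \<in> families Ms"
    using mfun_composite.values_tuple[OF inner p(2)]
    by (simp add: families_def list_all2_conv_all_nth length_Kss p(1))
  show "part_values (concat Kss) (concat Xsss) = concat (inner_values Xsss)"
    using families_length[OF p(2)] by (intro map2_concat) (simp add: list_all2_conv_all_nth length_Kss p(1))
  show "part_values Cs (map concat Xsss) = part_values Ms (inner_values Xsss)"
    using mobj_comp[OF p(2)] by (intro nth_equalityI) (simp_all add: length_Kss p(1))
qed

lemma concat_nth_double: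
  assumes X: "Xsss \<in> double_families" and a: "a < length Ms" "i < length (Kss ! a)"
  shows "concat Xsss ! mplace Ms a i = Xsss ! a ! i"
proof -
  note p = double_families_props[OF X]
  have "map (length \<circ> msrc) Ms = map length Xsss"
    by (rule nth_equalityI) (simp_all add: p(1) inner_length families_length[OF p(2)])
  then show ?thesis using nth_concat_place[of a Xsss i] a p(1) families_length[OF p(2)[OF a(1)]] by simp
qed

lemma double_mplace_cases:
  assumes X: "Xsss \<in> double_families" and p: "p < length (concat (map msrc Cs))"
  obtains a i j where "a < length Ms" "i < length (Kss ! a)" "j < length (msrc (Kss ! a ! i))"
    "p = mplace Cs a (mplace (Kss ! a) i j)" "p = mplace (concat Kss) (mplace Ms a i) j"
proof -
  obtain a l where a: "a < length Cs" "l < length (msrc (Cs ! a))" "p = mplace Cs a l"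
    using p by (rule mplace_cases)
  then have a': "a < length Ms" "l < length (concat (map msrc (Kss ! a)))" by (simp_all add: length_Kss)
  obtain i j where i: "i < length (Kss ! a)" "j < length (msrc (Kss ! a ! i))" "l = mplace (Kss ! a) i j"
    using a'(2) by (rule mplace_cases)
  show thesis using that[OF a'(1) i(1,2)] a(3) i(3) mplace_mplace[OF a'(1) i(1)] by simp
qed

theorem mfun_comp_assoc: "mfun_comp (mfun_comp N Ms) (concat Kss) = mfun_comp N Cs"
proof (rule multifunctor_eqI[OF outer_left.multifunctor_comp outer_right.multifunctor_comp])
  show "msrc (mfun_comp (mfun_comp N Ms) (concat Kss)) = msrc (mfun_comp N Cs)"
    by (simp only: mfun_comp_simps src_eq)
  show "mtrg (mfun_comp (mfun_comp N Ms) (concat Kss)) = mtrg (mfun_comp N Cs)" by simp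
  fix Xs assume "Xs \<in> obj_tuples (msrc (mfun_comp N Cs))"
  then obtain Xsss where X: "Xsss \<in> double_families" and Xs: "Xs = concat (concat Xsss)"
    unfolding mfun_comp_simps by (rule double_families_cases)
  note p = double_families_props[OF X]
  note v = inner_values[OF X]
  have Xs': "Xs = concat (map concat Xsss)" unfolding Xs by (rule concat_concat)
  have lenC: "length Cs = length Ms" by (simp add: length_Kss)
  show "mobj (mfun_comp (mfun_comp N Ms) (concat Kss)) Xs = mobj (mfun_comp N Cs) Xs"
    using mobj_comp[OF p(3), of "mfun_comp N Ms"] mobj_comp[OF p(4), of N] mobj_comp[OF v(1), of N]
    unfolding v(2,3) Xs[symmetric] Xs'[symmetric] by simp
  have in_map: "map concat Xsss ! a = concat (Xsss ! a)" if "a < length Ms" for a using that p(1) by simp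
  \<comment> \<open>Elimination rule that locates a loose morphism once for both bracketings and
    also types it, together with its value in the middle layer.\<close>
  have loose_cases: thesis
    if "loose_at (msrc (mfun_comp N Cs)) Xs l s"
      and "\<And>a i j. \<lbrakk>a < length Ms; i < length (Kss ! a); l = mplace Cs a (mplace (Kss ! a) i j);
        l = mplace (concat Kss) (mplace Ms a i) j; loose_at (msrc (Kss ! a ! i)) (Xsss ! a ! i) j s;
        j < length (msrc (Kss ! a ! i));
        loose_at (msrc (Cs ! a)) (map concat Xsss ! a) (mplace (Kss ! a) i j) s;
        loose_at (msrc (concat Kss ! mplace Ms a i)) (concat Xsss ! mplace Ms a i) j s;
        loose_at (msrc (Ms ! a)) (inner_values Xsss ! a) i (marr (Kss ! a ! i) j (Xsss ! a ! i) s)\<rbrakk> \<Longrightarrow> thesis"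
    for l s thesis
  proof -
    have "l < length (concat (map msrc Cs))" using that(1) by (simp add: loose_at_def)
    then obtain a i j where 1: "a < length Ms" "i < length (Kss ! a)" "j < length (msrc (Kss ! a ! i))"
      "l = mplace Cs a (mplace (Kss ! a) i j)" "l = mplace (concat Kss) (mplace Ms a i) j"
      by (rule double_mplace_cases[OF X])
    have 2: "mplace (Kss ! a) i j < length (msrc (Cs ! a))" using mplace_less[OF 1(2,3)] Cs_nth[OF 1(1)] by simp
    have 3: "loose_at (msrc (Cs ! a)) (map concat Xsss ! a) (mplace (Kss ! a) i j) s"
      using that(1) loose_at_mplace[OF p(4) _ 2] 1 lenC unfolding Xs' mfun_comp_simps by simp
    have 4: "loose_at (msrc (Kss ! a ! i)) (Xsss ! a ! i) j s"
      using 3 loose_at_mplace[OF p(2)[OF 1(1)] 1(2,3)] in_map[OF 1(1)] Cs_nth[OF 1(1)] by simp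
    have 5: "loose_at (msrc (concat Kss ! mplace Ms a i)) (concat Xsss ! mplace Ms a i) j s"
      using 4 concat_nth_double[OF X 1(1,2)] nth_concat_Kss[OF 1(1,2)] by simp
    have 6: "loose_at (msrc (Ms ! a)) (inner_values Xsss ! a) i (marr (Kss ! a ! i) j (Xsss ! a ! i) s)"
      unfolding v(4)[OF 1(1)] by (rule mfun_composite.loose_at_values[OF inner[OF 1(1)] p(2)[OF 1(1)] 1(2) 4])
    show thesis by (rule that(2)[OF 1(1,2,4,5) 4 1(3) 3 5 6])
  qed
  show "marr (mfun_comp (mfun_comp N Ms) (concat Kss)) l Xs s = marr (mfun_comp N Cs) l Xs s"
    if "loose_at (msrc (mfun_comp N Cs)) Xs l s" for l s
    using that
  proof (rule loose_cases, goal_cases)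
    case (1 a i j)
    note n = nth_concat_Kss[OF 1(1,2)] concat_nth_double[OF X 1(1,2)]
    have "marr (mfun_comp (mfun_comp N Ms) (concat Kss)) l Xs s
        = marr N a (part_values Ms (inner_values Xsss))
            (marr (Ms ! a) i (inner_values Xsss ! a) (marr (Kss ! a ! i) j (Xsss ! a ! i) s))"
      unfolding 1(4) Xs using marr_comp[OF p(3) n(2) 1(8)] marr_comp[OF v(1) 1(1,9)] v(2) n by simp
    moreover have "marr (mfun_comp N Cs) l Xs s
        = marr N a (part_values Ms (inner_values Xsss))
            (marr (Ms ! a) i (inner_values Xsss ! a) (marr (Kss ! a ! i) j (Xsss ! a ! i) s))"
      unfolding 1(3) Xs' using marr_comp[OF p(4) _ 1(7)] 1(1) lenC marr_comp[OF p(2)[OF 1(1)] 1(2,5)]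
        in_map[OF 1(1)] Cs_nth[OF 1(1)] v(3) v(4)[OF 1(1)] by simp
    ultimately show ?case by simp
  qed
  show "mcell (mfun_comp (mfun_comp N Ms) (concat Kss)) l Xs \<alpha> = mcell (mfun_comp N Cs) l Xs \<alpha>"
    if at: "cell_at (msrc (mfun_comp N Cs)) Xs l \<alpha>" for l \<alpha>
  proof -
    have "l < length (concat (map msrc Cs))" using at by (simp add: cell_at_def)
    then obtain a i j where 1: "a < length Ms" "i < length (Kss ! a)" "j < length (msrc (Kss ! a ! i))"
      "l = mplace Cs a (mplace (Kss ! a) i j)" "l = mplace (concat Kss) (mplace Ms a i) j"
      by (rule double_mplace_cases[OF X])
    note n = nth_concat_Kss[OF 1(1,2)] concat_nth_double[OF X 1(1,2)]
    have 2: "mplace (Kss ! a) i j < length (msrc (Cs ! a))" using mplace_less[OF 1(2,3)] Cs_nth[OF 1(1)] by simp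
    have 3: "cell_at (msrc (Cs ! a)) (map concat Xsss ! a) (mplace (Kss ! a) i j) \<alpha>"
      using at cell_at_mplace[OF p(4) _ 2] 1 lenC unfolding Xs' mfun_comp_simps by simp
    have 4: "cell_at (msrc (Kss ! a ! i)) (Xsss ! a ! i) j \<alpha>"
      using 3 cell_at_mplace[OF p(2)[OF 1(1)] 1(2,3)] in_map[OF 1(1)] Cs_nth[OF 1(1)] by simp
    have 5: "cell_at (msrc (concat Kss ! mplace Ms a i)) (concat Xsss ! mplace Ms a i) j \<alpha>"
      using 4 n by simp
    have 6: "cell_at (msrc (Ms ! a)) (inner_values Xsss ! a) i (mcell (Kss ! a ! i) j (Xsss ! a ! i) \<alpha>)"
      unfolding v(4)[OF 1(1)] by (rule mfun_composite.cell_at_values[OF inner[OF 1(1)] p(2)[OF 1(1)] 1(2) 4])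
    have "mcell (mfun_comp (mfun_comp N Ms) (concat Kss)) l Xs \<alpha>
        = mcell N a (part_values Ms (inner_values Xsss))
            (mcell (Ms ! a) i (inner_values Xsss ! a) (mcell (Kss ! a ! i) j (Xsss ! a ! i) \<alpha>))"
      unfolding 1(5) Xs using mcell_comp[OF p(3) n(2) 5] mcell_comp[OF v(1) 1(1) 6] v(2) n by simp
    moreover have "mcell (mfun_comp N Cs) l Xs \<alpha>
        = mcell N a (part_values Ms (inner_values Xsss))
            (mcell (Ms ! a) i (inner_values Xsss ! a) (mcell (Kss ! a ! i) j (Xsss ! a ! i) \<alpha>))"
      unfolding 1(4) Xs' using mcell_comp[OF p(4) _ 3] 1(1) lenC mcell_comp[OF p(2)[OF 1(1)] 1(2) 4]
        in_map[OF 1(1)] Cs_nth[OF 1(1)] v(3) v(4)[OF 1(1)] by simp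
    ultimately show ?thesis by simp
  qed
  show "mint (mfun_comp (mfun_comp N Ms) (concat Kss)) l m Xs s t = mint (mfun_comp N Cs) l m Xs s t"
    if lm: "l < m" and "loose_at (msrc (mfun_comp N Cs)) Xs l s" and t: "loose_at (msrc (mfun_comp N Cs)) Xs m t"
    for l m s t
    using that(2)
  proof (rule loose_cases, goal_cases)
    case (1 a i j)
    note n = nth_concat_Kss[OF 1(1,2)] concat_nth_double[OF X 1(1,2)]
    show ?case using t
    proof (rule loose_cases, goal_cases)
      case (1 b i' j')
      note one = \<open>a < length Ms\<close> \<open>i < length (Kss ! a)\<close> \<open>l = mplace Cs a (mplace (Kss ! a) i j)\<close>
        \<open>l = mplace (concat Kss) (mplace Ms a i) j\<close> \<open>loose_at (msrc (Kss ! a ! i)) (Xsss ! a ! i) j s\<close>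
        \<open>j < length (msrc (Kss ! a ! i))\<close>
        \<open>loose_at (msrc (Cs ! a)) (map concat Xsss ! a) (mplace (Kss ! a) i j) s\<close>
        \<open>loose_at (msrc (concat Kss ! mplace Ms a i)) (concat Xsss ! mplace Ms a i) j s\<close>
        \<open>loose_at (msrc (Ms ! a)) (inner_values Xsss ! a) i (marr (Kss ! a ! i) j (Xsss ! a ! i) s)\<close>
      note two = 1
      note n' = nth_concat_Kss[OF two(1,2)] concat_nth_double[OF X two(1,2)]
      have il: "i < length (msrc (Ms ! a))" "i' < length (msrc (Ms ! b))"
        using one two by (simp_all add: inner_length)
      have jl: "mplace (Kss ! a) i j < length (msrc (Cs ! a))" "mplace (Kss ! b) i' j' < length (msrc (Cs ! b))"
        using mplace_less[OF one(2,6)] mplace_less[OF two(2,6)] Cs_nth[OF one(1)] Cs_nth[OF two(1)] by simp_all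
      have less: "a < b \<or> a = b \<and> mplace (Kss ! a) i j < mplace (Kss ! b) i' j'"
        using lm mplace_less_iff[of a Cs _ b, OF _ jl(1) _ jl(2)] one two lenC by simp
      \<comment> \<open>Two places separate at the level of the groups, of the parts in a group, or
        of the arguments of one part. Accordingly the interchange is performed by \<open>N\<close>,
        by a member of \<open>Ms\<close>, or by a member of \<open>Kss ! a\<close>, and the layers
        outside act functorially on it.\<close>
      then consider "a < b" | "a = b" "i < i'" | "a = b" "i = i'" "j < j'"
        using mplace_less_iff[OF one(2,6), of i' j'] two by auto
      then show ?case
      proof cases
        case 1
        have less': "mplace Ms a i < mplace Ms b i'" using 1 one(1) two(1) il by (simp add: mplace_less_iff)
        have "mint (mfun_comp (mfun_comp N Ms) (concat Kss)) l m Xs s t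
          = mint N a b (part_values Ms (inner_values Xsss))
            (marr (Ms ! a) i (inner_values Xsss ! a) (marr (Kss ! a ! i) j (Xsss ! a ! i) s))
            (marr (Ms ! b) i' (inner_values Xsss ! b) (marr (Kss ! b ! i') j' (Xsss ! b ! i') t))"
          unfolding one(4) two(4) Xs
          using mint_comp_diff[OF p(3) less' n'(2) one(8) two(8)] mint_comp_diff[OF v(1) 1 two(1) one(9) two(9)]
            v(2) n n' by simp
        moreover have "mint (mfun_comp N Cs) l m Xs s t
          = mint N a b (part_values Ms (inner_values Xsss))
            (marr (Ms ! a) i (inner_values Xsss ! a) (marr (Kss ! a ! i) j (Xsss ! a ! i) s))
            (marr (Ms ! b) i' (inner_values Xsss ! b) (marr (Kss ! b ! i') j' (Xsss ! b ! i') t))"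
          unfolding one(3) two(3) Xs'
          using mint_comp_diff[OF p(4) 1 _ one(7) two(7)] two(1) lenC
            marr_comp[OF p(2)[OF one(1)] one(2,5)] marr_comp[OF p(2)[OF two(1)] two(2,5)]
            in_map[OF one(1)] Cs_nth[OF one(1)] in_map[OF two(1)] Cs_nth[OF two(1)] v(3)
            v(4)[OF one(1)] v(4)[OF two(1)] by simp
        ultimately show ?thesis by simp
      next
        case 2
        have less': "mplace Ms a i < mplace Ms b i'" using 2 one(1) two(1) il by (simp add: mplace_less_iff)
        have "mint (mfun_comp (mfun_comp N Ms) (concat Kss)) l m Xs s t
          = mcell N a (part_values Ms (inner_values Xsss)) (mint (Ms ! a) i i' (inner_values Xsss ! a)
            (marr (Kss ! a ! i) j (Xsss ! a ! i) s) (marr (Kss ! b ! i') j' (Xsss ! b ! i') t))"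
          unfolding one(4) two(4) Xs
          using mint_comp_diff[OF p(3) less' n'(2) one(8) two(8)]
            mint_comp_same[OF v(1) one(1) 2(2) one(9) two(9)[folded 2(1)]] v(2) n n' 2(1) by simp
        moreover have "mint (mfun_comp N Cs) l m Xs s t
          = mcell N a (part_values Ms (inner_values Xsss)) (mint (Ms ! a) i i' (inner_values Xsss ! a)
            (marr (Kss ! a ! i) j (Xsss ! a ! i) s) (marr (Kss ! b ! i') j' (Xsss ! b ! i') t))"
          unfolding one(3) two(3) Xs'
          using mint_comp_same[OF p(4) _ _ one(7) two(7)[folded 2(1)]] one(1) lenC less 2(1)
            mint_comp_diff[OF p(2)[OF one(1)] 2(2) two(2)[folded 2(1)] one(5) two(5)[folded 2(1)]]
            in_map[OF one(1)] Cs_nth[OF one(1)] v(3) v(4)[OF one(1)] by simp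
        ultimately show ?thesis by simp
      next
        case 3
        interpret K: multifunctor w' w "Kss ! a ! i" using mfun_composite.part[OF inner[OF one(1)] one(2)] .
        interpret I: mfun_composite w' w "Ms ! a" "Kss ! a" using inner[OF one(1)] .
        note tup = families_nth[OF p(2)[OF one(1)] one(2)]
        \<comment> \<open>Needed to evaluate the middle layer on the innermost interchange cell,
          since \<open>mcell\<close> is \<open>undefined\<close> off its domain.\<close>
        have "cell_at (msrc (Ms ! a)) (inner_values Xsss ! a) i (mint (Kss ! a ! i) j j' (Xsss ! a ! i) s t)"
          using K.mint_props(1)[OF tup 3(3) one(5) two(5)[folded 3(1,2)]]
            K.cell_at_mint[OF tup 3(3) one(5) two(5)[folded 3(1,2)]] one(2) il(1)
            values_nth[OF p(2)[OF one(1)] one(2)]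
          unfolding v(4)[OF one(1)] by (simp add: cell_at_def I.src_N)
        then have "mint (mfun_comp (mfun_comp N Ms) (concat Kss)) l m Xs s t
          = mcell N a (part_values Ms (inner_values Xsss)) (mcell (Ms ! a) i (inner_values Xsss ! a)
            (mint (Kss ! a ! i) j j' (Xsss ! a ! i) s t))"
          unfolding one(4) two(4)[folded 3(1,2)] Xs
          using mint_comp_same[OF p(3) n(2) 3(3) one(8) two(8)[folded 3(1,2)]]
            mcell_comp[OF v(1) one(1)] v(2) n by simp
        moreover have "mint (mfun_comp N Cs) l m Xs s t
          = mcell N a (part_values Ms (inner_values Xsss)) (mcell (Ms ! a) i (inner_values Xsss ! a)
            (mint (Kss ! a ! i) j j' (Xsss ! a ! i) s t))"
          unfolding one(3) two(3)[folded 3(1,2)] Xs'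
          using mint_comp_same[OF p(4) _ _ one(7) two(7)[folded 3(1,2)]] one(1) lenC less 3(1,2)
            mint_comp_same[OF p(2)[OF one(1)] one(2) 3(3) one(5) two(5)[folded 3(1,2)]]
            in_map[OF one(1)] Cs_nth[OF one(1)] v(3) v(4)[OF one(1)] by simp
        ultimately show ?thesis by simp
      qed
    qed
  qed
qed

end

section \<open>The action of functors on cones\<close>

lemma category_hom_cat:
  assumes "f_category S" "H \<subseteq> Loose S"
  shows "category (hom_cat S H)"
proof -
  interpret f_category S by fact
  have H: "f \<in> H \<Longrightarrow> f \<in> Loose S" for f using assms(2) by auto
  show ?thesis
    by unfold_locales
      (auto simp: hom_cat_def Let_def H id2_props vcomp_props vcomp_id_left vcomp_id_right vcomp_assoc')
qed

text \<open>Fullness is local fullness of the tight sub-2-category: \<open>hom_cat\<close> retains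
  all 2-cells between the chosen 1-cells, tight or not.\<close>

lemma full_embedding_hom_emb:
  assumes "f_category S"
  shows "full_embedding (hom_emb S X Y)"
proof -
  interpret f_category S by fact
  have sub: "tight_hom S X Y \<subseteq> loose_hom S X Y"
    using tight_loose by (auto simp: tight_hom_def loose_hom_def)
  have L: "loose_hom S X Y \<subseteq> Loose S" by (auto simp: loose_hom_def)
  have sub': "f \<in> loose_hom S X Y" if "f \<in> tight_hom S X Y" for f using that sub by auto
  have id: "f \<in> loose_hom S X Y \<Longrightarrow> f \<in> Loose S" for f using L by auto
  interpret T: category "hom_cat S (tight_hom S X Y)"
    using sub L by (intro category_hom_cat assms) auto
  interpret L: category "hom_cat S (loose_hom S X Y)" by (rule category_hom_cat[OF assms L])
  have "cat_functor (hom_cat S (tight_hom S X Y)) (hom_cat S (loose_hom S X Y)) (cfun_id (hom_cat S (tight_hom S X Y)))"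
    by unfold_locales
      (auto simp: hom_cat_def cfun_id_def Let_def sub' id id2_props vcomp_props)
  moreover have "fully_faithful (hom_cat S (tight_hom S X Y)) (hom_cat S (loose_hom S X Y))
      (cfun_id (hom_cat S (tight_hom S X Y)))"
    unfolding fully_faithful_def
    by (auto simp: hom_cat_def cfun_id_def Let_def bij_betw_def inj_on_def image_iff sub')
  ultimately show ?thesis
    by (simp add: full_embedding_def hom_emb_def inj_on_def) (auto simp: cfun_id_def)
qed

text \<open>Membership in \<open>FF_loose\<close> is the form in which composition in
  \<open>FF\<close> asks for its arguments.\<close>

lemma hom_action_loose:
  assumes "f_functor A B F" "X \<in> Obj A" "Y \<in> Obj A"
  shows "hom_action A B F X Y \<in> FF_loose"
proof -
  interpret f_functor A B F by fact
  have L: "loose_hom C X Y \<subseteq> Loose C" for C X Y by (auto simp: loose_hom_def)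
  have l: "f \<in> loose_hom C X Y \<Longrightarrow> f \<in> Loose C" for f C X Y by (auto simp: loose_hom_def)
  have m: "f \<in> loose_hom A X Y \<Longrightarrow> farr F f \<in> loose_hom B (fobj F X) (fobj F Y)" for f
    using map_loose by (auto simp: loose_hom_def)
  interpret HA: category "hom_cat A (loose_hom A X Y)" by (rule category_hom_cat[OF A.f_category_axioms L])
  interpret HB: category "hom_cat B (loose_hom B (fobj F X) (fobj F Y))" by (rule category_hom_cat[OF B.f_category_axioms L])
  have "cat_functor (hom_cat A (loose_hom A X Y)) (hom_cat B (loose_hom B (fobj F X) (fobj F Y)))
     \<lparr>cobj = restrict (farr F) (CObj (lam (hom_emb A X Y))), carr = restrict (fcell F) (CArr (lam (hom_emb A X Y)))\<rparr>"
    by unfold_locales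
      (auto simp: hom_cat_def hom_emb_def Let_def m l[of _ A] map_cell_props map_id2 A.id2_props
        A.vcomp_props map_vcomp')
  then show ?thesis
    by (simp add: FF_loose_def hom_action_def full_embedding_hom_emb A.f_category_axioms B.f_category_axioms)
      (simp add: hom_emb_def)
qed

lemma FF_sel:
  "f \<in> FF_loose \<Longrightarrow> fdom FF f = fst f" "f \<in> FF_loose \<Longrightarrow> fcod FF f = fst (snd f)"
  "Loose FF = FF_loose" "comp1 FF = FF_comp1"
  by (simp_all add: FF_def)

text \<open>Functoriality of the action on hom-objects; composing with the legs turns it into
  functoriality on cones.\<close>

lemma hom_action_comp:
  assumes F: "f_functor S C F" and G: "f_functor C D G" and X: "X \<in> Obj S" and Y: "Y \<in> Obj S"
  shows "comp1 FF (hom_action C D G (fobj F X) (fobj F Y)) (hom_action S C F X Y)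
    = hom_action S D (ffun_comp S G F) X Y"
proof -
  interpret F: f_functor S C F by fact
  interpret G: f_functor C D G by fact
  have l: "hom_action S C F X Y \<in> FF_loose" "hom_action C D G (fobj F X) (fobj F Y) \<in> FF_loose"
    using X Y by (auto intro: hom_action_loose F G F.map_obj)
  have m: "f \<in> loose_hom S X Y \<Longrightarrow> farr F f \<in> loose_hom C (fobj F X) (fobj F Y)" for f
    using F.map_loose by (auto simp: loose_hom_def)
  have "cfun_comp (lam (hom_emb S X Y))
      \<lparr>cobj = restrict (farr G) (CObj (lam (hom_emb C (fobj F X) (fobj F Y)))),
       carr = restrict (fcell G) (CArr (lam (hom_emb C (fobj F X) (fobj F Y))))\<rparr>
      \<lparr>cobj = restrict (farr F) (CObj (lam (hom_emb S X Y))),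
       carr = restrict (fcell F) (CArr (lam (hom_emb S X Y)))\<rparr>
    = \<lparr>cobj = restrict (farr (ffun_comp S G F)) (CObj (lam (hom_emb S X Y))),
       carr = restrict (fcell (ffun_comp S G F)) (CArr (lam (hom_emb S X Y)))\<rparr>"
    by (auto simp: cfun_comp_def hom_emb_def hom_cat_def Let_def fun_eq_iff compose_def m F.map_cell_props
        ffun_comp_sel) (auto simp: loose_hom_def ffun_comp_sel)
  then show ?thesis using l X Y by (simp add: FF_sel hom_action_def ffun_comp_sel)
qed

lemma hom_action_id:
  assumes "f_category S" "X \<in> Obj S" "Y \<in> Obj S"
  shows "hom_action S S (ffun_id S) X Y = id1 FF (hom_emb S X Y)"
proof -
  have "restrict (farr (ffun_id S)) (CObj (lam (hom_emb S X Y))) = restrict id (CObj (lam (hom_emb S X Y)))"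
    "restrict (fcell (ffun_id S)) (CArr (lam (hom_emb S X Y))) = restrict id (CArr (lam (hom_emb S X Y)))"
    by (auto simp: hom_emb_def hom_cat_def Let_def ffun_id_def fun_eq_iff loose_hom_def)
  then show ?thesis using assms full_embedding_hom_emb[OF assms(1), of X Y]
    by (simp add: FF_def hom_action_def cfun_id_def) (simp add: ffun_id_def)
qed

text \<open>A weight is a functor to \<open>FF\<close>, which therefore is an \<open>\<F>\<close>-category as soon as there is a cone.\<close>
lemma weighted_cone_FF: "weighted_cone S (c :: 'u wcone) \<Longrightarrow> f_category (FF :: ('u femb, 'u floose, 'u fcell2) fcat)"
  by (simp add: weighted_cone_def f_functor_def)

lemma weighted_cone_leg:
  fixes c :: "'u wcone"
  assumes "weighted_cone S c" "j \<in> Obj (shape c)"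
  shows "leg c j \<in> FF_loose" "fcod FF (leg c j) = hom_emb S (apex c) (fobj (diagram c) j)"
    "fobj (diagram c) j \<in> Obj S"
proof -
  interpret FF: f_category "FF :: ('u femb, 'u floose, 'u fcell2) fcat" using assms(1) by (rule weighted_cone_FF)
  interpret D: f_functor "shape c" S "diagram c" using assms(1) by (simp add: weighted_cone_def)
  show "fobj (diagram c) j \<in> Obj S" by (rule D.map_obj) fact
  moreover have "leg c j \<in> tight_hom FF (fobj (weight c) j)
      (fobj (ffun_comp (shape c) (hom_functor S (apex c)) (diagram c)) j)"
    using assms by (simp add: weighted_cone_def f_natural_def)
  ultimately have "leg c j \<in> tight_hom FF (fobj (weight c) j) (hom_emb S (apex c) (fobj (diagram c) j))"
    using assms(2) by (simp add: ffun_comp_sel) (simp add: hom_functor_def)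
  then show "leg c j \<in> FF_loose" "fcod FF (leg c j) = hom_emb S (apex c) (fobj (diagram c) j)"
    using FF.tight_loose by (auto simp: tight_hom_def FF_sel)
qed

lemma wcone_eqI:
  fixes c d :: "'u wcone"
  shows "\<lbrakk>shape c = shape d; weight c = weight d; diagram c = diagram d; apex c = apex d; leg c = leg d\<rbrakk> \<Longrightarrow> c = d"
  by simp

text \<open>On legs this combines functoriality of the action on hom-objects with associativity of
  composition in \<open>FF\<close>.\<close>

lemma map_cone_comp:
  fixes c :: "'u wcone"
  assumes c: "weighted_cone S c" and F: "f_functor S C F" and G: "f_functor C D G"
  shows "map_cone S D (ffun_comp S G F) c = map_cone C D G (map_cone S C F c)"
proof (rule wcone_eqI)
  interpret FF: f_category "FF :: ('u femb, 'u floose, 'u fcell2) fcat" using c by (rule weighted_cone_FF)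
  interpret F: f_functor S C F by fact
  interpret G: f_functor C D G by fact
  have D: "f_functor (shape c) S (diagram c)" and X: "apex c \<in> Obj S"
    using c by (auto simp: weighted_cone_def)
  show "diagram (map_cone S D (ffun_comp S G F) c) = diagram (map_cone C D G (map_cone S C F c))"
    by (simp add: map_cone_def ffun_comp_assoc[OF D])
  show "apex (map_cone S D (ffun_comp S G F) c) = apex (map_cone C D G (map_cone S C F c))"
    using X by (simp add: map_cone_def ffun_comp_sel)
  show "leg (map_cone S D (ffun_comp S G F) c) = leg (map_cone C D G (map_cone S C F c))"
  proof (rule ext)
    fix j
    show "leg (map_cone S D (ffun_comp S G F) c) j = leg (map_cone C D G (map_cone S C F c)) j"
    proof (cases "j \<in> Obj (shape c)")
      case True
      note l = weighted_cone_leg[OF c True]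
      let ?F = "hom_action S C F (apex c) (fobj (diagram c) j)"
      let ?G = "hom_action C D G (fobj F (apex c)) (fobj F (fobj (diagram c) j))"
      have "?F \<in> FF_loose" "?G \<in> FF_loose"
        using X l(3) by (auto intro: hom_action_loose F G F.map_obj)
      moreover have "fst ?F = hom_emb S (apex c) (fobj (diagram c) j)" "fst (snd ?F) = fst ?G"
        by (simp_all add: hom_action_def)
      ultimately have "comp1 FF (comp1 FF ?G ?F) (leg c j) = comp1 FF ?G (comp1 FF ?F (leg c j))"
        using l by (intro FF.comp1_assoc') (simp_all add: FF_sel)
      then show ?thesis using True hom_action_comp[OF F G X l(3)]
        by (simp add: map_cone_def ffun_comp_sel)
    qed (simp add: map_cone_def)
  qed
qed (simp_all add: map_cone_def)

text \<open>On legs this is the left unit law in \<open>FF\<close>. Extensionality of the legs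
  settles the values off the shape.\<close>

lemma map_cone_id:
  fixes c :: "'u wcone"
  assumes S: "f_category S" and c: "weighted_cone S c"
  shows "map_cone S S (ffun_id S) c = c"
proof (rule wcone_eqI)
  interpret FF: f_category "FF :: ('u femb, 'u floose, 'u fcell2) fcat" using c by (rule weighted_cone_FF)
  have D: "f_functor (shape c) S (diagram c)" and X: "apex c \<in> Obj S"
    and leg_ext: "leg c \<in> extensional (Obj (shape c))"
    using c by (auto simp: weighted_cone_def f_natural_def)
  show "diagram (map_cone S S (ffun_id S) c) = diagram c"
    using ffun_comp_id_left[OF D] by (simp add: map_cone_def)
  show "apex (map_cone S S (ffun_id S) c) = apex c" using X by (simp add: map_cone_def ffun_id_def)
  show "leg (map_cone S S (ffun_id S) c) = leg c"
  proof (rule ext)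
    fix j
    show "leg (map_cone S S (ffun_id S) c) j = leg c j"
    proof (cases "j \<in> Obj (shape c)")
      case True
      note l = weighted_cone_leg[OF c True]
      show ?thesis using True FF.comp1_id_left[of "leg c j"] l
        by (simp add: map_cone_def hom_action_id[OF S X l(3)] FF_sel(3))
    qed (simp add: map_cone_def extensional_arb[OF leg_ext])
  qed
qed (simp_all add: map_cone_def)

lemma sketch_morphism_id: "f_sketch S \<Longrightarrow> sketch_morphism S S (ffun_id (und S))"
  by (simp add: sketch_morphism_def f_functor_id f_sketch_def map_cone_id)

lemma sketch_morphism_comp:
  assumes "sketch_morphism S C F" "sketch_morphism C D G"
  shows "sketch_morphism S D (ffun_comp (und S) G F)"
  using assms map_cone_comp[of "und S" _ "und C" F "und D" G]
  by (auto simp: sketch_morphism_def f_functor_comp f_sketch_def)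

text \<open>An empty sketch has no cones, since a cone has an apex.\<close>
lemma sketch_morphism_empty:
  assumes S: "f_sketch S" "Obj (und S) = {}" and C: "f_sketch C"
  shows "sketch_morphism S C \<lparr>fobj = \<lambda>_. undefined, farr = \<lambda>_. undefined, fcell = \<lambda>_. undefined\<rparr>"
proof -
  interpret S: f_category "und S" using S by (simp add: f_sketch_def)
  interpret C: f_category "und C" using C by (simp add: f_sketch_def)
  have e: "f \<notin> Loose (und S)" "\<alpha> \<notin> Cell (und S)" for f \<alpha>
    using S.dom_obj S.src_loose S(2) by auto
  moreover have "f \<notin> Tight (und S)" for f using e S.tight_loose by auto
  ultimately have "f_functor (und S) (und C) \<lparr>fobj = \<lambda>_. undefined, farr = \<lambda>_. undefined, fcell = \<lambda>_. undefined\<rparr>"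
    by unfold_locales (auto simp: S(2) extensional_def composable1_def vcomposable_def hcomposable_def)
  moreover have "cones S = {}" using S by (auto simp: f_sketch_def weighted_cone_def)
  ultimately show ?thesis using S C by (simp add: sketch_morphism_def)
qed

section \<open>The multicategories\<close>

lemma mfun_composite_FCAT:
  "mcomposable (FCAT_multi w' w) g fs \<Longrightarrow> mfun_composite w' w g fs"
  by (auto simp: mcomposable_def FCAT_multi_def intro!: mfun_composite.intro mfun_composite_axioms.intro)

lemma multicategory_FCAT: "multicategory (FCAT_multi w' w :: ('u sfcat, 'u mfun) multicat)"
proof (rule multicategory.intro, goal_cases)
  case (1 f)
  then show ?case by (auto simp: FCAT_multi_def multifunctor.src_cat)
next
  case (2 f)
  then show ?case by (auto simp: FCAT_multi_def multifunctor.trg_cat)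
next
  case (3 A)
  then show ?case by (simp add: FCAT_multi_def multifunctor_id)
next
  case (4 g fs)
  then show ?case using mfun_composite.multifunctor_comp[OF mfun_composite_FCAT[OF 4]]
    by (simp add: FCAT_multi_def)
next
  case (5 f)
  then show ?case using mfun_comp_id_left[of w' w f] by (simp add: FCAT_multi_def)
next
  case (6 f)
  then show ?case using mfun_comp_id_right[of w' w f] by (simp add: FCAT_multi_def)
next
  case (7 g fs hss)
  have "mfun_composite_twice w' w g fs hss"
    using 7(2) by (intro mfun_composite_twice.intro mfun_composite_FCAT[OF 7(1)] mfun_composite_twice_axioms.intro
        mfun_composite_FCAT) (auto simp: list_all2_conv_all_nth)
  then show ?case using mfun_composite_twice.mfun_comp_assoc by (fastforce simp: FCAT_multi_def)
qed

section \<open>Multimodels as multimorphisms\<close>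

lemma mmodel_eqI:
  fixes P Q :: "'u mmodel"
  shows "\<lbrakk>sk_src P = sk_src Q; sk_trg P = sk_trg Q; mult P = mult Q\<rbrakk> \<Longrightarrow> P = Q"
  by simp

text \<open>Names the identity of \<open>FSK_multi\<close>, as \<open>model_comp\<close> names its
  composition, so that simplification keeps these operations folded.\<close>

definition model_id :: "'u sketch \<Rightarrow> 'u mmodel" where
  "model_id S = \<lparr>sk_src = [S], sk_trg = S, mult = mfun_id (und S)\<rparr>"

definition model_comp :: "'u mmodel \<Rightarrow> 'u mmodel list \<Rightarrow> 'u mmodel" where
  "model_comp Q Ps = \<lparr>sk_src = concat (map sk_src Ps), sk_trg = sk_trg Q, mult = mfun_comp (mult Q) (map mult Ps)\<rparr>"

lemma FSK_multi_sel [simp]: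
  "MObj (FSK_multi w' w) = Collect f_sketch" "MArr (FSK_multi w' w) = Collect (multimodel w' w)"
  "Msrc (FSK_multi w' w) = sk_src" "Mtrg (FSK_multi w' w) = sk_trg"
  "Mid (FSK_multi w' w) = model_id" "Mcomp (FSK_multi w' w) = model_comp"
  by (auto simp: FSK_multi_def model_id_def model_comp_def fun_eq_iff)

lemma FCAT_multi_sel [simp]:
  "MObj (FCAT_multi w' w) = Collect f_category" "MArr (FCAT_multi w' w) = Collect (multifunctor w' w)"
  "Msrc (FCAT_multi w' w) = msrc" "Mtrg (FCAT_multi w' w) = mtrg"
  "Mid (FCAT_multi w' w) = mfun_id" "Mcomp (FCAT_multi w' w) = mfun_comp"
  by (simp_all add: FCAT_multi_def)

lemma mcomposable_mult:
  assumes "mcomposable (FSK_multi w' w) Q Ps"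
  shows "mcomposable (FCAT_multi w' w) (mult Q) (map mult Ps)"
proof -
  have "map und (map sk_trg Ps) = map mtrg (map mult Ps)"
    using assms by (auto simp: mcomposable_def multimodel_def)
  then show ?thesis using assms by (auto simp: mcomposable_def multimodel_def)
qed

lemma slice_id: "f_category A \<Longrightarrow> length Xs = 1 \<Longrightarrow> slice (mfun_id A) 0 Xs = ffun_id A"
  by (simp add: mfun_id_unary slice_unary f_functor_id)

lemma multimodel_id: "f_sketch S \<Longrightarrow> multimodel w' w (model_id S)"
  by (auto simp: multimodel_def model_id_def f_sketch_def multifunctor_id slice_id obj_tuples_length
      intro!: sketch_morphism_id)

lemma multimodel_comp:
  assumes c: "mcomposable (FSK_multi w' w) Q Ps"
  shows "multimodel w' w (model_comp Q Ps)"
proof -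
  interpret C: mfun_composite w' w "mult Q" "map mult Ps"
    by (rule mfun_composite_FCAT[OF mcomposable_mult[OF c]])
  have Q: "multimodel w' w Q" and Ps: "P \<in> set Ps \<Longrightarrow> multimodel w' w P" and trg: "sk_src Q = map sk_trg Ps" for P
    using c by (auto simp: mcomposable_def)
  have src: "map und (concat (map sk_src Ps)) = concat (map msrc (map mult Ps))"
    using Ps by (auto simp: map_concat multimodel_def intro!: arg_cong[where f = concat])
  \<comment> \<open>The source sketches and the sources of the underlying multifunctors are cut into
    blocks of the same lengths, so a place has the same coordinates in both lists.\<close>
  have len: "map length (map sk_src Ps) = map (length \<circ> msrc) (map mult Ps)"
    using Ps by (auto simp: multimodel_def)
  have "sketch_morphism (concat (map sk_src Ps) ! p) (sk_trg Q) (slice (mfun_comp (mult Q) (map mult Ps)) p Xs)"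
    if p: "p < length (concat (map sk_src Ps))" and Xs: "Xs \<in> obj_tuples (map und (concat (map sk_src Ps)))" for p Xs
  proof -
    obtain Xss where X: "Xss \<in> families (map mult Ps)" "Xs = concat Xss"
      using Xs unfolding src by (rule families_cases)
    have "p < length (concat (map msrc (map mult Ps)))" using p unfolding src[symmetric] by simp
    then obtain a i where ai: "a < length (map mult Ps)" "i < length (msrc (map mult Ps ! a))" "p = mplace (map mult Ps) a i"
      by (rule mplace_cases)
    then have a: "a < length Ps" by simp
    have P: "multimodel w' w (Ps ! a)" using a Ps by simp
    have i: "i < length (sk_src (Ps ! a))" using ai a P by (simp add: multimodel_def)
    have nth: "concat (map sk_src Ps) ! p = sk_src (Ps ! a) ! i"
      using nth_concat_place[of a "map sk_src Ps" i] a i unfolding ai(3) len by simp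
    have "sketch_morphism (sk_src (Ps ! a) ! i) (sk_trg (Ps ! a)) (slice (mult (Ps ! a)) i (Xss ! a))"
      using P i families_nth[OF X(1) ai(1)] a by (simp add: multimodel_def)
    moreover have "sketch_morphism (sk_trg (Ps ! a)) (sk_trg Q) (slice (mult Q) a (part_values (map mult Ps) Xss))"
      using Q C.values_tuple[OF X(1)] a trg by (simp add: multimodel_def)
    ultimately have "sketch_morphism (sk_src (Ps ! a) ! i) (sk_trg Q)
        (ffun_comp (und (sk_src (Ps ! a) ! i)) (slice (mult Q) a (part_values (map mult Ps) Xss))
          (slice (mult (Ps ! a)) i (Xss ! a)))"
      by (rule sketch_morphism_comp)
    moreover have "msrc (mult (Ps ! a)) ! i = und (sk_src (Ps ! a) ! i)" using P i by (simp add: multimodel_def)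
    ultimately show ?thesis using C.slice_comp[OF X(1) ai(1,2)] a unfolding nth unfolding X(2) ai(3) by simp
  qed
  then show ?thesis
    using Q Ps src C.multifunctor_comp by (auto simp: multimodel_def model_comp_def)
qed

text \<open>On \<open>mult\<close> the laws are those already proved for multifunctors; what remains
  is bookkeeping with the lists of sketches.\<close>

lemma multicategory_FSK: "multicategory (FSK_multi w' w :: ('u sketch, 'u mmodel) multicat)"
proof -
  interpret FCAT: multicategory "FCAT_multi w' w :: ('u sfcat, 'u mfun) multicat" by (rule multicategory_FCAT)
  show ?thesis
  proof (rule multicategory.intro, goal_cases)
    case (1 f)
    then show ?case by (auto simp: multimodel_def)
  next
    case (2 f)
    then show ?case by (auto simp: multimodel_def)
  next
    case (3 S)
    then show ?case using multimodel_id[of S w' w] by (simp add: model_id_def)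
  next
    case (4 g fs)
    then show ?case using multimodel_comp[OF 4] by (simp add: model_comp_def)
  next
    case (5 P)
    then show ?case using FCAT.comp_id_left[of "mult P"]
      by (intro mmodel_eqI) (simp_all add: model_id_def model_comp_def multimodel_def)
  next
    case (6 P)
    then have "map mfun_id (msrc (mult P)) = map (mult \<circ> model_id) (sk_src P)"
      by (auto simp: multimodel_def model_id_def)
    then show ?case using 6 FCAT.comp_id_right[of "mult P"]
      by (intro mmodel_eqI) (auto simp: model_id_def model_comp_def multimodel_def comp_def)
  next
    case (7 g fs hss)
    have len: "length fs = length hss" using 7(2) by (auto dest: list_all2_lengthD)
    have a: "list_all2 (mcomposable (FCAT_multi w' w)) (map mult fs) (map (map mult) hss)"
      using 7(2) by (auto simp: list_all2_conv_all_nth mcomposable_mult)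
    have "map mult (map2 model_comp fs hss) = map2 mfun_comp (map mult fs) (map (map mult) hss)"
      "map sk_src (map2 model_comp fs hss) = map (\<lambda>hs. concat (map sk_src hs)) hss"
      by (rule nth_equalityI; simp add: model_comp_def len)+
    then show ?case using FCAT.comp_assoc[OF mcomposable_mult[OF 7(1)] a]
      by (intro mmodel_eqI) (simp_all add: model_comp_def map_concat concat_concat comp_def)
  qed
qed

lemma multicat_functor_forget:
  "multicat_functor (FSK_multi w' w :: ('u sketch, 'u mmodel) multicat) (FCAT_multi w' w) forget"
  by (intro multicat_functor.intro multicat_functor_axioms.intro multicategory_FSK multicategory_FCAT)
    (auto simp: forget_def f_sketch_def multi_hom_def multimodel_def model_id_def model_comp_def)

section \<open>Free sketches and the adjunction\<close>

definition free_sketch :: "'u sfcat \<Rightarrow> 'u sketch" where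
  "free_sketch A = \<lparr>und = A, cones = {}\<rparr>"

definition free_model :: "'u mfun \<Rightarrow> 'u mmodel" where
  "free_model M = \<lparr>sk_src = map free_sketch (msrc M), sk_trg = free_sketch (mtrg M), mult = M\<rparr>"

lemma und_free_sketch [simp]: "und (free_sketch A) = A" "und \<circ> free_sketch = id"
  by (auto simp: free_sketch_def)

lemma f_sketch_free [simp]: "f_sketch (free_sketch A) \<longleftrightarrow> f_category A"
  by (simp add: f_sketch_def free_sketch_def)

text \<open>There are no cones to preserve, so functoriality is the whole condition. This is the
  universal property of the free sketch.\<close>

lemma sketch_morphism_free:
  "f_sketch S \<Longrightarrow> sketch_morphism (free_sketch A) S F \<longleftrightarrow> f_functor A (und S) F"
  by (auto simp: sketch_morphism_def f_functor_def) (simp_all add: free_sketch_def)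

text \<open>The target may be any sketch over \<open>mtrg M\<close>; this generality provides the
  counit, whose target need not be free.\<close>

lemma multimodel_free:
  assumes "multifunctor w' w M" "f_sketch T" "mtrg M = und T"
  shows "multimodel w' w \<lparr>sk_src = map free_sketch (msrc M), sk_trg = T, mult = M\<rparr>"
  using assms multifunctor.slice_functor[OF assms(1)] multifunctor.src_cat[OF assms(1)]
  by (auto simp: multimodel_def sketch_morphism_free)

lemma multimodel_free_model: "multifunctor w' w M \<Longrightarrow> multimodel w' w (free_model M)"
  unfolding free_model_def by (rule multimodel_free) (simp_all add: multifunctor.trg_cat)

lemma multicat_functor_free:
  "multicat_functor (FCAT_multi w' w :: ('u sfcat, 'u mfun) multicat) (FSK_multi w' w) (free_sketch, free_model)"
  by (intro multicat_functor.intro multicat_functor_axioms.intro multicategory_FSK multicategory_FCAT)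
    (auto simp: multi_hom_def multimodel_free_model,
      auto simp: free_model_def model_id_def model_comp_def map_concat comp_def)

text \<open>Unit and counit have identity multifunctors underneath, so naturality and the triangle
  identities reduce to the unit laws of substitution.\<close>

lemma free_sketch_left_adjoint:
  "multicat_left_adjoint (FCAT_multi w' w :: ('u sfcat, 'u mfun) multicat) (FSK_multi w' w)
    (free_sketch, free_model) forget"
proof -
  interpret FCAT: multicategory "FCAT_multi w' w :: ('u sfcat, 'u mfun) multicat" by (rule multicategory_FCAT)
  \<comment> \<open>The counit: the identity multifunctor, regarded as a multimodel from the free
    sketch on \<open>und S\<close> to \<open>S\<close>.\<close>
  let ?\<epsilon> = "\<lambda>S :: 'u sketch. \<lparr>sk_src = [free_sketch (und S)], sk_trg = S, mult = mfun_id (und S)\<rparr>"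
  have id2: "mfun_comp (mfun_id A) [mfun_id A] = mfun_id A" if "f_category A" for A :: "'u sfcat"
    using mfun_comp_id_left[OF multifunctor_id[OF that]] by simp
  have \<epsilon>: "multimodel w' w (?\<epsilon> S)" if "f_sketch S" for S
    using multimodel_free[of w' w "mfun_id (und S)" S] that by (simp add: multifunctor_id f_sketch_def)
  have "multicat_natural (FCAT_multi w' w :: ('u sfcat, 'u mfun) multicat) (FCAT_multi w' w) (id, id)
      (fst forget \<circ> fst (free_sketch, free_model), snd forget \<circ> snd (free_sketch, free_model)) mfun_id"
    using mfun_comp_id_left mfun_comp_id_right
    by (fastforce simp: multicat_natural_def multi_hom_def forget_def free_model_def multifunctor_id)
  moreover have "multicat_natural (FSK_multi w' w :: ('u sketch, 'u mmodel) multicat) (FSK_multi w' w)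
      (fst (free_sketch, free_model) \<circ> fst forget, snd (free_sketch, free_model) \<circ> snd forget) (id, id) ?\<epsilon>"
    unfolding multicat_natural_def
  proof (intro conjI ballI, goal_cases)
    case (1 S)
    then show ?case using \<epsilon>[of S] by (simp add: multi_hom_def forget_def)
  next
    case (2 P)
    then have P: "multifunctor w' w (mult P)" "msrc (mult P) = map und (sk_src P)" "mtrg (mult P) = und (sk_trg P)"
      by (auto simp: multimodel_def)
    then show ?case using mfun_comp_id_left[OF P(1)] mfun_comp_id_right[OF P(1)]
      by (simp add: forget_def free_model_def model_comp_def comp_def concat_map_singleton)
  qed
  ultimately show ?thesis
    unfolding multicat_left_adjoint_def
    by (intro conjI multicat_functor_free multicat_functor_forget exI[of _ mfun_id] exI[of _ ?\<epsilon>])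
      (auto simp: forget_def free_model_def model_comp_def model_id_def id2 f_sketch_def)
qed

text \<open>Once its source and target sketches are fixed, a multimodel is determined by its
  multifunctor, so \<open>mult\<close> is the inverse on each hom set.\<close>

lemma free_sketch_fully_faithful:
  "multicat_fully_faithful (FCAT_multi w' w :: ('u sfcat, 'u mfun) multicat) (FSK_multi w' w)
    (free_sketch, free_model)"
  unfolding multicat_fully_faithful_def
proof (intro allI impI)
  fix As :: "'u sfcat list" and B :: "'u sfcat"
  show "bij_betw (snd (free_sketch, free_model)) (multi_hom (FCAT_multi w' w) As B)
    (multi_hom (FSK_multi w' w) (map (fst (free_sketch, free_model)) As) (fst (free_sketch, free_model) B))"
    by (rule bij_betw_byWitness[where f' = mult])
      (auto simp: multi_hom_def multimodel_free_model, auto simp: free_model_def multimodel_def comp_def intro: mmodel_eqI)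
qed

section \<open>Unary multimodels\<close>

lemma category_underlying_cat:
  assumes "multicategory V"
  shows "category (underlying_cat V)"
proof -
  interpret multicategory V by fact
  have unary: "\<exists>X. Msrc V f = [X] \<and> X \<in> MObj V" if "f \<in> unary V" for f
    using that src_obj[of f] by (auto simp: unary_def length_Suc_conv)
  have arr: "f \<in> MArr V" if "f \<in> unary V" for f using that by (simp add: unary_def)
  have id: "Mid V X \<in> unary V" if "X \<in> MObj V" for X using id_arr[OF that] by (simp add: unary_def)
  have comp: "Mcomp V g [f] \<in> unary V \<and> Msrc V (Mcomp V g [f]) = Msrc V f \<and> Mtrg V (Mcomp V g [f]) = Mtrg V g
      \<and> mcomposable V g [f]"
    if "f \<in> unary V" "g \<in> unary V" "hd (Msrc V g) = Mtrg V f" for f g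
  proof -
    have "mcomposable V g [f]" using that unary[OF that(2)] by (auto simp: mcomposable_def arr)
    then show ?thesis using comp_arr[of g "[f]"] that(1) by (simp add: unary_def)
  qed
  show ?thesis
  proof (rule category.intro, goal_cases)
    case (1 f)
    then show ?case using unary[of f] by (auto simp: underlying_cat_def)
  next
    case (2 f)
    then show ?case using arr trg_obj by (simp add: underlying_cat_def)
  next
    case (3 X)
    then show ?case using id_arr[of X] id[of X] by (simp add: underlying_cat_def)
  next
    case (4 f g)
    then show ?case using comp[of f g] by (simp add: underlying_cat_def)
  next
    case (5 f)
    then have f: "f \<in> unary V" by (simp add: underlying_cat_def)
    then show ?case using comp_id_left[OF arr[OF f]] id_arr[OF trg_obj[OF arr[OF f]]] id[OF trg_obj[OF arr[OF f]]]
        trg_obj[OF arr[OF f]] by (simp add: underlying_cat_def)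
  next
    case (6 f)
    then have f: "f \<in> unary V" by (simp add: underlying_cat_def)
    obtain X where X: "Msrc V f = [X]" "X \<in> MObj V" using unary[OF f] by auto
    then show ?case using comp_id_right[OF arr[OF f]] id_arr[OF X(2)] id[OF X(2)] f by (simp add: underlying_cat_def)
  next
    case (7 f g h)
    then have u: "f \<in> unary V" "g \<in> unary V" "h \<in> unary V" "hd (Msrc V g) = Mtrg V f" "hd (Msrc V h) = Mtrg V g"
      by (simp_all add: underlying_cat_def)
    \<comment> \<open>Associativity of the multicategory at one-element lists.\<close>
    have "Mcomp V (Mcomp V h [g]) (concat [[f]]) = Mcomp V h (map2 (Mcomp V) [g] [[f]])"
      using comp[OF u(1,2,4)] comp[OF u(2,3,5)] by (intro comp_assoc) auto
    then show ?case using u comp[OF u(1,2,4)] comp[OF u(2,3,5)] by (simp add: underlying_cat_def)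
  qed (auto simp: underlying_cat_def)
qed

lemma category_FSK: "category (FSK :: ('u sketch, 'u sketch \<times> 'u sketch \<times> 'u sffun) cat)"
proof -
  have comp: "(S, D, ffun_comp (und S) G F) \<in> FSK_arr" if "(S, C, F) \<in> FSK_arr" "(C, D, G) \<in> FSK_arr"
    for S C D :: "'u sketch" and F G
    using that sketch_morphism_comp by (auto simp: FSK_arr_def)
  show ?thesis
  proof (rule category.intro, goal_cases)
    case (3 S)
    then show ?case using sketch_morphism_id[of S] by (simp add: FSK_def FSK_arr_def)
  next
    case (4 f g)
    obtain S C F where f: "f = (S, C, F)" by (cases f) auto
    obtain C' D G where g: "g = (C', D, G)" by (cases g) auto
    show ?case using 4 comp[of S C F D G] by (simp add: FSK_def f g)
  next
    case (5 f)
    obtain S C F where f: "f = (S, C, F)" by (cases f) auto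
    then show ?case using 5 sketch_morphism_id[of C] ffun_comp_id_left[of "und S" "und C" F]
      by (auto simp: FSK_def FSK_arr_def sketch_morphism_def)
  next
    case (6 f)
    obtain S C F where f: "f = (S, C, F)" by (cases f) auto
    then show ?case using 6 sketch_morphism_id[of S] ffun_comp_id_right[of "und S" "und C" F]
      by (auto simp: FSK_def FSK_arr_def sketch_morphism_def)
  next
    case (7 f g h)
    obtain S C F where f: "f = (S, C, F)" by (cases f) auto
    obtain C' D G where g: "g = (C', D, G)" by (cases g) auto
    obtain D' E H where h: "h = (D', E, H)" by (cases h) auto
    have arrs: "(S, C, F) \<in> FSK_arr" "(C, D, G) \<in> FSK_arr" "(D, E, H) \<in> FSK_arr" "C' = C" "D' = D"
      using 7 by (auto simp: FSK_def f g h)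
    have "f_functor (und S) (und C) F" using arrs by (simp add: FSK_arr_def sketch_morphism_def)
    then show ?case using arrs comp[OF arrs(1,2)] comp[OF arrs(2,3)] ffun_comp_assoc
      by (auto simp: FSK_def f g h)
  next
    case (11 f g)
    then show ?case by (cases f; cases g) (auto simp: FSK_def)
  qed (auto simp: FSK_def FSK_arr_def sketch_morphism_def)
qed

lemma slice_unary_comp:
  assumes "mfun_composite w' w N [M]" "msrc M = [A]"
  shows "slice (mfun_comp N [M]) 0 [undefined] = ffun_comp A (slice N 0 [undefined]) (slice M 0 [undefined])"
proof -
  interpret C: mfun_composite w' w N "[M]" by fact
  interpret M: multifunctor w' w M using C.parts by simp
  interpret A: f_category A using M.src_cat assms(2) by simp
  \<comment> \<open>The formula for slices of a composite needs an object tuple. If \<open>A\<close>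
    has no objects there is none, but then all slices involved are \<open>undefined\<close>
    everywhere.\<close>
  show ?thesis
  proof (cases "Obj A = {}")
    case True
    then have "Loose A = {}" "Cell A = {}" using A.dom_obj A.src_loose by auto
    then show ?thesis using True assms(2) by (simp add: slice_def ffun_comp_def compose_def Let_def restrict_def)
  next
    case False
    then obtain X where X: "X \<in> Obj A" by auto
    have f: "[[X]] \<in> families [M]" using X assms(2) by (simp add: families_def obj_tuples_single)
    have u: "slice K 0 [undefined] = slice K 0 [Y]" for K :: "'a mfun" and Y
      using slice_update[of K 0 "[undefined]" Y] by simp
    show ?thesis using C.slice_comp[OF f, of 0 0] assms(2)
      by (simp add: place_Cons u[of M X] u[of N "mobj M [X]"] u[of "mfun_comp N [M]" X])
  qed
qed

text \<open>The definition of a multimodel tests slices at object tuples only. When the source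
  sketch has no objects that test is vacuous, and the slice is instead the everywhere undefined
  functor on an empty sketch.\<close>

lemma unary_FSK_cases:
  assumes "P \<in> unary (FSK_multi w' w)"
  obtains S where "sk_src P = [S]" "msrc (mult P) = [und S]" "mtrg (mult P) = und (sk_trg P)"
    "multifunctor w' w (mult P)" "f_sketch S" "f_sketch (sk_trg P)"
    "sketch_morphism S (sk_trg P) (slice (mult P) 0 [undefined])"
proof -
  have P: "multimodel w' w P" and "length (sk_src P) = 1" using assms by (auto simp: unary_def)
  then obtain S where S: "sk_src P = [S]" by (auto simp: length_Suc_conv)
  have m: "msrc (mult P) = [und S]" "mtrg (mult P) = und (sk_trg P)" "multifunctor w' w (mult P)"
    "f_sketch S" "f_sketch (sk_trg P)"
    using P S by (auto simp: multimodel_def)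
  have "sketch_morphism S (sk_trg P) (slice (mult P) 0 [undefined])"
  proof (cases "Obj (und S) = {}")
    case True
    interpret A: f_category "und S" using m by (simp add: f_sketch_def)
    have "Loose (und S) = {}" "Cell (und S) = {}" using True A.dom_obj A.src_loose by auto
    then have "slice (mult P) 0 [undefined]
        = \<lparr>fobj = \<lambda>_. undefined, farr = \<lambda>_. undefined, fcell = \<lambda>_. undefined\<rparr>"
      using True m by (simp add: slice_def Let_def restrict_def)
    then show ?thesis using sketch_morphism_empty[OF m(4) True m(5)] by simp
  next
    case False
    then obtain X where "X \<in> Obj (und S)" by auto
    then have "sketch_morphism S (sk_trg P) (slice (mult P) 0 [X])"
      using P S by (simp add: multimodel_def obj_tuples_single)
    then show ?thesis using slice_update[of "mult P" 0 "[undefined]" X] by simp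
  qed
  then show thesis using that S m by blast
qed

text \<open>With a single place there are no interchange cells, and the other data are those of the
  slice; extensionality upgrades this to equality.\<close>

lemma mfun_unary_slice:
  assumes "multifunctor w' w M" "msrc M = [A]"
  shows "mfun_unary A (mtrg M) (slice M 0 [undefined]) = M"
proof -
  interpret M: multifunctor w' w M by fact
  interpret A: f_category A using M.src_cat assms(2) by simp
  define F where "F = slice M 0 [undefined]"
  have s: "slice M 0 [X] = F" for X
    using slice_update[of M 0 "[undefined]" X] by (simp add: F_def)
  have m: "mobj M Xs = (if Xs \<in> obj_tuples [A] then fobj F (hd Xs) else undefined)" for Xs
    using M.obj_ext[of Xs] assms(2) slice_sel(1)[of _ M 0 "[undefined]"]
    by (auto simp: obj_tuples_single F_def)
  have a: "marr M i Xs t = (if arr_dom [A] i Xs t then farr F t else undefined)" for i Xs t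
    using M.arr_ext[of i Xs t] M.marr_slice[of Xs i t] assms(2)
    by (auto simp: arr_dom_def obj_tuples_single s loose_at_def)
  have c: "mcell M i Xs \<alpha> = (if cell_dom [A] i Xs \<alpha> then fcell F \<alpha> else undefined)" for i Xs \<alpha>
    using M.cell_ext[of i Xs \<alpha>] M.mcell_slice[of Xs i \<alpha>] assms(2)
    by (auto simp: cell_dom_def obj_tuples_single s cell_at_def)
  have i: "mint M i j Xs t u = undefined" for i j Xs t u
    using M.int_ext[of i j Xs t u] assms(2) by (simp add: int_dom_def loose_at_def)
  show ?thesis
    unfolding F_def[symmetric] by (rule mfun_eqI) (auto simp: mfun_unary_def fun_eq_iff assms(2) m a c i)
qed

text \<open>Serves as the inverse of the action of \<open>unary_model\<close> on arrows.\<close>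

definition unary_of_morphism :: "'u sketch \<times> 'u sketch \<times> 'u sffun \<Rightarrow> 'u mmodel" where
  "unary_of_morphism = (\<lambda>(S, C, F). \<lparr>sk_src = [S], sk_trg = C, mult = mfun_unary (und S) (und C) F\<rparr>)"

lemma unary_of_morphism: "(S, C, F) \<in> FSK_arr \<Longrightarrow> unary_of_morphism (S, C, F) \<in> unary (FSK_multi w' w)"
  by (auto simp: FSK_arr_def sketch_morphism_def unary_of_morphism_def unary_def multimodel_def
      multifunctor_unary slice_unary obj_tuples_single)

text \<open>Gives the precise sense in which the multicategory is a structure on the category of
  sketches: its unary part is that category, with objects kept fixed.\<close>

lemma unary_model_isomorphism:
  "cat_isomorphism (underlying_cat (FSK_multi w' w :: ('u sketch, 'u mmodel) multicat)) FSK (unary_model w' w)"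
  (is "cat_isomorphism ?U _ _")
proof -
  interpret V: multicategory "FSK_multi w' w :: ('u sketch, 'u mmodel) multicat" by (rule multicategory_FSK)
  interpret U: category ?U by (rule category_underlying_cat[OF multicategory_FSK])
  interpret FSK: category "FSK :: ('u sketch, 'u sketch \<times> 'u sketch \<times> 'u sffun) cat" by (rule category_FSK)
  let ?m = "\<lambda>P :: 'u mmodel. (hd (sk_src P), sk_trg P, slice (mult P) 0 [undefined])"
  have arr: "?m P \<in> FSK_arr" if "P \<in> unary (FSK_multi w' w)" for P
    using that by (rule unary_FSK_cases) (simp add: FSK_arr_def)
  have "cat_functor ?U FSK (unary_model w' w)"
  proof (unfold_locales, goal_cases)
    case (1 X)
    then show ?case by (simp add: underlying_cat_def unary_model_def FSK_def)
  next
    case (2 P)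
    then have P: "P \<in> unary (FSK_multi w' w)" by (simp add: underlying_cat_def)
    note a = arr[OF P]
    show ?case using P a V.src_obj[of P] V.trg_obj[of P]
      by (auto simp: underlying_cat_def unary_model_def FSK_def unary_def length_Suc_conv)
  next
    case (3 S)
    then have S: "f_sketch S" by (simp add: underlying_cat_def)
    have "model_id S \<in> unary (FSK_multi w' w)" using multimodel_id[OF S] by (simp add: unary_def model_id_def)
    then show ?case using S slice_id[of "und S" "[undefined]"]
      by (simp add: underlying_cat_def unary_model_def FSK_def) (simp add: model_id_def f_sketch_def)
  next
    case (4 P Q)
    then have PQ: "P \<in> unary (FSK_multi w' w)" "Q \<in> unary (FSK_multi w' w)" "hd (sk_src Q) = sk_trg P"
      by (simp_all add: underlying_cat_def)
    obtain S where P: "sk_src P = [S]" "msrc (mult P) = [und S]" using PQ(1) by (rule unary_FSK_cases)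
    have c: "mcomposable (FSK_multi w' w) Q [P]"
      using PQ by (auto simp: mcomposable_def unary_def length_Suc_conv)
    have "mfun_composite w' w (mult Q) [mult P]" using mfun_composite_FCAT[OF mcomposable_mult[OF c]] by simp
    from slice_unary_comp[OF this P(2)]
    have sl: "slice (mult (model_comp Q [P])) 0 [undefined]
        = ffun_comp (und S) (slice (mult Q) 0 [undefined]) (slice (mult P) 0 [undefined])"
      by (simp add: model_comp_def)
    have "model_comp Q [P] \<in> unary (FSK_multi w' w)"
      using multimodel_comp[OF c] P(1) by (simp add: unary_def) (simp add: model_comp_def)
    moreover have "hd (sk_src (model_comp Q [P])) = S" "sk_trg (model_comp Q [P]) = sk_trg Q"
      using P(1) by (simp_all add: model_comp_def)
    ultimately show ?case using PQ arr[OF PQ(1)] arr[OF PQ(2)] P(1) sl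
      by (simp add: underlying_cat_def unary_model_def FSK_def)
  qed (simp_all add: underlying_cat_def unary_model_def)
  moreover have "bij_betw (cobj (unary_model w' w)) (CObj ?U) (CObj FSK)"
    by (auto simp: unary_model_def underlying_cat_def FSK_def bij_betw_def inj_on_def)
  moreover have "bij_betw (carr (unary_model w' w)) (CArr ?U) (CArr FSK)"
  proof (rule bij_betw_byWitness[where f' = unary_of_morphism])
    show "\<forall>P\<in>CArr ?U. unary_of_morphism (carr (unary_model w' w) P) = P"
    proof
      fix P assume "P \<in> CArr ?U"
      then have P: "P \<in> unary (FSK_multi w' w)" by (simp add: underlying_cat_def)
      then show "unary_of_morphism (carr (unary_model w' w) P) = P"
      proof (rule unary_FSK_cases)
        fix S assume "sk_src P = [S]" "msrc (mult P) = [und S]" "mtrg (mult P) = und (sk_trg P)"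
          "multifunctor w' w (mult P)"
        then show ?thesis using P mfun_unary_slice[of w' w "mult P" "und S"]
          by (intro mmodel_eqI) (simp_all add: unary_model_def unary_of_morphism_def)
      qed
    qed
    show "\<forall>f\<in>CArr (FSK :: ('u sketch, 'u sketch \<times> 'u sketch \<times> 'u sffun) cat). carr (unary_model w' w) (unary_of_morphism f) = f"
    proof
      fix f :: "'u sketch \<times> 'u sketch \<times> 'u sffun"
      assume "f \<in> CArr FSK"
      then obtain S C F where f: "f = (S, C, F)" "(S, C, F) \<in> FSK_arr" by (cases f) (auto simp: FSK_def)
      then have "f_functor (und S) (und C) F" by (simp add: FSK_arr_def sketch_morphism_def)
      then show "carr (unary_model w' w) (unary_of_morphism f) = f"
        using unary_of_morphism[OF f(2), of w' w] f(1)
        by (simp add: unary_model_def) (simp add: unary_of_morphism_def slice_unary)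
    qed
    show "carr (unary_model w' w) ` CArr ?U \<subseteq> CArr FSK"
      using arr by (auto simp: unary_model_def underlying_cat_def FSK_def)
    show "unary_of_morphism ` CArr FSK \<subseteq> CArr ?U"
      using unary_of_morphism by (auto simp: underlying_cat_def FSK_def)
  qed
  ultimately show ?thesis by (simp add: cat_isomorphism_def)
qed

theorem proposition6p15:
  fixes w' w :: weakness
  assumes "w' \<le> w"
  shows "multicategory (FSK_multi w' w :: ('u sketch, 'u mmodel) multicat)
    \<and> cat_isomorphism (underlying_cat (FSK_multi w' w :: ('u sketch, 'u mmodel) multicat)) FSK (unary_model w' w)
    \<and> multicat_functor (FSK_multi w' w :: ('u sketch, 'u mmodel) multicat) (FCAT_multi w' w) forget
    \<and> (\<exists>sharp.
          multicat_left_adjoint (FCAT_multi w' w :: ('u sfcat, 'u mfun) multicat) (FSK_multi w' w) sharp forget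
        \<and> multicat_fully_faithful (FCAT_multi w' w :: ('u sfcat, 'u mfun) multicat) (FSK_multi w' w) sharp)"
  using multicategory_FSK unary_model_isomorphism multicat_functor_forget free_sketch_left_adjoint
    free_sketch_fully_faithful by blast

end
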